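(* Let $\boldsymbol K=(K,\oplus,\otimes)$ be the Shapley 2-monoid, let $Q$ be a fixed hierarchical self-join-free Boolean conjunctive query, let $\mathcal D^{\mathsf x}$ and $\mathcal D^{\mathsf n}$ be two disjoint database instances for $Q$ (the exogenous and endogenous parts of a database), and let $\psi(\mathcal D^{\mathsf x},\mathcal D^{\mathsf n})$ be the associated $\boldsymbol K$-annotated database instance. Then, using $Q$ and $\psi(\mathcal D^{\mathsf x},\mathcal D^{\mathsf n})$ as inputs, the Hierarchical Elimination Algorithm runs in time $O\big((|\mathcal D^{\mathsf x}|+|\mathcal D^{\mathsf n}|)\cdot|\mathcal D^{\mathsf n}|^2\big)$ and space $O\big((|\mathcal D^{\mathsf x}|+|\mathcal D^{\mathsf n}|)\cdot|\mathcal D^{\mathsf n}|\big)$, and outputs a vector $q\in K$ such that $$q(i,\mathsf{true})=\mathsf{\#Sat}_{Q,\mathcal D^{\mathsf x},\mathcal D^{\mathsf n}}(i)\qquad\text{for all } i\in\mathbb N.$$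
   Context: **Queries and databases.** An atom is $R(\boldsymbol X)$ with $R$ a relation symbol and $\boldsymbol X$ a finite set of variables. A self-join-free Boolean conjunctive query (SJF-BCQ) is $Q() \text{ :- } \bigwedge_{R(\boldsymbol X)\in \mathsf{at}(Q)} R(\boldsymbol X)$, with $\mathsf{at}(Q)$ a finite nonempty set of atoms with pairwise distinct relation symbols; $\mathsf{vars}(Q)$ is its set of variables and $\mathsf{at}(Y)$ is the set of atoms of $Q$ containing the variable $Y$. $Q$ is hierarchical if for all $X,Y\in\mathsf{vars}(Q)$: $\mathsf{at}(X)\subseteq\mathsf{at}(Y)$, or $\mathsf{at}(Y)\subseteq\mathsf{at}(X)$, or $\mathsf{at}(X)\cap\mathsf{at}(Y)=\emptyset$. $\mathsf{Dom}$ is a countably infinite domain; $\mathsf{Dom}^{\boldsymbol X}$ is the set of functions $\boldsymbol X\to\mathsf{Dom}$. A fact is $R(\boldsymbol x)$ with $R(\boldsymbol X)\in\mathsf{at}(Q)$, $\boldsymbol x\in\mathsf{Dom}^{\boldsymbol X}$. A database instance for $Q$ is a finite set of facts over $\mathsf{at}(Q)$; $|\mathcal D|$ is its number of facts. $Q$ is true on $\mathcal D$ if there is $\boldsymbol w\in\mathsf{Dom}^{\mathsf{vars}(Q)}$ with $R(\boldsymbol w|_{\boldsymbol X})\in\mathcal D$ for all $R(\boldsymbol X)\in\mathsf{at}(Q)$. **#Sat.** For a database divided into an exogenous part $\mathcal D^{\mathsf x}$ and an endogenous part $\mathcal D^{\mathsf n}$, and $k\in\mathbb N$, $\mathsf{\#Sat}_{Q,\mathcal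 D^{\mathsf x},\mathcal D^{\mathsf n}}(k)$ is the number of subsets $\mathcal D'\subseteq\mathcal D^{\mathsf n}$ with $|\mathcal D'|=k$ such that $Q$ is true on $\mathcal D^{\mathsf x}\cup\mathcal D'$. **2-monoids and annotations.** A 2-monoid $\boldsymbol K=(K,\oplus,\otimes)$ consists of two commutative monoids $(K,\oplus)$ with identity $\boldsymbol 0$ and $(K,\otimes)$ with identity $\boldsymbol 1$ such that $\boldsymbol 0\otimes\boldsymbol 0=\boldsymbol 0$. A $\boldsymbol K$-annotated relation $R(\boldsymbol X)$ assigns to each $\boldsymbol x\in\mathsf{Dom}^{\boldsymbol X}$ an annotation $R(\boldsymbol x)\in K$, all but finitely many equal to $\boldsymbol 0$; only the facts with annotation $\ne\boldsymbol 0$ are stored. A $\boldsymbol K$-annotated database instance for $Q$ consists of one such relation for each atom of $Q$. **Hierarchical Elimination Algorithm** (parameter: a 2-monoid $\boldsymbol K$; input: a hierarchical SJF-BCQ $Q$ and a $\boldsymbol K$-annotated database instance). While $Q$ is not of the form $Q()\text{ :- }R()$: (Rule 1) if some variable $Y$ occurs in only one atom $R(\boldsymbol X)$, let $\boldsymbol X'=\boldsymbol X\setminus\{Y\}$ and replace $R(\boldsymbol X)$ by a new atom $R'(\boldsymbol X')$ annotated by $R'(\boldsymbol x')=\bigoplus_{y\in\mathsf{Dom}}R(\boldsymbol x',y)$ for all $\boldsymbol x'\in\mathsf{Dom}^{\boldsymbol X'}$; (Rule 2) else if there are two distinct atoms $R_1(\boldsymbol X),R_2(\boldsymbol X)$ with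 the same variable set, replace both by a single new atom $R'(\boldsymbol X)$ annotated by $R'(\boldsymbol x)=R_1(\boldsymbol x)\otimes R_2(\boldsymbol x)$ for all $\boldsymbol x\in\mathsf{Dom}^{\boldsymbol X}$; else report that $Q$ is not hierarchical. At the end return the annotation $R()\in K$ of the empty tuple. **Shapley 2-monoid.** Let $\mathbb B=\{\mathsf{true},\mathsf{false}\}$ and $K=\mathbb N^{\mathbb N\times\mathbb B}$. For $\boldsymbol x_1,\boldsymbol x_2\in K$, $i\in\mathbb N$, $b\in\mathbb B$, $$(\boldsymbol x_1\oplus\boldsymbol x_2)(i,b)=\sum_{i_1+i_2=i}\ \sum_{b_1\vee b_2=b}\boldsymbol x_1(i_1,b_1)\,\boldsymbol x_2(i_2,b_2),\qquad(\boldsymbol x_1\otimes\boldsymbol x_2)(i,b)=\sum_{i_1+i_2=i}\ \sum_{b_1\wedge b_2=b}\boldsymbol x_1(i_1,b_1)\,\boldsymbol x_2(i_2,b_2),$$ with $i_1,i_2\in\mathbb N$, $b_1,b_2\in\mathbb B$. The identity $\boldsymbol 0$ has value $1$ at $(0,\mathsf{false})$ and $0$ elsewhere; the identity $\boldsymbol 1$ has value $1$ at $(0,\mathsf{true})$ and $0$ elsewhere. **Annotated input.** Let $\star\in K$ have value $1$ at $(0,\mathsf{false})$ and at $(1,\mathsf{true})$, and $0$ elsewhere. In $\psi(\mathcal D^{\mathsf x},\mathcal D^{\mathsf n})$, a fact $R(\boldsymbol x)$ is annotated with $\boldsymbol 1$ if $R(\boldsymbol x)\in\mathcal D^{\mathsf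 x}$, with $\star$ if $R(\boldsymbol x)\in\mathcal D^{\mathsf n}\setminus\mathcal D^{\mathsf x}$, and with $\boldsymbol 0$ otherwise. **Complexity conventions.** Data complexity: $Q$ is fixed and constants may depend on $Q$. Arithmetic operations on natural numbers cost unit time and space. Vectors are stored by their entries with index $i\le|\mathcal D^{\mathsf n}|$ (all others being $0$). Inside $O(\cdot)$, sizes are read as at least $1$. *)

theory Defs
  imports
    Complex_Main
    "HOL-Algebra.Ring"
    "HOL-Library.State_Monad"
    "HOL-Library.Countable_Set"
begin

section \<open>Queries and databases\<close>

text \<open>The query \<open>Q\<close> is identified with its set \<open>at(Q)\<close> of atoms; the pair \<open>(R, X)\<close> is the atom
  \<open>R(X)\<close>. An element of \<open>Dom\<^sup>X\<close> is a partial map with domain exactly \<open>X\<close>.\<close>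

type_synonym ('r, 'v) query = "('r \<times> 'v set) set"
type_synonym ('v, 'd) tuple = "'v \<rightharpoonup> 'd"
type_synonym ('r, 'v, 'd) fact = "'r \<times> ('v, 'd) tuple"

definition sjf_bcq :: "('r, 'v) query \<Rightarrow> bool" where
  "sjf_bcq Q \<longleftrightarrow> finite Q \<and> Q \<noteq> {} \<and> (\<forall>(R, X) \<in> Q. finite X) \<and> inj_on fst Q"

definition vars :: "('r, 'v) query \<Rightarrow> 'v set" where
  "vars Q = (\<Union>(R, X) \<in> Q. X)"

definition atoms_of :: "('r, 'v) query \<Rightarrow> 'v \<Rightarrow> ('r, 'v) query" where
  "atoms_of Q Y = {(R, X) \<in> Q. Y \<in> X}"

definition hierarchical :: "('r, 'v) query \<Rightarrow> bool" where
  "hierarchical Q \<longleftrightarrow> (\<forall>X \<in> vars Q. \<forall>Y \<in> vars Q.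
     atoms_of Q X \<subseteq> atoms_of Q Y \<or> atoms_of Q Y \<subseteq> atoms_of Q X \<or> atoms_of Q X \<inter> atoms_of Q Y = {})"

definition facts_over :: "('r, 'v) query \<Rightarrow> ('r, 'v, 'd) fact set" where
  "facts_over Q = {(R, x) | R x X. (R, X) \<in> Q \<and> dom x = X}"

definition database :: "('r, 'v) query \<Rightarrow> ('r, 'v, 'd) fact set \<Rightarrow> bool" where
  "database Q D \<longleftrightarrow> finite D \<and> D \<subseteq> facts_over Q"

definition query_true :: "('r, 'v) query \<Rightarrow> ('r, 'v, 'd) fact set \<Rightarrow> bool" where
  "query_true Q D \<longleftrightarrow> (\<exists>w. dom w = vars Q \<and> (\<forall>(R, X) \<in> Q. (R, w |` X) \<in> D))"

definition num_sat ::
  "('r, 'v) query \<Rightarrow> ('r, 'v, 'd) fact set \<Rightarrow> ('r, 'v, 'd) fact set \<Rightarrow> nat \<Rightarrow> nat" where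
  "num_sat Q Dx Dn k = card {D'. D' \<subseteq> Dn \<and> card D' = k \<and> query_true Q (Dx \<union> D')}"


section \<open>2-monoids and the Hierarchical Elimination Algorithm\<close>

text \<open>Only the signature of the record \<^typ>\<open>'a ring\<close> is used: \<open>\<oplus>\<close> need not have inverses, and neither
  distributivity nor annihilation is required.\<close>

locale two_monoid = abelian_monoid K + comm_monoid K for K (structure) +
  assumes zero_times_zero: "\<zero> \<otimes> \<zero> = \<zero>"

text \<open>An annotated instance maps every relation symbol and tuple to an annotation; it is \<open>\<zero>\<close> outside
  the facts over the query at hand.\<close>

type_synonym ('r, 'v, 'd, 'k) annotated = "'r \<Rightarrow> ('v, 'd) tuple \<Rightarrow> 'k"

text \<open>\<open>R'\<close> is the symbol of the new atom. Atoms have distinct symbols, hence \<open>R1 \<noteq> R2\<close> says that the two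
  atoms are distinct. Neither rule is applicable to a query of the form \<open>Q() :- R()\<close>, so the condition
  of the while loop is implicit.\<close>

definition rule1 :: "('r, 'v) query \<Rightarrow> 'r \<Rightarrow> 'v set \<Rightarrow> 'v \<Rightarrow> 'r \<Rightarrow> bool" where
  "rule1 Q R X Y R' \<longleftrightarrow> (R, X) \<in> Q \<and> Y \<in> X \<and> atoms_of Q Y = {(R, X)} \<and> R' \<notin> fst ` Q"

definition rule2 :: "('r, 'v) query \<Rightarrow> 'r \<Rightarrow> 'r \<Rightarrow> 'v set \<Rightarrow> 'r \<Rightarrow> bool" where
  "rule2 Q R1 R2 X R' \<longleftrightarrow> (\<nexists>R X Y R'. rule1 Q R X Y R') \<and>
     (R1, X) \<in> Q \<and> (R2, X) \<in> Q \<and> R1 \<noteq> R2 \<and> R' \<notin> fst ` Q"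

definition rule1_query :: "('r, 'v) query \<Rightarrow> 'r \<Rightarrow> 'v set \<Rightarrow> 'v \<Rightarrow> 'r \<Rightarrow> ('r, 'v) query" where
  "rule1_query Q R X Y R' = insert (R', X - {Y}) (Q - {(R, X)})"

definition rule2_query :: "('r, 'v) query \<Rightarrow> 'r \<Rightarrow> 'r \<Rightarrow> 'v set \<Rightarrow> 'r \<Rightarrow> ('r, 'v) query" where
  "rule2_query Q R1 R2 X R' = insert (R', X) (Q - {(R1, X), (R2, X)})"

text \<open>The sum over \<open>y \<in> Dom\<close> is taken over the finitely many \<open>y\<close> whose summand is not the identity \<open>\<zero>\<close>.\<close>

definition rule1_annot ::
  "('k, 'm) ring_scheme \<Rightarrow> ('r, 'v, 'd, 'k) annotated \<Rightarrow> 'r \<Rightarrow> 'v set \<Rightarrow> 'v \<Rightarrow> 'r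
    \<Rightarrow> ('r, 'v, 'd, 'k) annotated" where
  "rule1_annot K D R X Y R' = D
     (R := (\<lambda>x. \<zero>\<^bsub>K\<^esub>),
      R' := (\<lambda>x'. if dom x' = X - {Y}
         then \<Oplus>\<^bsub>K\<^esub>y \<in> {y. D R (x'(Y \<mapsto> y)) \<noteq> \<zero>\<^bsub>K\<^esub>}. D R (x'(Y \<mapsto> y))
         else \<zero>\<^bsub>K\<^esub>))"

definition rule2_annot ::
  "('k, 'm) ring_scheme \<Rightarrow> ('r, 'v, 'd, 'k) annotated \<Rightarrow> 'r \<Rightarrow> 'r \<Rightarrow> 'v set \<Rightarrow> 'r
    \<Rightarrow> ('r, 'v, 'd, 'k) annotated" where
  "rule2_annot K D R1 R2 X R' = D
     (R1 := (\<lambda>x. \<zero>\<^bsub>K\<^esub>),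
      R2 := (\<lambda>x. \<zero>\<^bsub>K\<^esub>),
      R' := (\<lambda>x. if dom x = X then D R1 x \<otimes>\<^bsub>K\<^esub> D R2 x else \<zero>\<^bsub>K\<^esub>))"

inductive elim_step ::
  "('k, 'm) ring_scheme \<Rightarrow> ('r, 'v) query \<times> ('r, 'v, 'd, 'k) annotated
    \<Rightarrow> ('r, 'v) query \<times> ('r, 'v, 'd, 'k) annotated \<Rightarrow> bool"
  for K where
  "rule1 Q R X Y R' \<Longrightarrow>
     elim_step K (Q, D) (rule1_query Q R X Y R', rule1_annot K D R X Y R')"
| "rule2 Q R1 R2 X R' \<Longrightarrow>
     elim_step K (Q, D) (rule2_query Q R1 R2 X R', rule2_annot K D R1 R2 X R')"

text \<open>Whatever the choices made along the way, the steps starting in \<open>c\<close> come to an end, and \<open>P\<close> holds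
  for every configuration in which no further step is possible.\<close>

inductive always_ends :: "('c \<Rightarrow> 'c \<Rightarrow> bool) \<Rightarrow> ('c \<Rightarrow> bool) \<Rightarrow> 'c \<Rightarrow> bool" for step P where
  "(\<And>c'. step c c' \<Longrightarrow> always_ends step P c') \<Longrightarrow> (\<nexists>c'. step c c') \<longrightarrow> P c \<Longrightarrow> always_ends step P c"

text \<open>A run that gets stuck with a query other than \<open>Q() :- R()\<close> reports that the query is not
  hierarchical, and outputs nothing.\<close>

definition outputs ::
  "('r, 'v) query \<times> ('r, 'v, 'd, 'k) annotated \<Rightarrow> 'k \<Rightarrow> bool" where
  "outputs c q \<longleftrightarrow> (\<exists>R. fst c = {(R, {})} \<and> snd c R Map.empty = q)"


section \<open>The Shapley 2-monoid\<close>

type_synonym vector = "nat \<times> bool \<Rightarrow> nat"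

definition convolution :: "(bool \<Rightarrow> bool \<Rightarrow> bool) \<Rightarrow> vector \<Rightarrow> vector \<Rightarrow> vector" where
  "convolution f x1 x2 = (\<lambda>(i, b).
     \<Sum>(i1, i2) \<in> {(i1, i2). i1 + i2 = i}. \<Sum>(b1, b2) \<in> {(b1, b2). f b1 b2 = b}. x1 (i1, b1) * x2 (i2, b2))"

definition shapley :: "vector ring" where
  "shapley = \<lparr>carrier = UNIV,
     mult = convolution (\<and>), one = (\<lambda>k. if k = (0, True) then 1 else 0),
     zero = (\<lambda>k. if k = (0, False) then 1 else 0), add = convolution (\<or>)\<rparr>"

lemma convolution_alt:
  "convolution f x y k = (\<Sum>(p, q) \<in> {(p, q). (fst p + fst q, f (snd p) (snd q)) = k}. x p * y q)"
proof (cases k)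
  case (Pair i b)
  show ?thesis
    unfolding Pair convolution_def prod.case case_prod_unfold sum.cartesian_product
    by (auto intro!: sum.reindex_bij_witness[of _
          "\<lambda>(p, q). ((fst p, fst q), (snd p, snd q))" "\<lambda>((i1, i2), (b1, b2)). ((i1, b1), (i2, b2))"]
        simp: case_prod_unfold)
qed

lemma finite_fibre:
  "finite {(p :: nat \<times> bool, q :: nat \<times> bool). (fst p + fst q, f (snd p) (snd q)) = k}"
  by (rule finite_subset[of _ "({..fst k} \<times> UNIV) \<times> ({..fst k} \<times> UNIV)"]) auto

lemma convolution_assoc:
  assumes f: "\<And>a b c. f (f a b) c = f a (f b c)"
  shows "convolution f (convolution f x y) z = convolution f x (convolution f y z)"
proof
  fix k
  let ?g = "\<lambda>p q :: nat \<times> bool. (fst p + fst q, f (snd p) (snd q))"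
  let ?F = "\<lambda>k. {(p, q). ?g p q = k}"
  have fin: "finite (?F k)" for k
    by (rule finite_fibre)
  have "convolution f (convolution f x y) z k =
      (\<Sum>(u, v) \<in> (SIGMA u : ?F k. ?F (fst u)). x (fst v) * y (snd v) * z (snd u))"
    by (subst sum.Sigma[symmetric, OF fin ballI[OF fin]])
      (simp add: convolution_alt sum_distrib_right case_prod_unfold)
  also have "\<dots> = (\<Sum>(u, v) \<in> (SIGMA u : ?F k. ?F (snd u)). x (fst u) * (y (fst v) * z (snd v)))"
    by (rule sum.reindex_bij_witness[of _
          "\<lambda>((p, r), (q, t)). ((?g p q, t), (p, q))" "\<lambda>((r, t), (p, q)). ((p, ?g q t), (q, t))"])
      (auto simp: f algebra_simps)
  also have "\<dots> = convolution f x (convolution f y z) k"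
    by (subst sum.Sigma[symmetric, OF fin ballI[OF fin]])
      (simp add: convolution_alt sum_distrib_left case_prod_unfold)
  finally show "convolution f (convolution f x y) z k = convolution f x (convolution f y z) k" .
qed

lemma convolution_comm:
  assumes f: "\<And>a b. f a b = f b a"
  shows "convolution f x y = convolution f y x"
proof
  fix k
  show "convolution f x y k = convolution f y x k"
    unfolding convolution_alt
    by (rule sum.reindex_bij_witness[of _ prod.swap prod.swap]) (auto simp: f add.commute)
qed

lemma convolution_unit:
  assumes f: "\<And>a. f e a = a"
  shows "convolution f (\<lambda>k. if k = (0, e) then 1 else 0) x = x"
proof
  fix k
  let ?A = "{(p :: nat \<times> bool, q). (fst p + fst q, f (snd p) (snd q)) = k}"
  have "convolution f (\<lambda>k. if k = (0, e) then 1 else 0) x k =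
      (\<Sum>(p, q) \<in> {((0 :: nat, e), k)}. (if p = (0, e) then 1 else 0) * x q)"
    unfolding convolution_alt
    by (rule sum.mono_neutral_right[OF finite_fibre]) (auto simp: f split: if_splits)
  then show "convolution f (\<lambda>k. if k = (0, e) then 1 else 0) x k = x k"
    by simp
qed

lemma two_monoid_shapley: "two_monoid shapley"
proof -
  have "comm_monoid (add_monoid shapley)"
    by (rule comm_monoidI)
      (auto simp: shapley_def convolution_unit intro!: convolution_assoc convolution_comm)
  moreover have "comm_monoid shapley"
    by (rule comm_monoidI)
      (auto simp: shapley_def convolution_unit intro!: convolution_assoc convolution_comm)
  moreover have "\<zero>\<^bsub>shapley\<^esub> \<otimes>\<^bsub>shapley\<^esub> \<zero>\<^bsub>shapley\<^esub> = \<zero>\<^bsub>shapley\<^esub>"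
  proof
    fix k
    let ?z = "\<lambda>k :: nat \<times> bool. if k = (0, False) then 1 else 0 :: nat"
    have "convolution (\<and>) ?z ?z k = (\<Sum>(p, q) \<in> (if k = (0, False) then {((0, False), (0, False))} else {}). ?z p * ?z q)"
      unfolding convolution_alt
      by (rule sum.mono_neutral_right[OF finite_fibre]) (auto split: if_splits)
    then show "(\<zero>\<^bsub>shapley\<^esub> \<otimes>\<^bsub>shapley\<^esub> \<zero>\<^bsub>shapley\<^esub>) k = \<zero>\<^bsub>shapley\<^esub> k"
      by (auto simp: shapley_def)
  qed
  ultimately show ?thesis
    by (simp add: two_monoid_def two_monoid_axioms_def abelian_monoid_def)
qed

definition star :: vector where
  "star k = (if k = (0, False) \<or> k = (1, True) then 1 else 0)"

definition shapley_input ::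
  "('r, 'v, 'd) fact set \<Rightarrow> ('r, 'v, 'd) fact set \<Rightarrow> ('r, 'v, 'd, vector) annotated" where
  "shapley_input Dx Dn R x =
     (if (R, x) \<in> Dx then \<one>\<^bsub>shapley\<^esub>
      else if (R, x) \<in> Dn - Dx then star
      else \<zero>\<^bsub>shapley\<^esub>)"


section \<open>Time and space\<close>

text \<open>The two rules are implemented by programs on a random access machine with associative addressing:
  a stored vector is addressed by its fact. The machine charges

    \<^item> one unit of time for each arithmetic or Boolean operation or comparison, for each access to a single
      number, and for each component of a tuple that is inspected;

    \<^item> one unit of space for each number in memory (whatever its size), and \<open>1 + |X|\<close> units for the address
      \<open>R(x)\<close> with \<open>x \<in> Dom\<^sup>X\<close> of a stored vector.

  The facts with annotation \<open>\<noteq> \<zero>\<close> are stored, each with a vector of the entries with index \<open>i \<le> N\<close>, where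
  \<open>N\<close> will be the number of endogenous facts. The component \<open>work\<close> is a single auxiliary vector.
  A program has in addition boundedly many local scalars, loop counters and tuples; these and the
  query itself take an amount of space which depends on the query only, and are not counted in
  \<open>cells\<close>. The lists of the loops stand for ranges of indices, and for cursors over the stored facts.

  In \<open>cells\<close> the sum ranges over a finite set: the store is finite initially, and each instruction
  changes it at one fact only.\<close>

type_synonym stored_vector = "nat \<times> bool \<rightharpoonup> nat"

record ('r, 'v, 'd) machine =
  store :: "('r, 'v, 'd) fact \<rightharpoonup> stored_vector"
  work :: stored_vector
  clock :: nat
  peak :: nat

type_synonym ('r, 'v, 'd, 'a) program = "(('r, 'v, 'd) machine, 'a) state"

definition key_size :: "('r, 'v, 'd) fact \<Rightarrow> nat" where
  "key_size f = 1 + card (dom (snd f))"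

definition cells :: "('r, 'v, 'd) machine \<Rightarrow> nat" where
  "cells s = (\<Sum>f \<in> dom (store s). key_size f + card (dom (the (store s f)))) + card (dom (work s))"

definition entry :: "stored_vector \<Rightarrow> vector" where
  "entry v k = (case v k of None \<Rightarrow> 0 | Some n \<Rightarrow> n)"

definition annotation :: "('r, 'v, 'd) machine \<Rightarrow> ('r, 'v, 'd, vector) annotated" where
  "annotation s R x = (case store s (R, x) of None \<Rightarrow> \<zero>\<^bsub>shapley\<^esub> | Some v \<Rightarrow> entry v)"

subsection \<open>Machine instructions\<close>

definition tick :: "nat \<Rightarrow> ('r, 'v, 'd, unit) program" where
  "tick n = do {
     s \<leftarrow> State_Monad.get;
     State_Monad.set (s\<lparr>clock := clock s + n\<rparr>)
   }"

text \<open>Every instruction that changes the memory goes through \<open>modify\<close>, so that \<open>peak\<close> is the largest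
  number of cells that have been in use at the same time.\<close>

definition modify ::
  "nat \<Rightarrow> (('r, 'v, 'd) machine \<Rightarrow> ('r, 'v, 'd) machine) \<Rightarrow> ('r, 'v, 'd, unit) program" where
  "modify n f = do {
     tick n;
     s \<leftarrow> State_Monad.get;
     State_Monad.set ((f s)\<lparr>peak := max (peak s) (cells (f s))\<rparr>)
   }"

definition compute :: "'a \<Rightarrow> ('r, 'v, 'd, 'a) program" where
  "compute a = do { tick 1; State_Monad.return a }"

definition is_stored :: "('r, 'v, 'd) fact \<Rightarrow> ('r, 'v, 'd, bool) program" where
  "is_stored f = do {
     tick (key_size f);
     s \<leftarrow> State_Monad.get;
     State_Monad.return (store s f \<noteq> None)
   }"

definition read_store :: "('r, 'v, 'd) fact \<Rightarrow> nat \<times> bool \<Rightarrow> ('r, 'v, 'd, nat) program" where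
  "read_store f k = do {
     tick (key_size f + 1);
     s \<leftarrow> State_Monad.get;
     State_Monad.return (annotation s (fst f) (snd f) k)
   }"

definition read_work :: "nat \<times> bool \<Rightarrow> ('r, 'v, 'd, nat) program" where
  "read_work k = do {
     tick 1;
     s \<leftarrow> State_Monad.get;
     State_Monad.return (entry (work s) k)
   }"

definition write_work :: "nat \<times> bool \<Rightarrow> nat \<Rightarrow> ('r, 'v, 'd, unit) program" where
  "write_work k n = modify 1 (\<lambda>s. s\<lparr>work := (work s)(k \<mapsto> n)\<rparr>)"

definition copy_work :: "('r, 'v, 'd) fact \<Rightarrow> ('r, 'v, 'd, unit) program" where
  "copy_work f = do {
     s \<leftarrow> State_Monad.get;
     modify (key_size f + card (dom (work s))) (\<lambda>s. s\<lparr>store := (store s)(f \<mapsto> work s)\<rparr>)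
   }"

definition delete :: "('r, 'v, 'd) fact \<Rightarrow> ('r, 'v, 'd, unit) program" where
  "delete f = do {
     s \<leftarrow> State_Monad.get;
     modify (key_size f + (case store s f of None \<Rightarrow> 0 | Some v \<Rightarrow> card (dom v)))
       (\<lambda>s. s\<lparr>store := (store s)(f := None)\<rparr>)
   }"

fun for_each :: "('a \<Rightarrow> ('r, 'v, 'd, unit) program) \<Rightarrow> 'a list \<Rightarrow> ('r, 'v, 'd, unit) program" where
  "for_each p [] = State_Monad.return ()"
| "for_each p (a # as) = do { tick 1; p a; for_each p as }"

subsection \<open>The programs for the two rules\<close>

definition indices :: "nat \<Rightarrow> (nat \<times> bool) list" where
  "indices N = List.product [0..<Suc N] [False, True]"

definition convolve ::
  "nat \<Rightarrow> (bool \<Rightarrow> bool \<Rightarrow> bool) \<Rightarrow> ('r, 'v, 'd) fact \<Rightarrow> ('r, 'v, 'd) fact \<Rightarrow> ('r, 'v, 'd, unit) program" where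
  "convolve N f f1 f2 = do {
     for_each (\<lambda>k. write_work k 0) (indices N);
     for_each (\<lambda>(i1, b1). do {
       M \<leftarrow> compute (N - i1);
       for_each (\<lambda>(i2, b2). do {
         m1 \<leftarrow> read_store f1 (i1, b1);
         m2 \<leftarrow> read_store f2 (i2, b2);
         m \<leftarrow> compute (m1 * m2);
         i \<leftarrow> compute (i1 + i2);
         b \<leftarrow> compute (f b1 b2);
         n \<leftarrow> read_work (i, b);
         n' \<leftarrow> compute (n + m);
         write_work (i, b) n'
       }) (indices M)
     }) (indices N)
   }"

fun work_is_zero :: "(nat \<times> bool) list \<Rightarrow> ('r, 'v, 'd, bool) program" where
  "work_is_zero [] = State_Monad.return True"
| "work_is_zero (k # ks) = do {
     n \<leftarrow> read_work k;
     b \<leftarrow> compute (n = \<zero>\<^bsub>shapley\<^esub> k);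
     if b then work_is_zero ks else State_Monad.return False
   }"

definition assign_work :: "nat \<Rightarrow> ('r, 'v, 'd) fact \<Rightarrow> ('r, 'v, 'd, unit) program" where
  "assign_work N f = do {
     z \<leftarrow> work_is_zero (indices N);
     if z then delete f else copy_work f
   }"

text \<open>The lists \<open>xs\<close>, \<open>xs1\<close>, \<open>xs2\<close> enumerate the tuples stored for \<open>R\<close>, \<open>R1\<close>, \<open>R2\<close>. Since facts that are
  not stored have annotation \<open>\<zero>\<close>, no initialization of \<open>R'\<close> is needed in the first program. In the
  second one, a tuple may be stored for only one of \<open>R1\<close> and \<open>R2\<close>: in a 2-monoid \<open>\<zero> \<otimes> a\<close> can differ
  from \<open>\<zero>\<close>.\<close>

definition rule1_program ::
  "nat \<Rightarrow> 'r \<Rightarrow> 'v set \<Rightarrow> 'v \<Rightarrow> 'r \<Rightarrow> ('v, 'd) tuple list \<Rightarrow> ('r, 'v, 'd, unit) program" where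
  "rule1_program N R X Y R' xs = do {
     for_each (\<lambda>x. do {
       tick (card (dom x));
       x' \<leftarrow> compute (x |` (X - {Y}));
       convolve N (\<or>) (R', x') (R, x);
       assign_work N (R', x')
     }) xs;
     for_each (\<lambda>x. delete (R, x)) xs
   }"

definition rule2_program ::
  "nat \<Rightarrow> 'r \<Rightarrow> 'r \<Rightarrow> 'r \<Rightarrow> ('v, 'd) tuple list \<Rightarrow> ('v, 'd) tuple list \<Rightarrow> ('r, 'v, 'd, unit) program" where
  "rule2_program N R1 R2 R' xs1 xs2 = do {
     for_each (\<lambda>x. do {
       convolve N (\<and>) (R1, x) (R2, x);
       assign_work N (R', x)
     }) xs1;
     for_each (\<lambda>x. do {
       d \<leftarrow> is_stored (R1, x);
       if d then State_Monad.return ()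
       else do {
         convolve N (\<and>) (R1, x) (R2, x);
         assign_work N (R', x)
       }
     }) xs2;
     for_each (\<lambda>x. delete (R1, x)) xs1;
     for_each (\<lambda>x. delete (R2, x)) xs2
   }"

definition enumerates :: "('v, 'd) tuple list \<Rightarrow> ('r, 'v, 'd) machine \<Rightarrow> 'r \<Rightarrow> bool" where
  "enumerates xs s R \<longleftrightarrow> distinct xs \<and> set xs = {x. (R, x) \<in> dom (store s)}"

definition query_size :: "('r, 'v) query \<Rightarrow> nat" where
  "query_size Q = (\<Sum>(R, X) \<in> Q. 1 + card X)"

text \<open>Selecting the rule and updating the query are charged quadratically in the size of the query.\<close>

inductive machine_step ::
  "nat \<Rightarrow> ('r, 'v) query \<times> ('r, 'v, 'd) machine \<Rightarrow> ('r, 'v) query \<times> ('r, 'v, 'd) machine \<Rightarrow> bool"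
  for N where
  "rule1 Q R X Y R' \<Longrightarrow> enumerates xs s R \<Longrightarrow>
     run_state (rule1_program N R X Y R' xs) (s\<lparr>clock := clock s + (query_size Q)\<^sup>2\<rparr>) = ((), s') \<Longrightarrow>
     machine_step N (Q, s) (rule1_query Q R X Y R', s')"
| "rule2 Q R1 R2 X R' \<Longrightarrow> enumerates xs1 s R1 \<Longrightarrow> enumerates xs2 s R2 \<Longrightarrow>
     run_state (rule2_program N R1 R2 R' xs1 xs2) (s\<lparr>clock := clock s + (query_size Q)\<^sup>2\<rparr>) = ((), s') \<Longrightarrow>
     machine_step N (Q, s) (rule2_query Q R1 R2 X R', s')"

definition truncate_vector :: "nat \<Rightarrow> vector \<Rightarrow> stored_vector" where
  "truncate_vector N q = (\<lambda>(i, b). if i \<le> N then Some (q (i, b)) else None)"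

text \<open>Initially the annotated instance \<open>D\<close> is in memory. It is the input of the algorithm, so no time is
  charged for it, but its space counts.\<close>

definition load :: "nat \<Rightarrow> ('r, 'v, 'd, vector) annotated \<Rightarrow> ('r, 'v, 'd) machine" where
  "load N D =
     (let s = \<lparr>store = (\<lambda>(R, x). if D R x = \<zero>\<^bsub>shapley\<^esub> then None else Some (truncate_vector N (D R x))),
               work = Map.empty, clock = 0, peak = 0\<rparr>
      in s\<lparr>peak := cells s\<rparr>)"

end

theory Submission
  imports Defs
begin

text \<open>After each step, every fact \<open>f\<close> of the current query carries a set \<open>S f\<close> of endogenous facts of the
  original database and a truth value depending on the subset of \<open>S f\<close> that is present. The sets \<open>S f\<close>
  partition the endogenous part, the annotation of \<open>f\<close> counts the subsets of \<open>S f\<close> by cardinality and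
  truth value, and the current query is true exactly when the original one is. The convolutions preserve
  this because the sets are disjoint: \<open>\<oplus>\<close> is disjunction and \<open>\<otimes>\<close> is conjunction of the truth values. In
  particular all annotations vanish beyond index \<open>|D\<^sup>n|\<close>, so that truncated vectors suffice. The number of
  stored facts never grows from one step to the next, each convolution takes \<open>O(|D\<^sup>n|\<^sup>2)\<close> time, and the
  number of steps depends on the query only.\<close>

section \<open>The elimination steps on queries\<close>

text \<open>The Shapley 2-monoid is not distributive, so correctness cannot be read off by expanding
  an algebraic expression. The sets \<open>S\<close> and predicates \<open>\<phi>\<close> are ghost
  data: existentially quantified in the invariant, never computed. As constructed,
  \<open>\<phi> f D'\<close> is the truth value that a Boolean run on \<open>Dx \<union> D'\<close>
  would give to \<open>f\<close>. The delicate value is \<open>\<zero>\<close>. Only nonzero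
  annotations are stored and summed, yet the sets \<open>S f\<close> must cover the endogenous part;
  this is consistent because annotation \<open>\<zero>\<close> forces \<open>S f\<close> to be empty
  and \<open>\<phi> f\<close> to be false. On the machine, cutting vectors at \<open>N\<close> is
  compatible with convolution and loses nothing of an abstract annotation, so each program run is
  exactly one abstract step and correctness transfers along the reached configurations. Time is paid
  from a potential: with \<open>B\<close> bounding the cost of one step,
  \<open>clock s + query_size Q * B\<close> never increases, because \<open>query_size\<close> drops
  by at least one. Space must be bounded at every instruction, also in the middle of a rule, where
  old and new facts coexist; this is the factor 2 in \<open>space_bound\<close>.\<close>

lemma always_ends_measure:
  fixes \<mu> :: "'c \<Rightarrow> nat"
  assumes "I c"
    and step: "\<And>c c'. I c \<Longrightarrow> step c c' \<Longrightarrow> I c' \<and> \<mu> c' < \<mu> c"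
    and final: "\<And>c. I c \<Longrightarrow> \<nexists>c'. step c c' \<Longrightarrow> P c"
  shows "always_ends step P c"
  using \<open>I c\<close>
proof (induction "\<mu> c" arbitrary: c rule: less_induct)
  case less
  show ?case
    by (rule always_ends.intros) (use less step final in blast)+
qed

text \<open>\<open>A\<close>, \<open>B\<close> and \<open>C\<close> witness the failure of the three
  alternatives in \<open>hierarchical\<close>. This forbidden pattern speaks only of the family of
  variable sets, so a rule preserves the property as soon as a pattern in the new family lifts to
  the old one.\<close>

lemma hierarchical_iff:
  "hierarchical Q \<longleftrightarrow> (\<forall>Y Z. \<forall>A \<in> snd ` Q. \<forall>B \<in> snd ` Q. \<forall>C \<in> snd ` Q.
     \<not> (Y \<in> A \<and> Z \<in> A \<and> Y \<in> B \<and> Z \<notin> B \<and> Z \<in> C \<and> Y \<notin> C))"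
  (is "?L \<longleftrightarrow> ?R")
proof
  assume L: ?L
  show ?R
  proof (intro allI ballI notI)
    fix Y Z A B C assume "A \<in> snd ` Q" "B \<in> snd ` Q" "C \<in> snd ` Q"
      and *: "Y \<in> A \<and> Z \<in> A \<and> Y \<in> B \<and> Z \<notin> B \<and> Z \<in> C \<and> Y \<notin> C"
    then obtain R1 R2 R3 where Q: "(R1, A) \<in> Q" "(R2, B) \<in> Q" "(R3, C) \<in> Q"
      by auto
    then have "Y \<in> vars Q" "Z \<in> vars Q"
      using * by (auto simp: vars_def)
    moreover have "(R1, A) \<in> atoms_of Q Y \<inter> atoms_of Q Z" "(R2, B) \<in> atoms_of Q Y - atoms_of Q Z"
      "(R3, C) \<in> atoms_of Q Z - atoms_of Q Y"
      using Q * by (auto simp: atoms_of_def)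
    ultimately show False
      using L unfolding hierarchical_def by blast
  qed
next
  assume R: ?R
  show ?L
    unfolding hierarchical_def
  proof (intro ballI, rule ccontr)
    fix Y Z
    assume "\<not> (atoms_of Q Y \<subseteq> atoms_of Q Z \<or> atoms_of Q Z \<subseteq> atoms_of Q Y \<or> atoms_of Q Y \<inter> atoms_of Q Z = {})"
    then obtain a b c where "a \<in> atoms_of Q Y - atoms_of Q Z" "b \<in> atoms_of Q Z - atoms_of Q Y"
      "c \<in> atoms_of Q Y \<inter> atoms_of Q Z"
      by blast
    then have "a \<in> Q" "b \<in> Q" "c \<in> Q" "Y \<in> snd a" "Z \<notin> snd a" "Z \<in> snd b" "Y \<notin> snd b"
      "Y \<in> snd c" "Z \<in> snd c"
      by (auto simp: atoms_of_def)
    then show False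
      using R by (meson image_eqI)
  qed
qed

lemma finite_vars: "sjf_bcq Q \<Longrightarrow> finite (vars Q)"
  by (auto simp: sjf_bcq_def vars_def)

lemma fresh_symbol:
  assumes "infinite (UNIV :: 'r set)" and "sjf_bcq (Q :: ('r, 'v) query)"
  shows "\<exists>R. R \<notin> fst ` Q"
  using ex_new_if_finite[OF assms(1)] assms(2) by (metis finite_imageI sjf_bcq_def)

text \<open>A variable with a minimal set of atoms occurs in one atom only, or all its atoms have the same
  variable set.\<close>

lemma stuck_query:
  fixes Q :: "('r, 'v) query"
  assumes inf: "infinite (UNIV :: 'r set)" and sjf: "sjf_bcq Q" and h: "hierarchical Q"
    and r1: "\<nexists>R X Y R'. rule1 Q R X Y R'" and r2: "\<nexists>R1 R2 X R'. rule2 Q R1 R2 X R'"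
  shows "\<exists>R. Q = {(R, {})}"
proof -
  have fin: "finite Q" "Q \<noteq> {}"
    using sjf by (auto simp: sjf_bcq_def)
  obtain R' where R': "R' \<notin> fst ` Q"
    using fresh_symbol[OF inf sjf] by blast
  have distinct_sets: "R1 = R2" if "(R1, X) \<in> Q" "(R2, X) \<in> Q" for R1 R2 X
    using r1 r2 R' that unfolding rule2_def by blast
  have "vars Q = {}"
  proof (rule ccontr)
    assume "vars Q \<noteq> {}"
    then obtain Y where Y: "Y \<in> vars Q"
      and min: "\<And>Z. Z \<in> vars Q \<Longrightarrow> card (atoms_of Q Y) \<le> card (atoms_of Q Z)"
      using arg_min_if_finite(1,2)[OF finite_vars[OF sjf], of "\<lambda>Y. card (atoms_of Q Y)"]
      by (metis not_le_imp_less)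
    obtain R X where RX: "(R, X) \<in> Q" "Y \<in> X"
      using Y by (auto simp: vars_def)
    then have "atoms_of Q Y \<noteq> {(R, X)}"
      using r1 R' by (auto simp: rule1_def)
    moreover have "(R, X) \<in> atoms_of Q Y"
      using RX by (auto simp: atoms_of_def)
    ultimately obtain R2 X2 where R2: "(R2, X2) \<in> Q" "Y \<in> X2" "(R2, X2) \<noteq> (R, X)"
      by (auto simp: atoms_of_def)
    then have "X \<noteq> X2"
      using distinct_sets RX by auto
    then obtain Z A B where Z: "A \<in> Q" "B \<in> Q" "Y \<in> snd A" "Y \<in> snd B" "Z \<in> snd A" "Z \<notin> snd B"
      using RX R2 by (metis snd_conv subsetI subset_antisym)
    have "Z \<in> vars Q"
      using Z unfolding vars_def by (metis (no_types, lifting) UN_I case_prod_beta)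
    moreover have "A \<in> atoms_of Q Z" "A \<in> atoms_of Q Y" "B \<in> atoms_of Q Y" "B \<notin> atoms_of Q Z"
      using Z by (auto simp: atoms_of_def)
    \<comment> \<open>\<open>A\<close> contains both variables and \<open>B\<close> only
      \<open>Y\<close>, so of the three alternatives only this inclusion remains, and
      \<open>B\<close> makes it strict, against the minimality of \<open>Y\<close>.\<close>
    ultimately have "atoms_of Q Z \<subset> atoms_of Q Y"
      using h Y unfolding hierarchical_def by blast
    moreover have "finite (atoms_of Q Y)"
      by (rule finite_subset[OF _ fin(1)]) (auto simp: atoms_of_def)
    ultimately show False
      using min[OF \<open>Z \<in> vars Q\<close>] by (meson leD psubset_card_mono)
  qed
  then have empty: "X = {}" if "(R, X) \<in> Q" for R X
    using that by (auto simp: vars_def)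
  obtain R X where "(R, X) \<in> Q"
    using fin by auto
  then have "Q = {(R, {})}"
    using empty distinct_sets by (metis (no_types, lifting) insertI1 singletonD subsetI subset_antisym surj_pair)
  then show ?thesis ..
qed

lemma rule1_other_atoms:
  "rule1 Q R X Y R' \<Longrightarrow> (S, Z) \<in> Q \<Longrightarrow> Y \<in> Z \<Longrightarrow> S = R \<and> Z = X"
  by (auto simp: rule1_def atoms_of_def)

lemma sjf_bcq_replace:
  assumes "sjf_bcq Q" "R' \<notin> fst ` Q" "finite X"
  shows "sjf_bcq (insert (R', X) (Q - A))"
proof -
  have "fst ` (Q - A) \<subseteq> fst ` Q"
    by blast
  then have "R' \<notin> fst ` (Q - A)"
    using assms(2) by blast
  moreover have "inj_on fst (Q - A)"
    using assms(1) inj_on_subset[of fst Q "Q - A"] by (simp add: sjf_bcq_def)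
  ultimately show ?thesis
    using assms unfolding sjf_bcq_def by auto
qed

lemma sjf_bcq_rule1: "rule1 Q R X Y R' \<Longrightarrow> sjf_bcq Q \<Longrightarrow> sjf_bcq (rule1_query Q R X Y R')"
  unfolding rule1_query_def by (rule sjf_bcq_replace) (auto simp: rule1_def sjf_bcq_def)

lemma sjf_bcq_rule2: "rule2 Q R1 R2 X R' \<Longrightarrow> sjf_bcq Q \<Longrightarrow> sjf_bcq (rule2_query Q R1 R2 X R')"
  unfolding rule2_query_def by (rule sjf_bcq_replace) (auto simp: rule2_def sjf_bcq_def)

text \<open>Every new variable set is an old one without \<open>Y\<close>: the other atoms never
  contained \<open>Y\<close>. The two variables of a forbidden pattern lie in such a set, hence
  differ from \<open>Y\<close>, and the pattern is already present in the old sets.\<close>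

lemma hierarchical_rule1:
  assumes r: "rule1 Q R X Y R'" and h: "hierarchical Q"
  shows "hierarchical (rule1_query Q R X Y R')"
proof -
  have *: "\<exists>B \<in> snd ` Q. A = B - {Y}" if "A \<in> snd ` rule1_query Q R X Y R'" for A
  proof -
    obtain S where "(S, A) \<in> rule1_query Q R X Y R'"
      using \<open>A \<in> snd ` rule1_query Q R X Y R'\<close> by auto
    then consider "A = X - {Y}" | "(S, A) \<in> Q" "(S, A) \<noteq> (R, X)"
      unfolding rule1_query_def by blast
    then show ?thesis
    proof cases
      case 1
      then show ?thesis
        using r by (force simp: rule1_def)
    next
      case 2
      then have "Y \<notin> A"
        using rule1_other_atoms[OF r] by blast
      then show ?thesis
        using 2(1) by (intro bexI[of _ A]) (simp, force)
    qed
  qed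
  show ?thesis
    unfolding hierarchical_iff
  proof (intro allI ballI notI)
    fix V Z A B C
    assume "A \<in> snd ` rule1_query Q R X Y R'" "B \<in> snd ` rule1_query Q R X Y R'" "C \<in> snd ` rule1_query Q R X Y R'"
      and **: "V \<in> A \<and> Z \<in> A \<and> V \<in> B \<and> Z \<notin> B \<and> Z \<in> C \<and> V \<notin> C"
    from *[OF this(1)] *[OF this(2)] *[OF this(3)] obtain A' B' C'
      where Q: "A' \<in> snd ` Q" "B' \<in> snd ` Q" "C' \<in> snd ` Q"
        and eq: "A = A' - {Y}" "B = B' - {Y}" "C = C' - {Y}"
      by (elim bexE)
    moreover have "V \<in> A' \<and> Z \<in> A' \<and> V \<in> B' \<and> Z \<notin> B' \<and> Z \<in> C' \<and> V \<notin> C'"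
      using ** unfolding eq by auto
    ultimately show False
      using h unfolding hierarchical_iff by metis
  qed
qed

lemma hierarchical_rule2:
  assumes "rule2 Q R1 R2 X R'" "hierarchical Q"
  shows "hierarchical (rule2_query Q R1 R2 X R')"
proof -
  have "snd ` rule2_query Q R1 R2 X R' \<subseteq> snd ` Q"
    using assms(1) image_eqI[of X snd "(R1, X)" Q] by (auto simp: rule2_query_def rule2_def)
  with assms(2) show ?thesis
    unfolding hierarchical_iff by (meson subsetD)
qed

text \<open>Rule 1 loses a variable occurrence and rule 2 an entire atom. The same number therefore
  serves as termination measure, as bound on the number of steps and as potential for the time
  analysis.\<close>

lemma query_size_rule1:
  assumes "rule1 Q R X Y R'" "sjf_bcq Q"
  shows "query_size (rule1_query Q R X Y R') < query_size Q"
proof -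
  have Q: "finite Q" "(R, X) \<in> Q" "Y \<in> X" "finite X" and "(R', X - {Y}) \<notin> Q - {(R, X)}"
    using assms by (auto simp: rule1_def sjf_bcq_def image_iff)
  then show ?thesis
    using card_Diff1_less[of X Y]
    by (simp add: query_size_def rule1_query_def sum.remove[of Q "(R, X)"])
qed

lemma query_size_rule2:
  assumes "rule2 Q R1 R2 X R'" "sjf_bcq Q"
  shows "query_size (rule2_query Q R1 R2 X R') < query_size Q"
proof -
  have "finite Q" "(R1, X) \<in> Q" "(R2, X) \<in> Q - {(R1, X)}"
    and new: "(R', X) \<notin> Q - {(R1, X), (R2, X)}"
    using assms by (auto simp: rule2_def sjf_bcq_def image_iff)
  moreover have "Q - {(R1, X), (R2, X)} = Q - {(R1, X)} - {(R2, X)}"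
    by auto
  ultimately show ?thesis
    by (simp add: query_size_def rule2_query_def sum.remove[of Q "(R1, X)"]
        sum.remove[of "Q - {(R1, X)}" "(R2, X)"])
qed

lemma elim_step_query:
  assumes "elim_step K (Q, D) (Q', D')" "sjf_bcq Q" "hierarchical Q"
  shows "sjf_bcq Q'" "hierarchical Q'" "query_size Q' < query_size Q"
  using assms
  by (auto elim!: elim_step.cases intro: sjf_bcq_rule1 sjf_bcq_rule2 hierarchical_rule1
      hierarchical_rule2 query_size_rule1 query_size_rule2)

section \<open>Query truth through total valuations\<close>

definition value_tuple :: "('v \<Rightarrow> 'd) \<Rightarrow> 'v set \<Rightarrow> ('v, 'd) tuple" where
  "value_tuple w X = (Some \<circ> w) |` X"

lemma value_tuple_apply: "value_tuple w X v = (if v \<in> X then Some (w v) else None)"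
  by (simp add: value_tuple_def restrict_map_def)

lemma dom_value_tuple [simp]: "dom (value_tuple w X) = X"
  by (auto simp: value_tuple_apply dom_def split: if_splits)

text \<open>With total valuations, changing the value of one variable is a function update, and no
  domain has to follow the variable set when a rule shrinks it. Values outside \<open>vars Q\<close>
  do not affect the tuples.\<close>

lemma query_true_iff: "query_true Q D \<longleftrightarrow> (\<exists>w. \<forall>(R, X) \<in> Q. (R, value_tuple w X) \<in> D)"
proof
  assume "query_true Q D"
  then obtain w where w: "dom w = vars Q" "\<forall>(R, X) \<in> Q. (R, w |` X) \<in> D"
    by (auto simp: query_true_def)
  have "w |` X = value_tuple (the \<circ> w) X" if "(R, X) \<in> Q" for R X
  proof
    fix v
    have "v \<in> X \<Longrightarrow> v \<in> dom w"
      using that w(1) by (auto simp: vars_def)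
    then show "(w |` X) v = value_tuple (the \<circ> w) X v"
      by (auto simp: value_tuple_apply restrict_map_def)
  qed
  with w(2) show "\<exists>w. \<forall>(R, X) \<in> Q. (R, value_tuple w X) \<in> D"
    by (intro exI[of _ "the \<circ> w"]) fastforce
next
  assume "\<exists>w. \<forall>(R, X) \<in> Q. (R, value_tuple w X) \<in> D"
  then obtain w where w: "\<forall>(R, X) \<in> Q. (R, value_tuple w X) \<in> D"
    by blast
  have "value_tuple w (vars Q) |` X = value_tuple w X" if "(R, X) \<in> Q" for R X
    using that by (force simp: value_tuple_apply restrict_map_def vars_def fun_eq_iff)
  with w show "query_true Q D"
    unfolding query_true_def by (intro exI[of _ "value_tuple w (vars Q)"]) auto
qed

section \<open>Counting annotations\<close>

interpretation shapley: two_monoid shapley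
  by (rule two_monoid_shapley)

lemma carrier_shapley [simp]: "carrier shapley = UNIV"
  by (simp add: shapley_def)

lemma shapley_simps:
  "mult shapley = convolution (\<and>)" "add shapley = convolution (\<or>)"
  "one shapley = (\<lambda>k. if k = (0, True) then 1 else 0)"
  "zero shapley = (\<lambda>k. if k = (0, False) then 1 else 0)"
  by (simp_all add: shapley_def)

text \<open>The cardinality profile of a Boolean function on the subsets of \<open>S\<close>. Both
  truth values are recorded because the \<open>True\<close> entries of a disjunction also depend on
  the \<open>False\<close> entries of its parts.\<close>

definition count_by :: "'a set \<Rightarrow> ('a set \<Rightarrow> bool) \<Rightarrow> vector" where
  "count_by S \<phi> = (\<lambda>(i, b). card {D. D \<subseteq> S \<and> card D = i \<and> \<phi> D = b})"

lemma count_by_cong: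
  "S = T \<Longrightarrow> (\<And>D. D \<subseteq> S \<Longrightarrow> \<phi> D = \<psi> D) \<Longrightarrow> count_by S \<phi> = count_by T \<psi>"
  unfolding count_by_def by (auto intro!: ext arg_cong[where f = card])

text \<open>With nothing to choose from, only the constant truth value is left: the identities
  \<open>\<zero>\<close> and \<open>\<one>\<close> are the profiles of the constants false and
  true.\<close>

lemma count_by_empty: "count_by {} \<phi> = (\<lambda>k. if k = (0, \<phi> {}) then 1 else 0)"
proof
  fix k :: "nat \<times> bool"
  have "{D. D \<subseteq> {} \<and> card D = fst k \<and> \<phi> D = snd k} = (if k = (0, \<phi> {}) then {{}} else {})"
    by (auto simp: prod_eq_iff)
  then show "count_by {} \<phi> k = (if k = (0, \<phi> {}) then 1 else 0)"
    by (simp add: count_by_def case_prod_unfold)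
qed

text \<open>The origin of \<open>star\<close>: a single endogenous fact is false when absent, with 0
  facts chosen, and true when present, with 1 fact chosen.\<close>

lemma count_by_singleton: "count_by {f} (\<lambda>D. f \<in> D) = star"
proof
  fix k :: "nat \<times> bool"
  have "{D. D \<subseteq> {f} \<and> card D = fst k \<and> (f \<in> D) = snd k} =
      (if k = (0, False) then {{}} else if k = (1, True) then {{f}} else {})"
    by (auto simp: prod_eq_iff subset_singleton_iff)
  then show "count_by {f} (\<lambda>D. f \<in> D) k = star k"
    by (simp add: count_by_def case_prod_unfold star_def)
qed

lemma count_by_support:
  assumes "finite S" "card S < i"
  shows "count_by S \<phi> (i, b) = 0"
proof -
  have "{D. D \<subseteq> S \<and> card D = i \<and> \<phi> D = b} = {}"
    using assms card_mono[of S] by (metis (mono_tags, lifting) empty_Collect_eq leD)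
  then show ?thesis
    by (simp only: count_by_def prod.case card.empty)
qed

text \<open>The full set \<open>S\<close> is itself counted, at \<open>(card S, \<phi> S)\<close>.
  The only nonzero entry of \<open>\<zero>\<close> is \<open>(0, False)\<close>, so \<open>S\<close>
  must be empty. Hence a fact that is not stored hides no endogenous facts.\<close>

lemma count_by_eq_zero:
  assumes "finite S" "count_by S \<phi> = \<zero>\<^bsub>shapley\<^esub>"
  shows "S = {}" "\<not> \<phi> {}"
proof -
  let ?A = "{D. D \<subseteq> S \<and> card D = card S \<and> \<phi> D = \<phi> S}"
  have "finite ?A"
    by (rule finite_subset[OF _ finite_Pow_iff[THEN iffD2, OF assms(1)]]) blast
  moreover have "?A \<noteq> {}"
    by blast
  ultimately have "card ?A \<noteq> 0"
    by (simp only: card_eq_0_iff simp_thms)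
  moreover have "card ?A = count_by S \<phi> (card S, \<phi> S)"
    by (simp only: count_by_def prod.case)
  ultimately have "(card S, \<phi> S) = (0, False)"
    unfolding assms(2) shapley_simps(4) by presburger
  then have "card S = 0" "\<not> \<phi> S"
    by simp_all
  then show "S = {}" "\<not> \<phi> {}"
    using assms(1) by auto
qed

text \<open>A subset of a disjoint union is a pair of subsets; cardinalities add, and by locality
  each predicate sees only its own half, so the truth values combine by \<open>f\<close>. The
  convolution sums over exactly these data.\<close>

lemma convolution_count_by:
  assumes fin: "finite S" "finite T" and disj: "S \<inter> T = {}"
    and loc: "\<And>D. \<phi> (D \<inter> S) = \<phi> D" "\<And>D. \<psi> (D \<inter> T) = \<psi> D"
  shows "convolution f (count_by S \<phi>) (count_by T \<psi>) = count_by (S \<union> T) (\<lambda>D. f (\<phi> D) (\<psi> D))"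
proof
  fix k :: "nat \<times> bool"
  let ?A = "\<lambda>S \<phi> p. {D. D \<subseteq> S \<and> card D = fst p \<and> \<phi> D = snd p}"
  let ?F = "{(p :: nat \<times> bool, q :: nat \<times> bool). (fst p + fst q, f (snd p) (snd q)) = k}"
  have "convolution f (count_by S \<phi>) (count_by T \<psi>) k = (\<Sum>(p, q) \<in> ?F. card (?A S \<phi> p \<times> ?A T \<psi> q))"
    unfolding convolution_alt by (simp add: count_by_def case_prod_unfold card_cartesian_product)
  also have "\<dots> = card (SIGMA u : ?F. ?A S \<phi> (fst u) \<times> ?A T \<psi> (snd u))"
  proof -
    have fin_A: "finite (?A S \<phi> p)" "finite (?A T \<psi> p)" for p
      using fin by (auto intro: finite_subset[of _ "Pow S"] finite_subset[of _ "Pow T"])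
    then have "\<forall>u \<in> ?F. finite (?A S \<phi> (fst u) \<times> ?A T \<psi> (snd u))"
      by blast
    from card_SigmaI[OF finite_fibre this] show ?thesis
      by (simp only: case_prod_unfold)
  qed
  also have "\<dots> = card (?A (S \<union> T) (\<lambda>D. f (\<phi> D) (\<psi> D)) k)"
  proof (rule bij_betw_same_card[OF bij_betw_byWitness])
    let ?h = "\<lambda>(u :: (nat \<times> bool) \<times> (nat \<times> bool), D, E). D \<union> E"
    let ?h' = "\<lambda>D. (((card (D \<inter> S), \<phi> D), (card (D \<inter> T), \<psi> D)), (D \<inter> S, D \<inter> T))"
    let ?U = "SIGMA u : ?F. ?A S \<phi> (fst u) \<times> ?A T \<psi> (snd u)"
    have *: "(D \<union> E) \<inter> S = D" "(D \<union> E) \<inter> T = E" "\<phi> (D \<union> E) = \<phi> D" "\<psi> (D \<union> E) = \<psi> E"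
      "card (D \<union> E) = card D + card E"
      if "D \<subseteq> S" "E \<subseteq> T" for D E
    proof -
      show 1: "(D \<union> E) \<inter> S = D" "(D \<union> E) \<inter> T = E"
        using that disj by auto
      show "\<phi> (D \<union> E) = \<phi> D" "\<psi> (D \<union> E) = \<psi> E"
        using loc(1)[of "D \<union> E"] loc(2)[of "D \<union> E"] 1 by simp_all
      show "card (D \<union> E) = card D + card E"
        using that disj fin by (intro card_Un_disjoint) (auto dest: finite_subset)
    qed
    \<comment> \<open>The index \<open>u\<close> is determined by \<open>D\<close> and
      \<open>E\<close>, so the dependent sum amounts to the pairs \<open>(D, E)\<close> subject to a
      single condition.\<close>
    have U: "(u, D, E) \<in> ?U \<longleftrightarrow> D \<subseteq> S \<and> E \<subseteq> T \<and> u = ((card D, \<phi> D), (card E, \<psi> E)) \<and>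
        (card D + card E, f (\<phi> D) (\<psi> E)) = k" for u D E
      by (cases u) auto
    show "\<forall>a \<in> ?U. ?h' (?h a) = a"
    proof (intro ballI)
      fix a assume "a \<in> ?U"
      moreover obtain u D E where "a = (u, D, E)"
        by (rule prod_cases3)
      ultimately show "?h' (?h a) = a"
        using * by (simp only: U prod.case)
    qed
    show "?h ` ?U \<subseteq> ?A (S \<union> T) (\<lambda>D. f (\<phi> D) (\<psi> D)) k"
    proof (intro image_subsetI)
      fix a assume "a \<in> ?U"
      moreover obtain u D E where a: "a = (u, D, E)"
        by (rule prod_cases3)
      ultimately have D: "D \<subseteq> S" "E \<subseteq> T" and k: "(card D + card E, f (\<phi> D) (\<psi> E)) = k"
        by (simp_all only: U)
      show "?h a \<in> ?A (S \<union> T) (\<lambda>D. f (\<phi> D) (\<psi> D)) k"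
        using *[OF D] D unfolding a k[symmetric] by auto
    qed
    have **: "(D \<inter> S) \<union> (D \<inter> T) = D" "card (D \<inter> S) + card (D \<inter> T) = card D" if "D \<subseteq> S \<union> T" for D
    proof -
      show "(D \<inter> S) \<union> (D \<inter> T) = D"
        using that by auto
      then show "card (D \<inter> S) + card (D \<inter> T) = card D"
        using *(5)[of "D \<inter> S" "D \<inter> T"] by simp
    qed
    show "\<forall>D \<in> ?A (S \<union> T) (\<lambda>D. f (\<phi> D) (\<psi> D)) k. ?h (?h' D) = D"
      using ** by simp
    show "?h' ` ?A (S \<union> T) (\<lambda>D. f (\<phi> D) (\<psi> D)) k \<subseteq> ?U"
    proof (intro image_subsetI)
      fix D assume "D \<in> ?A (S \<union> T) (\<lambda>D. f (\<phi> D) (\<psi> D)) k"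
      then have "D \<subseteq> S \<union> T" "(card D, f (\<phi> D) (\<psi> D)) = k"
        by (auto simp: prod_eq_iff)
      then show "?h' D \<in> ?U"
        unfolding U using loc ** by simp
    qed
  qed
  also have "\<dots> = count_by (S \<union> T) (\<lambda>D. f (\<phi> D) (\<psi> D)) k"
    by (simp add: count_by_def case_prod_unfold)
  finally show "convolution f (count_by S \<phi>) (count_by T \<psi>) k = count_by (S \<union> T) (\<lambda>D. f (\<phi> D) (\<psi> D)) k" .
qed

lemma finsum_count_by:
  assumes "finite A" and fin: "\<And>y. y \<in> A \<Longrightarrow> finite (S y)"
    and disj: "\<And>y z. y \<in> A \<Longrightarrow> z \<in> A \<Longrightarrow> y \<noteq> z \<Longrightarrow> S y \<inter> S z = {}"
    and loc: "\<And>y D. y \<in> A \<Longrightarrow> \<phi> y (D \<inter> S y) = \<phi> y D"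
  shows "(\<Oplus>\<^bsub>shapley\<^esub>y \<in> A. count_by (S y) (\<phi> y)) = count_by (\<Union>y \<in> A. S y) (\<lambda>D. \<exists>y \<in> A. \<phi> y D)"
  using assms
proof (induction A rule: finite_induct)
  case empty
  then show ?case
    by (simp add: count_by_empty shapley_simps)
next
  case (insert y A)
  \<comment> \<open>Locality of the partial disjunction with respect to the union of its sets, as
    needed for the second factor of the convolution.\<close>
  have *: "(\<exists>z \<in> A. \<phi> z (D \<inter> (\<Union>z \<in> A. S z))) = (\<exists>z \<in> A. \<phi> z D)" for D
  proof (rule bex_cong[OF refl])
    fix z assume z: "z \<in> A"
    then have "D \<inter> (\<Union>z \<in> A. S z) \<inter> S z = D \<inter> S z"
      by auto
    then show "\<phi> z (D \<inter> (\<Union>z \<in> A. S z)) = \<phi> z D"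
      using insert.prems(3) z by (metis insertCI)
  qed
  have disj: "S y \<inter> (\<Union>z \<in> A. S z) = {}"
    using insert.prems(2) insert.hyps by fastforce
  have "(\<Oplus>\<^bsub>shapley\<^esub>y \<in> insert y A. count_by (S y) (\<phi> y)) =
      convolution (\<or>) (count_by (S y) (\<phi> y)) (\<Oplus>\<^bsub>shapley\<^esub>y \<in> A. count_by (S y) (\<phi> y))"
    using insert.hyps by (subst shapley.finsum_insert) (auto simp: shapley_simps)
  also have "\<dots> = convolution (\<or>) (count_by (S y) (\<phi> y)) (count_by (\<Union>y \<in> A. S y) (\<lambda>D. \<exists>y \<in> A. \<phi> y D))"
    using insert by auto
  also have "\<dots> = count_by (S y \<union> (\<Union>y \<in> A. S y)) (\<lambda>D. \<phi> y D \<or> (\<exists>y \<in> A. \<phi> y D))"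
    using insert.hyps insert.prems disj * by (intro convolution_count_by) auto
  finally show ?case
    by simp
qed

text \<open>\<open>S\<close> and \<open>\<phi>\<close> are indexed by all pairs of a symbol and a
  tuple, also by those outside the current query; there the annotation is \<open>\<zero>\<close>, so
  they carry the empty set and the constant false. Disjointness and locality are what the
  convolutions use, the covering makes the last remaining fact account for all of
  \<open>Dn\<close>.\<close>

definition provenance ::
  "('r, 'v) query \<Rightarrow> ('r, 'v, 'd) fact set \<Rightarrow> ('r, 'v, 'd) fact set
    \<Rightarrow> ('r, 'v) query \<Rightarrow> ('r, 'v, 'd, vector) annotated
    \<Rightarrow> (('r, 'v, 'd) fact \<Rightarrow> ('r, 'v, 'd) fact set)
    \<Rightarrow> (('r, 'v, 'd) fact \<Rightarrow> ('r, 'v, 'd) fact set \<Rightarrow> bool) \<Rightarrow> bool" where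
  "provenance Q0 Dx Dn Q D S \<phi> \<longleftrightarrow>
     (\<forall>f g. f \<noteq> g \<longrightarrow> S f \<inter> S g = {}) \<and> (\<Union>f. S f) = Dn \<and>
     (\<forall>f D'. \<phi> f (D' \<inter> S f) = \<phi> f D') \<and>
     (\<forall>R x. D R x = count_by (S (R, x)) (\<phi> (R, x))) \<and>
     (\<forall>D' \<subseteq> Dn. query_true Q0 (Dx \<union> D') = query_true Q {f. \<phi> f D'})"

lemma provenanceD:
  assumes "provenance Q0 Dx Dn Q D S \<phi>"
  shows "f \<noteq> g \<Longrightarrow> S f \<inter> S g = {}" "(\<Union>f. S f) = Dn" "S f \<subseteq> Dn" "\<phi> f (E \<inter> S f) = \<phi> f E"
    "D R x = count_by (S (R, x)) (\<phi> (R, x))"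
    "E \<subseteq> Dn \<Longrightarrow> query_true Q0 (Dx \<union> E) = query_true Q {f. \<phi> f E}"
proof -
  note P = assms[unfolded provenance_def]
  note P2 = P[THEN conjunct2]
  note P3 = P2[THEN conjunct2]
  note P4 = P3[THEN conjunct2]
  show "f \<noteq> g \<Longrightarrow> S f \<inter> S g = {}"
    by (rule P[THEN conjunct1, rule_format])
  show "(\<Union>f. S f) = Dn"
    by (rule P2[THEN conjunct1])
  then show "S f \<subseteq> Dn"
    by blast
  show "\<phi> f (E \<inter> S f) = \<phi> f E"
    by (rule P3[THEN conjunct1, THEN spec, THEN spec])
  show "D R x = count_by (S (R, x)) (\<phi> (R, x))"
    by (rule P4[THEN conjunct1, rule_format])
  show "E \<subseteq> Dn \<Longrightarrow> query_true Q0 (Dx \<union> E) = query_true Q {f. \<phi> f E}"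
    by (rule P4[THEN conjunct2, rule_format])
qed

definition elim_invariant ::
  "('r, 'v) query \<Rightarrow> ('r, 'v, 'd) fact set \<Rightarrow> ('r, 'v, 'd) fact set
    \<Rightarrow> ('r, 'v) query \<times> ('r, 'v, 'd, vector) annotated \<Rightarrow> bool" where
  "elim_invariant Q0 Dx Dn = (\<lambda>(Q, D). sjf_bcq Q \<and> hierarchical Q \<and> finite Dn \<and>
     finite {(R, x). D R x \<noteq> \<zero>\<^bsub>shapley\<^esub>} \<and>
     (\<forall>R x. (R, x) \<notin> facts_over Q \<longrightarrow> D R x = \<zero>\<^bsub>shapley\<^esub>) \<and>
     (\<exists>S \<phi>. provenance Q0 Dx Dn Q D S \<phi>))"

lemma elim_invariant_init:
  assumes "sjf_bcq Q" "hierarchical Q" "database Q Dx" "database Q Dn" "Dx \<inter> Dn = {}"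
  shows "elim_invariant Q Dx Dn (Q, shapley_input Dx Dn)"
proof -
  have fin: "finite Dx" "finite Dn" and over: "Dx \<subseteq> facts_over Q" "Dn \<subseteq> facts_over Q"
    using assms by (auto simp: database_def)
  have "{(R, x). shapley_input Dx Dn R x \<noteq> \<zero>\<^bsub>shapley\<^esub>} \<subseteq> Dx \<union> Dn"
    by (auto simp: shapley_input_def split: if_splits)
  then have "finite {(R, x). shapley_input Dx Dn R x \<noteq> \<zero>\<^bsub>shapley\<^esub>}"
    using fin finite_subset by blast
  moreover have "shapley_input Dx Dn R x = \<zero>\<^bsub>shapley\<^esub>" if "(R, x) \<notin> facts_over Q" for R x
    using that over by (auto simp: shapley_input_def)
  \<comment> \<open>An exogenous fact gets the empty set and the constant true, an endogenous one
    its own singleton. Intersecting with \<open>Dn\<close> makes the predicate local for all other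
    facts too. Disjointness of the two parts excludes a fact annotated by \<open>\<one>\<close>
    whose set is a singleton.\<close>
  moreover have "provenance Q Dx Dn Q (shapley_input Dx Dn) (\<lambda>f. {f} \<inter> Dn) (\<lambda>f D'. f \<in> Dx \<union> D' \<inter> Dn)"
  proof -
    have "shapley_input Dx Dn R x = count_by ({(R, x)} \<inter> Dn) (\<lambda>D'. (R, x) \<in> Dx \<union> D' \<inter> Dn)" for R x
    proof -
      consider "(R, x) \<in> Dx" "(R, x) \<notin> Dn" | "(R, x) \<in> Dn" "(R, x) \<notin> Dx" | "(R, x) \<notin> Dx" "(R, x) \<notin> Dn"
        using assms(5) by blast
      then show ?thesis
      proof cases
        case 2
        then have "count_by ({(R, x)} \<inter> Dn) (\<lambda>D'. (R, x) \<in> Dx \<union> D' \<inter> Dn) = count_by {(R, x)} (\<lambda>D. (R, x) \<in> D)"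
          by (intro count_by_cong) auto
        with 2 show ?thesis
          by (simp add: shapley_input_def count_by_singleton)
      qed (auto simp: shapley_input_def count_by_empty shapley_simps)
    qed
    moreover have "{f. f \<in> Dx \<union> D' \<inter> Dn} = Dx \<union> D'" if "D' \<subseteq> Dn" for D'
      using that by auto
    ultimately show ?thesis
      unfolding provenance_def by auto
  qed
  ultimately show ?thesis
    using assms fin unfolding elim_invariant_def by auto
qed

lemma elim_invariant_support:
  assumes "elim_invariant Q0 Dx Dn (Q, D)" "card Dn < i"
  shows "D R x (i, b) = 0"
proof -
  obtain S \<phi> where "provenance Q0 Dx Dn Q D S \<phi>" and "finite Dn"
    using assms by (auto simp: elim_invariant_def)
  then have "S (R, x) \<subseteq> Dn" "D R x = count_by (S (R, x)) (\<phi> (R, x))" "finite Dn"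
    by (auto simp: provenance_def)
  then show ?thesis
    using count_by_support[of "S (R, x)" i] assms(2) by (metis card_mono finite_subset le_less_trans)
qed

text \<open>A fact of the query after a step inherits the endogenous facts of the facts it is computed from.\<close>

lemma provenance_step:
  assumes P: "provenance Q0 Dx Dn Q D S \<phi>"
    and loc: "\<And>f D'. \<phi>' f (D' \<inter> (\<Union>e \<in> g -` {f}. S e)) = \<phi>' f D'"
    and ann: "\<And>R x. D' R x = count_by (\<Union>e \<in> g -` {(R, x)}. S e) (\<phi>' (R, x))"
    and true: "\<And>E. query_true Q' {f. \<phi>' f E} = query_true Q {f. \<phi> f E}"
  shows "provenance Q0 Dx Dn Q' D' (\<lambda>f. \<Union>e \<in> g -` {f}. S e) \<phi>'"
proof -
  \<comment> \<open>Each old fact feeds exactly one new fact, so the new sets are unions over the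
    disjoint fibres of \<open>g\<close>.\<close>
  have "(\<Union>e \<in> g -` {f}. S e) \<inter> (\<Union>e \<in> g -` {f'}. S e) = {}" if "f \<noteq> f'" for f f'
  proof -
    have "S e \<inter> S e' = {}" if "g e = f" "g e' = f'" for e e'
      using P that \<open>f \<noteq> f'\<close> unfolding provenance_def by metis
    then show ?thesis
      by blast
  qed
  moreover have "(\<Union>f. \<Union>e \<in> g -` {f}. S e) = Dn"
    using P by (auto simp: provenance_def)
  ultimately show ?thesis
    using P loc ann true unfolding provenance_def by simp
qed


text \<open>Once \<open>S (R, x)\<close> is empty, locality makes the predicate constant, with the
  value false that it has on the empty set. This is used both for facts outside the query and for
  summands skipped by rule 1.\<close>

lemma provenance_eq_zero:
  assumes P: "provenance Q0 Dx Dn Q D S \<phi>" and "finite Dn" and "D R x = \<zero>\<^bsub>shapley\<^esub>"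
  shows "S (R, x) = {}" "\<not> \<phi> (R, x) E"
proof -
  have "S (R, x) \<subseteq> Dn" "count_by (S (R, x)) (\<phi> (R, x)) = \<zero>\<^bsub>shapley\<^esub>"
    using P assms(3) by (auto simp: provenance_def)
  then have *: "S (R, x) = {}" "\<not> \<phi> (R, x) {}"
    using count_by_eq_zero[of "S (R, x)" "\<phi> (R, x)"] finite_subset[OF _ assms(2)] by auto
  then have "\<phi> (R, x) E = \<phi> (R, x) {}"
    using P unfolding provenance_def by (metis Int_empty_right)
  with * show "S (R, x) = {}" "\<not> \<phi> (R, x) E"
    by simp_all
qed

lemma provenance_local:
  assumes "provenance Q0 Dx Dn Q D S \<phi>" "S f \<subseteq> T"
  shows "\<phi> f (E \<inter> T) = \<phi> f E"
proof -
  have *: "\<And>E. \<phi> f (E \<inter> S f) = \<phi> f E"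
    using assms(1) unfolding provenance_def by blast
  have "\<phi> f (E \<inter> T) = \<phi> f (E \<inter> T \<inter> S f)" "\<phi> f E = \<phi> f (E \<inter> S f)"
    by (simp_all only: *)
  moreover have "E \<inter> T \<inter> S f = E \<inter> S f"
    using assms(2) by blast
  ultimately show ?thesis
    by simp
qed

section \<open>Effect of the rules on tuples and on query truth\<close>

lemma sjf_bcq_unique: "sjf_bcq Q \<Longrightarrow> (R, X) \<in> Q \<Longrightarrow> (R, Y) \<in> Q \<Longrightarrow> X = Y"
  unfolding sjf_bcq_def by (metis fst_conv inj_onD prod.inject)

lemma mem_facts_over: "(R, x) \<in> facts_over Q \<longleftrightarrow> (R, dom x) \<in> Q"
  by (simp add: facts_over_def)

lemma fresh_not_mem: "R \<notin> fst ` Q \<Longrightarrow> (R, X) \<notin> Q"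
  by (metis fst_conv image_eqI)

text \<open>Connects the two views of rule 1: the annotation ranges over the extensions of
  \<open>x'\<close> by a value at \<open>Y\<close>, whereas provenance and machine group the old
  tuples by their projection.\<close>

lemma restrict_map_delete_iff:
  assumes "Y \<in> X"
  shows "dom x = X \<and> x |` (X - {Y}) = x' \<longleftrightarrow> dom x' = X - {Y} \<and> (\<exists>y. x = x'(Y \<mapsto> y))"
proof
  assume L: "dom x = X \<and> x |` (X - {Y}) = x'"
  then obtain y where y: "x Y = Some y"
    using assms by blast
  have "x v = ((x |` (X - {Y}))(Y \<mapsto> y)) v" for v
    using L y by (cases "v \<in> X") (auto simp: restrict_map_def)
  with L show "dom x' = X - {Y} \<and> (\<exists>y. x = x'(Y \<mapsto> y))"
    by (metis Diff_subset dom_restrict ext inf.absorb_iff2)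
next
  assume "dom x' = X - {Y} \<and> (\<exists>y. x = x'(Y \<mapsto> y))"
  then obtain y where x: "x = x'(Y \<mapsto> y)" and x': "dom x' = X - {Y}"
    by blast
  have "(x'(Y \<mapsto> y) |` dom x') v = x' v" for v
    using x' by (cases "x' v") (auto simp: restrict_map_def)
  then have "x'(Y \<mapsto> y) |` dom x' = x'"
    by (rule ext)
  moreover have "dom (x'(Y \<mapsto> y)) = X"
    using x' assms by auto
  ultimately show "dom x = X \<and> x |` (X - {Y}) = x'"
    unfolding x x'[symmetric] by (rule conjI[rotated])
qed

text \<open>Since \<open>Y\<close> occurs in no other atom, the existential quantifier over its
  value can be moved inwards to the atom \<open>R(X)\<close>, where it is what \<open>R'\<close>
  expresses.\<close>

lemma query_true_rule1:
  assumes r: "rule1 Q R X Y R'"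
    and T: "\<And>S x. S \<noteq> R \<Longrightarrow> S \<noteq> R' \<Longrightarrow> (S, x) \<in> T' \<longleftrightarrow> (S, x) \<in> T"
      "\<And>x. dom x = X - {Y} \<Longrightarrow> (R', x) \<in> T' \<longleftrightarrow> (\<exists>y. (R, x(Y \<mapsto> y)) \<in> T)"
    and sjf: "sjf_bcq Q"
  shows "query_true (rule1_query Q R X Y R') T' \<longleftrightarrow> query_true Q T"
proof -
  have other: "(S, value_tuple w Z) \<in> T' \<longleftrightarrow> (S, value_tuple (w(Y := y)) Z) \<in> T"
    if "(S, Z) \<in> Q - {(R, X)}" for S Z w y
  proof -
    have r': "(R, X) \<in> Q" "R' \<notin> fst ` Q" and SZ: "(S, Z) \<in> Q" "(S, Z) \<noteq> (R, X)"
      using that r by (simp_all add: rule1_def)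
    have "S \<noteq> R" "S \<noteq> R'" "Y \<notin> Z"
      using sjf_bcq_unique[OF sjf SZ(1)] SZ r' fresh_not_mem[OF r'(2)] rule1_other_atoms[OF r SZ(1)]
      by metis+
    moreover have "value_tuple (w(Y := y)) Z = value_tuple w Z"
      using \<open>Y \<notin> Z\<close> by (auto simp: value_tuple_apply)
    ultimately show ?thesis
      using T(1) by simp
  qed
  have new: "(R', value_tuple w (X - {Y})) \<in> T' \<longleftrightarrow> (\<exists>y. (R, value_tuple (w(Y := y)) X) \<in> T)" for w
  proof -
    have "(value_tuple w (X - {Y}))(Y \<mapsto> y) = value_tuple (w(Y := y)) X" for y
      using r by (auto simp: value_tuple_apply rule1_def)
    then show ?thesis
      using T(2) by simp
  qed
  have "query_true (rule1_query Q R X Y R') T' \<longleftrightarrow>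
      (\<exists>w. (R', value_tuple w (X - {Y})) \<in> T' \<and> (\<forall>(S, Z) \<in> Q - {(R, X)}. (S, value_tuple w Z) \<in> T'))"
    by (simp only: query_true_iff rule1_query_def ball_simps prod.case)
  also have "\<dots> \<longleftrightarrow> (\<exists>w y. (R, value_tuple (w(Y := y)) X) \<in> T \<and>
      (\<forall>(S, Z) \<in> Q - {(R, X)}. (S, value_tuple (w(Y := y)) Z) \<in> T))"
  proof -
    have "(\<forall>(S, Z) \<in> Q - {(R, X)}. (S, value_tuple w Z) \<in> T') \<longleftrightarrow>
        (\<forall>(S, Z) \<in> Q - {(R, X)}. (S, value_tuple (w(Y := y)) Z) \<in> T)" for w y
      using other by (intro ball_cong refl) (simp only: split_paired_all prod.case)
    note bodies = this
    have swap: "(\<exists>w. (\<exists>y. A w y) \<and> B w) \<longleftrightarrow> (\<exists>w y. A w y \<and> C w y)"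
      if "\<And>w y. B w = C w y" for A C :: "('b \<Rightarrow> 'c) \<Rightarrow> 'c \<Rightarrow> bool" and B
      by (simp add: that[symmetric])
    show ?thesis
      unfolding new by (rule swap) (rule bodies)
  qed
  also have "\<dots> \<longleftrightarrow> (\<exists>w. (R, value_tuple w X) \<in> T \<and> (\<forall>(S, Z) \<in> Q - {(R, X)}. (S, value_tuple w Z) \<in> T))"
  proof -
    \<comment> \<open>Every valuation is the update of itself by its own value at \<open>Y\<close>,
      so the inner quantifier is absorbed.\<close>
    have "(\<exists>w y. P (w(Y := y))) \<longleftrightarrow> (\<exists>w. P w)" for P :: "('b \<Rightarrow> 'c) \<Rightarrow> bool"
      by (metis fun_upd_triv)
    then show ?thesis .
  qed
  also have "\<dots> \<longleftrightarrow> (\<exists>w. \<forall>(S, Z) \<in> insert (R, X) (Q - {(R, X)}). (S, value_tuple w Z) \<in> T)"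
    by (simp only: ball_simps prod.case)
  also have "insert (R, X) (Q - {(R, X)}) = Q"
    using r by (simp add: rule1_def insert_absorb)
  finally show ?thesis
    unfolding query_true_iff .
qed

lemma query_true_rule2:
  assumes r: "rule2 Q R1 R2 X R'"
    and T: "\<And>S x. S \<noteq> R1 \<Longrightarrow> S \<noteq> R2 \<Longrightarrow> S \<noteq> R' \<Longrightarrow> (S, x) \<in> T' \<longleftrightarrow> (S, x) \<in> T"
      "\<And>x. dom x = X \<Longrightarrow> (R', x) \<in> T' \<longleftrightarrow> (R1, x) \<in> T \<and> (R2, x) \<in> T"
    and sjf: "sjf_bcq Q"
  shows "query_true (rule2_query Q R1 R2 X R') T' \<longleftrightarrow> query_true Q T"
proof -
  let ?Q = "Q - {(R1, X), (R2, X)}"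
  have other: "(S, value_tuple w Z) \<in> T' \<longleftrightarrow> (S, value_tuple w Z) \<in> T" if "(S, Z) \<in> ?Q" for S Z w
  proof -
    have r': "(R1, X) \<in> Q" "(R2, X) \<in> Q" "R' \<notin> fst ` Q"
      and SZ: "(S, Z) \<in> Q" "(S, Z) \<noteq> (R1, X)" "(S, Z) \<noteq> (R2, X)"
      using that r by (simp_all add: rule2_def)
    have "S \<noteq> R1" "S \<noteq> R2" "S \<noteq> R'"
      using sjf_bcq_unique[OF sjf SZ(1)] SZ r' fresh_not_mem[OF r'(3)] by metis+
    then show ?thesis
      by (rule T(1))
  qed
  have "query_true (rule2_query Q R1 R2 X R') T' \<longleftrightarrow>
      (\<exists>w. (R', value_tuple w X) \<in> T' \<and> (\<forall>(S, Z) \<in> ?Q. (S, value_tuple w Z) \<in> T'))"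
    by (simp only: query_true_iff rule2_query_def ball_simps prod.case)
  also have "\<dots> \<longleftrightarrow> (\<exists>w. ((R1, value_tuple w X) \<in> T \<and> (R2, value_tuple w X) \<in> T) \<and>
      (\<forall>(S, Z) \<in> ?Q. (S, value_tuple w Z) \<in> T))"
  proof -
    have "(\<forall>(S, Z) \<in> ?Q. (S, value_tuple w Z) \<in> T') \<longleftrightarrow>
        (\<forall>(S, Z) \<in> ?Q. (S, value_tuple w Z) \<in> T)" for w
      using other by (intro ball_cong refl) (simp only: split_paired_all prod.case)
    then show ?thesis
      by (simp only: T(2)[OF dom_value_tuple])
  qed
  also have "\<dots> \<longleftrightarrow> (\<exists>w. \<forall>(S, Z) \<in> insert (R1, X) (insert (R2, X) ?Q). (S, value_tuple w Z) \<in> T)"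
    by (simp only: ball_simps prod.case conj_assoc)
  also have "insert (R1, X) (insert (R2, X) ?Q) = Q"
    using r unfolding rule2_def by blast
  finally show ?thesis
    unfolding query_true_iff .
qed

section \<open>Preservation of the counting invariant and its final reading\<close>

lemma elim_invariant_rule1:
  fixes Q :: "('r, 'v) query" and D :: "('r, 'v, 'd, vector) annotated"
  assumes inv: "elim_invariant Q0 Dx Dn (Q, D)" and r: "rule1 Q R X Y R'"
  shows "elim_invariant Q0 Dx Dn (rule1_query Q R X Y R', rule1_annot shapley D R X Y R')"
proof -
  let ?Q' = "rule1_query Q R X Y R'" and ?D' = "rule1_annot shapley D R X Y R'"
  let ?g = "\<lambda>(R0, x). if R0 = R then (R', x |` (X - {Y})) else (R0, x)"
  obtain S \<phi> where sjf: "sjf_bcq Q" and hier: "hierarchical Q" and fin: "finite Dn"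
    and fin_D: "finite {(R, x). D R x \<noteq> \<zero>\<^bsub>shapley\<^esub>}"
    and out: "\<And>R x. (R, x) \<notin> facts_over Q \<Longrightarrow> D R x = \<zero>\<^bsub>shapley\<^esub>"
    and P: "provenance Q0 Dx Dn Q D S \<phi>"
    using inv unfolding elim_invariant_def prod.case by blast
  have RX: "(R, X) \<in> Q" and Y: "Y \<in> X" and fresh: "R' \<notin> fst ` Q"
    using r by (simp_all add: rule1_def)
  have "R' \<noteq> R"
    using fresh_not_mem[OF fresh, of X] RX by metis
  have D': "?D' R' x' = (if dom x' = X - {Y}
      then \<Oplus>\<^bsub>shapley\<^esub>y \<in> {y. D R (x'(Y \<mapsto> y)) \<noteq> \<zero>\<^bsub>shapley\<^esub>}. D R (x'(Y \<mapsto> y)) else \<zero>\<^bsub>shapley\<^esub>)"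
    "?D' R x' = \<zero>\<^bsub>shapley\<^esub>" "R0 \<noteq> R \<Longrightarrow> R0 \<noteq> R' \<Longrightarrow> ?D' R0 x' = D R0 x'" for R0 x'
    using \<open>R' \<noteq> R\<close> by (simp_all add: rule1_annot_def)
  have empty: "S (R0, x) = {}" "\<not> \<phi> (R0, x) E" if "(R0, x) \<notin> facts_over Q" for R0 x E
    using provenance_eq_zero[OF P fin out[OF that]] by auto
  \<comment> \<open>\<open>?g\<close> fixes the facts with the new symbol, so the fibre over a new
    fact contains that fact itself; freshness of \<open>R'\<close> makes its old set empty.\<close>
  have empty': "S (R', x) = {}" for x
    using empty(1)[of R' x] fresh_not_mem[OF fresh] by (simp add: mem_facts_over)
  have dom_X: "dom x = X" if "S (R, x) \<noteq> {}" for x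
    using empty(1)[of R x] that sjf_bcq_unique[OF sjf RX] by (metis mem_facts_over)
  define SU where "SU f = (\<Union>e \<in> ?g -` {f}. S e)" for f
  \<comment> \<open>The guard on the domain mirrors \<open>rule1_annot\<close>: a tuple that already
    assigns a value to \<open>Y\<close> can also be updated to a tuple over \<open>X\<close>, and
    must not count.\<close>
  define \<phi>' where "\<phi>' f E = (if fst f = R' then dom (snd f) = X - {Y} \<and> (\<exists>y. \<phi> (R, (snd f)(Y \<mapsto> y)) E)
      else if fst f = R then False else \<phi> f E)" for f E
  have SU_new: "SU (R', x') = (if dom x' = X - {Y} then \<Union>y. S (R, x'(Y \<mapsto> y)) else {})" for x'
  proof -
    have "SU (R', x') = (\<Union>x \<in> {x. dom x = X \<and> x |` (X - {Y}) = x'}. S (R, x))"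
    proof (intro equalityI subsetI)
      fix d assume "d \<in> SU (R', x')"
      then obtain R0 x where e: "?g (R0, x) = (R', x')" "d \<in> S (R0, x)"
        unfolding SU_def by auto
      then have "R0 = R"
        using empty' by (cases "R0 = R") auto
      then have "dom x = X" "x |` (X - {Y}) = x'" "d \<in> S (R, x)"
        using e dom_X[of x] by auto
      then show "d \<in> (\<Union>x \<in> {x. dom x = X \<and> x |` (X - {Y}) = x'}. S (R, x))"
        by blast
    next
      fix d assume "d \<in> (\<Union>x \<in> {x. dom x = X \<and> x |` (X - {Y}) = x'}. S (R, x))"
      then obtain x where "x |` (X - {Y}) = x'" "d \<in> S (R, x)"
        by blast
      moreover from this have "(R, x) \<in> ?g -` {(R', x')}"
        by simp
      ultimately show "d \<in> SU (R', x')"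
        unfolding SU_def by blast
    qed
    also have "{x. dom x = X \<and> x |` (X - {Y}) = x'} = {x. dom x' = X - {Y} \<and> (\<exists>y. x = x'(Y \<mapsto> y))}"
      by (rule Collect_cong) (rule restrict_map_delete_iff[OF Y])
    also have "(\<Union>x \<in> \<dots>. S (R, x)) = (if dom x' = X - {Y} then \<Union>y. S (R, x'(Y \<mapsto> y)) else {})"
      by auto
    finally show ?thesis .
  qed
  have SU_R: "SU (R, x) = {}" for x
    using \<open>R' \<noteq> R\<close> by (auto simp: SU_def split: if_splits)
  have SU_other: "SU (R0, x) = S (R0, x)" if "R0 \<noteq> R" "R0 \<noteq> R'" for R0 x
  proof -
    have "?g -` {(R0, x)} = {(R0, x)}"
      using that by (auto split: if_splits)
    then show ?thesis
      by (simp only: SU_def UN_insert UN_empty Un_empty_right)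
  qed
  have \<phi>'_other: "\<phi>' (R0, x) = \<phi> (R0, x)" if "R0 \<noteq> R" "R0 \<noteq> R'" for R0 x
    using that by (simp add: \<phi>'_def fun_eq_iff)
  \<comment> \<open>A value \<open>y\<close> is recovered from the nonzero fact it belongs to by
    evaluation at \<open>Y\<close>, so finitely many such facts give finitely many values.\<close>
  have fin_y: "finite {y. D R (x'(Y \<mapsto> y)) \<noteq> \<zero>\<^bsub>shapley\<^esub>}" for x'
  proof (rule finite_subset[OF _ finite_imageI[OF fin_D, of "\<lambda>(_, x). the (x Y)"]], rule subsetI)
    fix y assume "y \<in> {y. D R (x'(Y \<mapsto> y)) \<noteq> \<zero>\<^bsub>shapley\<^esub>}"
    then show "y \<in> (\<lambda>(_, x). the (x Y)) ` {(R, x). D R x \<noteq> \<zero>\<^bsub>shapley\<^esub>}"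
      by (intro image_eqI[of _ _ "(R, x'(Y \<mapsto> y))"]) simp_all
  qed
  have "provenance Q0 Dx Dn ?Q' ?D' SU \<phi>'"
  proof (rule provenance_step[OF P, where g = ?g and \<phi>' = \<phi>', folded SU_def])
    fix f E
    show "\<phi>' f (E \<inter> SU f) = \<phi>' f E"
    proof (cases f)
      case (Pair R0 x)
      consider "R0 = R'" | "R0 = R" "R0 \<noteq> R'" | "R0 \<noteq> R" "R0 \<noteq> R'"
        by blast
      then show ?thesis
      proof cases
        case 1
        have "\<phi> (R, x(Y \<mapsto> y)) (E \<inter> SU (R', x)) = \<phi> (R, x(Y \<mapsto> y)) E" if "dom x = X - {Y}" for y
          using that by (intro provenance_local[OF P]) (auto simp: SU_new)
        then show ?thesis
          unfolding Pair 1 \<phi>'_def by auto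
      next
        case 3
        then show ?thesis
          using provenance_local[OF P order_refl] by (simp add: Pair \<phi>'_def SU_other)
      qed (simp add: Pair \<phi>'_def)
    qed
  next
    fix R0 and x :: "('v, 'd) tuple"
    consider "R0 = R'" "dom x = X - {Y}" | "R0 = R'" "dom x \<noteq> X - {Y}" | "R0 = R" "R0 \<noteq> R'"
      | "R0 \<noteq> R" "R0 \<noteq> R'"
      by blast
    then show "?D' R0 x = count_by (SU (R0, x)) (\<phi>' (R0, x))"
    proof cases
      case 1
      let ?A = "{y. D R (x(Y \<mapsto> y)) \<noteq> \<zero>\<^bsub>shapley\<^esub>}"
      have disj: "S (R, x(Y \<mapsto> y)) \<inter> S (R, x(Y \<mapsto> z)) = {}" if "y \<noteq> z" for y z
      proof -
        have "(R, x(Y \<mapsto> y)) \<noteq> (R, x(Y \<mapsto> z))"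
          using that by (metis map_upd_eqD1 prod.inject)
        then show ?thesis
          by (rule provenanceD(1)[OF P])
      qed
      have fin_S: "finite (S (R, x(Y \<mapsto> y)))" for y
        using provenanceD(3)[OF P] fin by (rule finite_subset)
      note ann = provenanceD(5)[OF P]
      have "?D' R0 x = (\<Oplus>\<^bsub>shapley\<^esub>y \<in> ?A. count_by (S (R, x(Y \<mapsto> y))) (\<phi> (R, x(Y \<mapsto> y))))"
        unfolding 1 D'(1) ann[symmetric] using 1 by simp
      also have "\<dots> = count_by (\<Union>y \<in> ?A. S (R, x(Y \<mapsto> y))) (\<lambda>E. \<exists>y \<in> ?A. \<phi> (R, x(Y \<mapsto> y)) E)"
        using provenance_local[OF P order_refl]
        by (intro finsum_count_by[OF fin_y fin_S disj])
      also have "\<dots> = count_by (SU (R0, x)) (\<phi>' (R0, x))"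
      proof (rule count_by_cong)
        \<comment> \<open>The sum skips the values with annotation \<open>\<zero>\<close>, while the
          new set and predicate range over all values; the skipped ones contribute neither
          endogenous facts nor truth.\<close>
        have zero: "y \<in> ?A" if "S (R, x(Y \<mapsto> y)) \<noteq> {} \<or> \<phi> (R, x(Y \<mapsto> y)) E" for y E
          using provenance_eq_zero[OF P fin, of R "x(Y \<mapsto> y)"] that by blast
        then show "(\<Union>y \<in> ?A. S (R, x(Y \<mapsto> y))) = SU (R0, x)"
          unfolding 1(1) SU_new using 1(2) by auto
        show "(\<exists>y \<in> ?A. \<phi> (R, x(Y \<mapsto> y)) E) = \<phi>' (R0, x) E" for E
          unfolding \<phi>'_def using 1 zero[OF disjI2, of _ E] by auto
      qed
      finally show ?thesis .
    qed (use provenanceD(5)[OF P] in \<open>simp_all add: D' SU_new SU_R SU_other \<phi>'_other \<phi>'_def count_by_empty shapley_simps(4)\<close>)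
  next
    fix E
    show "query_true ?Q' {f. \<phi>' f E} = query_true Q {f. \<phi> f E}"
      by (rule query_true_rule1[OF r _ _ sjf]) (simp_all add: \<phi>'_def)
  qed
  moreover have "finite {(R, x). ?D' R x \<noteq> \<zero>\<^bsub>shapley\<^esub>}"
  proof (rule finite_subset[OF _ finite_imageI[OF fin_D, of ?g]], clarify)
    fix R0 x assume nz: "?D' R0 x \<noteq> \<zero>\<^bsub>shapley\<^esub>"
    show "(R0, x) \<in> ?g ` {(R, x). D R x \<noteq> \<zero>\<^bsub>shapley\<^esub>}"
    proof (cases "R0 = R'")
      case True
      then have dom: "dom x = X - {Y}"
        using nz D'(1) by (metis (mono_tags, lifting))
      have "{y. D R (x(Y \<mapsto> y)) \<noteq> \<zero>\<^bsub>shapley\<^esub>} \<noteq> {}"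
      proof
        assume "{y. D R (x(Y \<mapsto> y)) \<noteq> \<zero>\<^bsub>shapley\<^esub>} = {}"
        then have "?D' R0 x = \<zero>\<^bsub>shapley\<^esub>"
          unfolding True D'(1) by (simp only: shapley.finsum_empty if_cancel)
        with nz show False ..
      qed
      then obtain y where y: "D R (x(Y \<mapsto> y)) \<noteq> \<zero>\<^bsub>shapley\<^esub>"
        by blast
      have "x(Y \<mapsto> y) |` (X - {Y}) = x"
        using restrict_map_delete_iff[OF Y, of "x(Y \<mapsto> y)" x] dom by blast
      with y True show ?thesis
        by (intro image_eqI[of _ _ "(R, x(Y \<mapsto> y))"]) simp_all
    next
      case False
      then have "R0 \<noteq> R"
        using nz D'(2) by metis
      with False nz show ?thesis
        by (intro image_eqI[of _ _ "(R0, x)"]) (simp_all add: D'(3))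
    qed
  qed
  moreover have "?D' R0 x = \<zero>\<^bsub>shapley\<^esub>" if "(R0, x) \<notin> facts_over ?Q'" for R0 x
  proof (cases "R0 = R \<or> R0 = R'")
    case True
    have "R0 = R' \<Longrightarrow> dom x \<noteq> X - {Y}"
      using that by (simp add: mem_facts_over rule1_query_def)
    with True show ?thesis
      by (metis D'(1,2))
  next
    case False
    then have "(R0, x) \<notin> facts_over Q"
      using that by (auto simp: mem_facts_over rule1_query_def)
    with False show ?thesis
      by (simp add: D'(3) out)
  qed
  ultimately show ?thesis
    using sjf_bcq_rule1[OF r sjf] hierarchical_rule1[OF r hier] fin
    unfolding elim_invariant_def prod.case by blast
qed

lemma elim_invariant_rule2:
  fixes Q :: "('r, 'v) query" and D :: "('r, 'v, 'd, vector) annotated"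
  assumes inv: "elim_invariant Q0 Dx Dn (Q, D)" and r: "rule2 Q R1 R2 X R'"
  shows "elim_invariant Q0 Dx Dn (rule2_query Q R1 R2 X R', rule2_annot shapley D R1 R2 X R')"
proof -
  let ?Q' = "rule2_query Q R1 R2 X R'" and ?D' = "rule2_annot shapley D R1 R2 X R'"
  let ?g = "\<lambda>(R0, x). if R0 = R1 \<or> R0 = R2 then (R', x) else (R0, x)"
  obtain S \<phi> where sjf: "sjf_bcq Q" and hier: "hierarchical Q" and fin: "finite Dn"
    and fin_D: "finite {(R, x). D R x \<noteq> \<zero>\<^bsub>shapley\<^esub>}"
    and out: "\<And>R x. (R, x) \<notin> facts_over Q \<Longrightarrow> D R x = \<zero>\<^bsub>shapley\<^esub>"
    and P: "provenance Q0 Dx Dn Q D S \<phi>"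
    using inv unfolding elim_invariant_def prod.case by blast
  have RX: "(R1, X) \<in> Q" "(R2, X) \<in> Q" "R1 \<noteq> R2" and fresh: "R' \<notin> fst ` Q"
    using r by (simp_all add: rule2_def)
  have R': "R' \<noteq> R1" "R' \<noteq> R2"
    using fresh_not_mem[OF fresh, of X] RX by metis+
  have D': "?D' R' x = (if dom x = X then convolution (\<and>) (D R1 x) (D R2 x) else \<zero>\<^bsub>shapley\<^esub>)"
    "R0 = R1 \<or> R0 = R2 \<Longrightarrow> ?D' R0 x = \<zero>\<^bsub>shapley\<^esub>"
    "R0 \<noteq> R1 \<Longrightarrow> R0 \<noteq> R2 \<Longrightarrow> R0 \<noteq> R' \<Longrightarrow> ?D' R0 x = D R0 x" for R0 x
    using R' by (auto simp: rule2_annot_def shapley_simps(1))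
  have empty: "S (R0, x) = {}" "\<not> \<phi> (R0, x) E" if "(R0, x) \<notin> facts_over Q" for R0 x E
    using provenance_eq_zero[OF P fin out[OF that]] by auto
  have empty': "S (R', x) = {}" for x
    using empty(1)[of R' x] fresh_not_mem[OF fresh] by (simp add: mem_facts_over)
  \<comment> \<open>Tuples over another domain belong to neither relation, so the formula
    \<open>SU_new\<close> needs no case distinction although the annotation has one.\<close>
  have dom_X: "S (R1, x) = {}" "S (R2, x) = {}" if "dom x \<noteq> X" for x
    using empty(1)[of R1 x] empty(1)[of R2 x] that sjf_bcq_unique[OF sjf RX(1)] sjf_bcq_unique[OF sjf RX(2)]
    by (metis mem_facts_over)+
  define SU where "SU f = (\<Union>e \<in> ?g -` {f}. S e)" for f
  define \<phi>' where "\<phi>' f E = (if fst f = R' then dom (snd f) = X \<and> \<phi> (R1, snd f) E \<and> \<phi> (R2, snd f) E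
      else if fst f = R1 \<or> fst f = R2 then False else \<phi> f E)" for f E
  have SU_new: "SU (R', x) = S (R1, x) \<union> S (R2, x)" for x
  proof (intro equalityI subsetI)
    fix d assume "d \<in> SU (R', x)"
    then obtain R0 x0 where e: "?g (R0, x0) = (R', x)" "d \<in> S (R0, x0)"
      unfolding SU_def by auto
    then show "d \<in> S (R1, x) \<union> S (R2, x)"
      using empty' by (cases "R0 = R1 \<or> R0 = R2") auto
  next
    fix d assume "d \<in> S (R1, x) \<union> S (R2, x)"
    moreover have "(R1, x) \<in> ?g -` {(R', x)}" "(R2, x) \<in> ?g -` {(R', x)}"
      by simp_all
    ultimately show "d \<in> SU (R', x)"
      unfolding SU_def by blast
  qed
  have SU_R: "SU (R0, x) = {}" if "R0 = R1 \<or> R0 = R2" for R0 x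
    using R' that by (auto simp: SU_def split: if_splits)
  have SU_other: "SU (R0, x) = S (R0, x)" if "R0 \<noteq> R1" "R0 \<noteq> R2" "R0 \<noteq> R'" for R0 x
  proof -
    have "?g -` {(R0, x)} = {(R0, x)}"
      using that by (auto split: if_splits)
    then show ?thesis
      by (simp only: SU_def UN_insert UN_empty Un_empty_right)
  qed
  have \<phi>'_other: "\<phi>' (R0, x) = \<phi> (R0, x)" if "R0 \<noteq> R1" "R0 \<noteq> R2" "R0 \<noteq> R'" for R0 x
    using that by (simp add: \<phi>'_def fun_eq_iff)
  have "provenance Q0 Dx Dn ?Q' ?D' SU \<phi>'"
  proof (rule provenance_step[OF P, where g = ?g and \<phi>' = \<phi>', folded SU_def])
    fix f E
    show "\<phi>' f (E \<inter> SU f) = \<phi>' f E"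
    proof (cases f)
      case (Pair R0 x)
      consider "R0 = R'" | "R0 = R1 \<or> R0 = R2" "R0 \<noteq> R'" | "R0 \<noteq> R1" "R0 \<noteq> R2" "R0 \<noteq> R'"
        by blast
      then show ?thesis
      proof cases
        case 1
        have "\<phi> (R1, x) (E \<inter> SU (R', x)) = \<phi> (R1, x) E" "\<phi> (R2, x) (E \<inter> SU (R', x)) = \<phi> (R2, x) E"
          by (intro provenance_local[OF P]; simp add: SU_new)+
        then show ?thesis
          unfolding Pair 1 \<phi>'_def by simp
      next
        case 3
        then show ?thesis
          using provenance_local[OF P order_refl] by (simp add: Pair \<phi>'_def SU_other)
      qed (simp add: Pair \<phi>'_def)
    qed
  next
    fix R0 and x :: "('v, 'd) tuple"
    consider "R0 = R'" "dom x = X" | "R0 = R'" "dom x \<noteq> X" | "R0 = R1 \<or> R0 = R2" "R0 \<noteq> R'"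
      | "R0 \<noteq> R1" "R0 \<noteq> R2" "R0 \<noteq> R'"
      by blast
    then show "?D' R0 x = count_by (SU (R0, x)) (\<phi>' (R0, x))"
    proof cases
      case 1
      \<comment> \<open>The atoms have different symbols, so the conjoined facts are distinct and
        rest on disjoint sets of endogenous facts.\<close>
      have "(R1, x) \<noteq> (R2, x)"
        using RX(3) by simp
      then have disj: "S (R1, x) \<inter> S (R2, x) = {}"
        by (rule provenanceD(1)[OF P])
      have fin_S: "finite (S (R0, x))" for R0
        using provenanceD(3)[OF P] fin by (rule finite_subset)
      note ann = provenanceD(5)[OF P]
      have "?D' R0 x = convolution (\<and>) (D R1 x) (D R2 x)"
        unfolding 1 D'(1) using 1 by simp
      also have "\<dots> = count_by (S (R1, x) \<union> S (R2, x)) (\<lambda>E. \<phi> (R1, x) E \<and> \<phi> (R2, x) E)"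
        unfolding ann using provenance_local[OF P order_refl] by (intro convolution_count_by fin_S disj)
      also have "\<dots> = count_by (SU (R0, x)) (\<phi>' (R0, x))"
        using 1 by (intro count_by_cong) (simp_all add: SU_new \<phi>'_def)
      finally show ?thesis .
    qed (use provenanceD(5)[OF P] in \<open>simp_all add: D' SU_new SU_R SU_other dom_X \<phi>'_other \<phi>'_def count_by_empty shapley_simps(4)\<close>)
  next
    fix E
    show "query_true ?Q' {f. \<phi>' f E} = query_true Q {f. \<phi> f E}"
      by (rule query_true_rule2[OF r _ _ sjf]) (simp_all add: \<phi>'_def)
  qed
  moreover have "finite {(R, x). ?D' R x \<noteq> \<zero>\<^bsub>shapley\<^esub>}"
  proof (rule finite_subset[OF _ finite_imageI[OF fin_D, of ?g]], clarify)
    fix R0 x assume nz: "?D' R0 x \<noteq> \<zero>\<^bsub>shapley\<^esub>"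
    show "(R0, x) \<in> ?g ` {(R, x). D R x \<noteq> \<zero>\<^bsub>shapley\<^esub>}"
    proof (cases "R0 = R'")
      case True
      \<comment> \<open>Here the axiom \<open>\<zero> \<otimes> \<zero> = \<zero>\<close> guarantees
        that a nonzero product comes from a nonzero old fact, which keeps the support
        finite.\<close>
      have "D R1 x \<noteq> \<zero>\<^bsub>shapley\<^esub> \<or> D R2 x \<noteq> \<zero>\<^bsub>shapley\<^esub>"
      proof (rule ccontr)
        assume "\<not> ?thesis"
        then have "?D' R0 x = \<zero>\<^bsub>shapley\<^esub>"
          unfolding True D'(1) using shapley.zero_times_zero by (simp add: shapley_simps(1))
        with nz show False ..
      qed
      then show ?thesis
      proof
        assume "D R1 x \<noteq> \<zero>\<^bsub>shapley\<^esub>"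
        with True show ?thesis
          by (intro image_eqI[of _ _ "(R1, x)"]) simp_all
      next
        assume "D R2 x \<noteq> \<zero>\<^bsub>shapley\<^esub>"
        with True show ?thesis
          by (intro image_eqI[of _ _ "(R2, x)"]) simp_all
      qed
    next
      case False
      then have "R0 \<noteq> R1" "R0 \<noteq> R2"
        using nz D'(2) by metis+
      with False nz show ?thesis
        by (intro image_eqI[of _ _ "(R0, x)"]) (simp_all add: D'(3))
    qed
  qed
  moreover have "?D' R0 x = \<zero>\<^bsub>shapley\<^esub>" if "(R0, x) \<notin> facts_over ?Q'" for R0 x
  proof (cases "R0 = R1 \<or> R0 = R2 \<or> R0 = R'")
    case True
    have "R0 = R' \<Longrightarrow> dom x \<noteq> X"
      using that by (simp add: mem_facts_over rule2_query_def)
    with True show ?thesis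
      by (metis D'(1,2))
  next
    case False
    then have "(R0, x) \<notin> facts_over Q"
      using that by (auto simp: mem_facts_over rule2_query_def)
    with False show ?thesis
      by (simp add: D'(3) out)
  qed
  ultimately show ?thesis
    using sjf_bcq_rule2[OF r sjf] hierarchical_rule2[OF r hier] fin
    unfolding elim_invariant_def prod.case by blast
qed

lemma elim_invariant_step:
  assumes "elim_invariant Q0 Dx Dn c" "elim_step shapley c c'"
  shows "elim_invariant Q0 Dx Dn c'" "query_size (fst c') < query_size (fst c)"
proof -
  obtain Q D Q' D' where c: "c = (Q, D)" "c' = (Q', D')"
    by (meson surj_pair)
  then have "sjf_bcq Q" "hierarchical Q"
    using assms(1) by (auto simp: elim_invariant_def)
  then show "query_size (fst c') < query_size (fst c)"
    using elim_step_query(3) assms(2) unfolding c by fastforce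
  show "elim_invariant Q0 Dx Dn c'"
    using assms(2,1) by (cases rule: elim_step.cases) (auto intro: elim_invariant_rule1 elim_invariant_rule2)
qed

text \<open>All facts except \<open>R()\<close> lie outside the final query and carry empty sets, so
  by the covering \<open>R()\<close> carries all of \<open>Dn\<close>. Its predicate is then the
  truth of the original query, and its annotation is the required count.\<close>

lemma elim_invariant_final:
  fixes Q :: "('r, 'v) query" and D :: "('r, 'v, 'd, vector) annotated"
  assumes "infinite (UNIV :: 'r set)" and inv: "elim_invariant Q0 Dx Dn (Q, D)"
    and stuck: "\<nexists>c'. elim_step shapley (Q, D) c'"
  shows "\<exists>q. outputs (Q, D) q \<and> (\<forall>i. q (i, True) = num_sat Q0 Dx Dn i)"
proof -
  obtain S \<phi> where sjf: "sjf_bcq Q" and hier: "hierarchical Q" and fin: "finite Dn"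
    and out: "\<And>R x. (R, x) \<notin> facts_over Q \<Longrightarrow> D R x = \<zero>\<^bsub>shapley\<^esub>"
    and P: "provenance Q0 Dx Dn Q D S \<phi>"
    using inv unfolding elim_invariant_def prod.case by blast
  have "\<nexists>R X Y R'. rule1 Q R X Y R'" "\<nexists>R1 R2 X R'. rule2 Q R1 R2 X R'"
    using stuck elim_step.intros[where K = shapley and D = D] by metis+
  then obtain R where Q: "Q = {(R, {})}"
    using stuck_query[OF assms(1) sjf hier] by blast
  have empty: "S f = {}" if "f \<noteq> (R, Map.empty)" for f
  proof -
    have "f \<notin> facts_over Q"
      using that by (auto simp: facts_over_def Q)
    then show ?thesis
      using provenance_eq_zero(1)[OF P fin out] by (metis surj_pair)
  qed
  have "(\<Union>f. S f) \<subseteq> S (R, Map.empty)"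
  proof (rule UN_least)
    show "S f \<subseteq> S (R, Map.empty)" for f
      using empty[of f] by (cases "f = (R, Map.empty)") simp_all
  qed
  then have "S (R, Map.empty) = Dn"
    unfolding provenanceD(2)[OF P] using provenanceD(3)[OF P] by (rule subset_antisym[rotated])
  then have q: "D R Map.empty = count_by Dn (\<phi> (R, Map.empty))"
    using provenanceD(5)[OF P, of R Map.empty] by simp
  have "query_true Q0 (Dx \<union> E) = \<phi> (R, Map.empty) E" if "E \<subseteq> Dn" for E
  proof -
    have "query_true Q0 (Dx \<union> E) = query_true Q {f. \<phi> f E}"
      by (rule provenanceD(6)[OF P that])
    also have "value_tuple w {} = Map.empty" for w :: "'v \<Rightarrow> 'd"
      by (auto simp: value_tuple_apply)
    then have "query_true Q {f. \<phi> f E} = \<phi> (R, Map.empty) E"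
      unfolding query_true_iff Q by simp
    finally show ?thesis .
  qed
  then have "D R Map.empty (i, True) = num_sat Q0 Dx Dn i" for i
    unfolding q count_by_def num_sat_def prod.case by (intro arg_cong[where f = card]) auto
  then show ?thesis
    unfolding outputs_def using Q by auto
qed

section \<open>Running the machine programs\<close>

text \<open>Programs are total and deterministic, so this evaluates the postcondition at the result.
  Clock and peak belong to the state, which makes resource bounds ordinary postconditions.\<close>

definition wp :: "('s, 'a) state \<Rightarrow> ('a \<Rightarrow> 's \<Rightarrow> bool) \<Rightarrow> 's \<Rightarrow> bool" where
  "wp p P s \<longleftrightarrow> (case run_state p s of (a, s') \<Rightarrow> P a s')"

lemma wp_basic [simp]:
  "wp (State_Monad.return a) P s \<longleftrightarrow> P a s"
  "wp (State_Monad.bind p f) P' s \<longleftrightarrow> wp p (\<lambda>a. wp (f a) P') s"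
  "wp State_Monad.get P\<^sub>g s \<longleftrightarrow> P\<^sub>g s s"
  "wp (State_Monad.set s') P\<^sub>s s \<longleftrightarrow> P\<^sub>s () s'"
  by (simp_all add: wp_def case_prod_unfold State_Monad.get_def State_Monad.set_def)

lemma wp_mono: "wp p P s \<Longrightarrow> (\<And>a s'. P a s' \<Longrightarrow> P' a s') \<Longrightarrow> wp p P' s"
  by (auto simp: wp_def)

lemma wp_instr [simp]:
  "wp (tick n) P s \<longleftrightarrow> P () (s\<lparr>clock := clock s + n\<rparr>)"
  "wp (compute a) P' s \<longleftrightarrow> P' a (s\<lparr>clock := clock s + 1\<rparr>)"
  "wp (is_stored f) P\<^sub>b s \<longleftrightarrow> P\<^sub>b (store s f \<noteq> None) (s\<lparr>clock := clock s + key_size f\<rparr>)"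
  "wp (read_store f k) P\<^sub>n s \<longleftrightarrow> P\<^sub>n (annotation s (fst f) (snd f) k) (s\<lparr>clock := clock s + key_size f + 1\<rparr>)"
  "wp (read_work k) P\<^sub>n s \<longleftrightarrow> P\<^sub>n (entry (work s) k) (s\<lparr>clock := clock s + 1\<rparr>)"
  by (simp_all add: tick_def compute_def is_stored_def read_store_def read_work_def annotation_def add.assoc)

text \<open>\<open>I\<close> is indexed by the processed prefix, so that it can speak of partial
  sums. It has to ignore the clock because every round begins with a tick, which is the
  \<open>Suc\<close> in the bound.\<close>

lemma wp_for_each:
  assumes "I [] s"
    and step: "\<And>ys a zs s. xs = ys @ a # zs \<Longrightarrow> I ys s \<Longrightarrow>
      wp (p a) (\<lambda>_ s'. I (ys @ [a]) s' \<and> clock s' \<le> clock s + t) s"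
    and clock: "\<And>ys s n. I ys (s\<lparr>clock := n\<rparr>) = I ys s"
  shows "wp (for_each p xs) (\<lambda>_ s'. I xs s' \<and> clock s' \<le> clock s + length xs * Suc t) s"
proof -
  have "wp (for_each p zs) (\<lambda>_ s'. I xs s' \<and> clock s' \<le> clock s + length zs * Suc t) s"
    if "xs = ys @ zs" "I ys s" for ys zs s
    using that
  proof (induction zs arbitrary: ys s)
    case (Cons a zs)
    let ?s = "s\<lparr>clock := clock s + 1\<rparr>"
    have "wp (p a) (\<lambda>_ s'. I (ys @ [a]) s' \<and> clock s' \<le> clock ?s + t) ?s"
      using Cons.prems clock by (intro step) auto
    then have "wp (p a) (\<lambda>_. wp (for_each p zs) (\<lambda>_ s'. I xs s' \<and> clock s' \<le> clock s + length (a # zs) * Suc t)) ?s"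
    proof (rule wp_mono)
      fix s' assume s': "I (ys @ [a]) s' \<and> clock s' \<le> clock ?s + t"
      then have "wp (for_each p zs) (\<lambda>_ s''. I xs s'' \<and> clock s'' \<le> clock s' + length zs * Suc t) s'"
        using Cons.prems by (intro Cons.IH) auto
      then show "wp (for_each p zs) (\<lambda>_ s'. I xs s' \<and> clock s' \<le> clock s + length (a # zs) * Suc t) s'"
        by (rule wp_mono) (use s' in auto)
    qed
    then show ?case
      by simp
  qed simp
  from this[of "[]"] assms(1) show ?thesis
    by simp
qed

section \<open>Truncated vectors and the cost of a convolution\<close>

definition cut_off :: "nat \<Rightarrow> vector \<Rightarrow> vector" where
  "cut_off N g = (\<lambda>k. if fst k \<le> N then g k else 0)"

lemma entry_truncate_vector [simp]: "entry (truncate_vector N g) = cut_off N g"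
  by (auto simp: entry_def truncate_vector_def cut_off_def)

lemma set_indices: "set (indices N) = {k. fst k \<le> N}"
  by (auto simp: indices_def)

lemma length_indices [simp]: "length (indices N) = 2 * Suc N"
  by (simp add: indices_def)

lemma distinct_indices: "distinct (indices N)"
  by (simp add: indices_def distinct_product)

lemma card_indices: "card (set (indices N)) = 2 * Suc N"
  using distinct_card[OF distinct_indices] by simp

lemma dom_truncate_vector [simp]: "dom (truncate_vector N g) = set (indices N)"
  by (auto simp: truncate_vector_def set_indices split: if_splits)

lemma truncate_vector_upd:
  "fst k \<le> N \<Longrightarrow> (truncate_vector N g)(k \<mapsto> n) = truncate_vector N (g(k := n))"
  by (cases k) (auto simp: truncate_vector_def fun_eq_iff)

lemma truncate_vector_cong:
  "(\<And>k. fst k \<le> N \<Longrightarrow> g k = h k) \<Longrightarrow> truncate_vector N g = truncate_vector N h"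
  by (auto simp: truncate_vector_def fun_eq_iff)

text \<open>Indices are nonnegative and add up, so the entries up to \<open>N\<close> of a
  convolution involve only entries up to \<open>N\<close> of its factors.\<close>

lemma convolution_cut_off: "cut_off N (convolution f (cut_off N x) (cut_off N y)) = cut_off N (convolution f x y)"
proof
  fix k
  have "convolution f (cut_off N x) (cut_off N y) k = convolution f x y k" if "fst k \<le> N"
    unfolding convolution_alt using that by (intro sum.cong refl) (auto simp: cut_off_def)
  then show "cut_off N (convolution f (cut_off N x) (cut_off N y)) k = cut_off N (convolution f x y) k"
    by (simp add: cut_off_def)
qed

lemma cut_off_idem [simp]: "cut_off N (cut_off N x) = cut_off N x"
  by (auto simp: cut_off_def)

lemma convolution_cut_off_left: "cut_off N (convolution f (cut_off N x) y) = cut_off N (convolution f x y)"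
  by (metis convolution_cut_off cut_off_idem)

lemma convolution_cut_off_right: "cut_off N (convolution f x (cut_off N y)) = cut_off N (convolution f x y)"
  by (metis convolution_cut_off cut_off_idem)

lemma cut_off_zero [simp]: "cut_off N \<zero>\<^bsub>shapley\<^esub> = \<zero>\<^bsub>shapley\<^esub>"
  by (auto simp: cut_off_def shapley_simps)

text \<open>The inner range ends at \<open>N - fst p\<close>: the loops visit the pairs whose
  indices sum to at most \<open>N\<close>. So no write leaves the vector, and for
  \<open>fst k \<le> N\<close> the whole fibre over \<open>k\<close> is visited.\<close>

lemma convolution_loop:
  assumes "fst k \<le> N"
  shows "(\<Sum>p\<leftarrow>indices N. \<Sum>q\<leftarrow>indices (N - fst p).
      if (fst p + fst q, f (snd p) (snd q)) = k then x p * y q else 0) = convolution f x y k"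
proof -
  let ?I = "SIGMA p : set (indices N). set (indices (N - fst p))"
  let ?F = "{(p, q). (fst p + fst q, f (snd p) (snd q)) = k}"
  have "(\<Sum>p\<leftarrow>indices N. \<Sum>q\<leftarrow>indices (N - fst p).
      if (fst p + fst q, f (snd p) (snd q)) = k then x p * y q else 0) =
      (\<Sum>(p, q) \<in> ?I. if (fst p + fst q, f (snd p) (snd q)) = k then x p * y q else 0)"
    by (simp add: sum_list_distinct_conv_sum_set distinct_indices sum.Sigma)
  also have "\<dots> = (\<Sum>(p, q) \<in> ?F. x p * y q)"
  proof (rule sum.mono_neutral_cong_right)
    show "?F \<subseteq> ?I"
      using assms by (auto simp: set_indices)
    show "finite ?I"
      by simp
  qed (auto split: if_splits)
  finally show ?thesis
    by (simp only: convolution_alt)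
qed

lemma annotation_clock: "annotation (s\<lparr>clock := n\<rparr>) = annotation s"
  by (intro ext) (simp add: annotation_def)

lemma annotation_cong: "store s f = store s' f \<Longrightarrow> annotation s (fst f) (snd f) = annotation s' (fst f) (snd f)"
  by (rule ext) (simp add: annotation_def)

text \<open>Initialization takes a tick and a write per entry. An inner round costs one tick and
  \<open>2 * q + 8\<close>: two reads of the store at \<open>q + 1\<close> each, four computations,
  one read and one write of the work vector. An outer round adds its tick and the computation of the
  inner range.\<close>

definition convolve_cost :: "nat \<Rightarrow> nat \<Rightarrow> nat" where
  "convolve_cost N q = 2 * Suc N * 2 + 2 * Suc N * Suc (1 + 2 * Suc N * Suc (2 * q + 8))"

text \<open>The facts in \<open>F\<close> may be stored, their keys have size at most \<open>q\<close>, and \<open>P\<close> bounds the space.\<close>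

locale budget =
  fixes N q P :: nat and F :: "('r, 'v, 'd) fact set"
  assumes finite_F: "finite F" and key_size_F: "f \<in> F \<Longrightarrow> key_size f \<le> q"
    and peak_bound: "card F * (q + 2 * Suc N) + 2 * Suc N \<le> P"
begin

definition fits :: "('r, 'v, 'd) machine \<Rightarrow> bool" where
  "fits s \<longleftrightarrow> dom (store s) \<subseteq> F \<and> (\<forall>v \<in> ran (store s). dom v \<subseteq> set (indices N)) \<and>
     dom (work s) \<subseteq> set (indices N) \<and> peak s \<le> P"

lemma fits_clock [simp]: "fits (s\<lparr>clock := n\<rparr>) = fits s"
  by (simp add: fits_def)

text \<open>A stored vector occupies its key and at most \<open>2 * Suc N\<close> entries, and
  \<open>work\<close> adds as many once. As the bound depends only on the store staying within
  \<open>F\<close>, it holds after every single instruction.\<close>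

lemma cells_le:
  assumes "dom (store s) \<subseteq> F" "\<And>v. v \<in> ran (store s) \<Longrightarrow> dom v \<subseteq> set (indices N)"
    "dom (work s) \<subseteq> set (indices N)"
  shows "cells s \<le> P"
proof -
  have card_le: "card A \<le> 2 * Suc N" if "A \<subseteq> set (indices N)" for A
    using card_mono[OF _ that] by (simp add: card_indices)
  have "(\<Sum>f \<in> dom (store s). key_size f + card (dom (the (store s f)))) \<le> (\<Sum>f \<in> dom (store s). q + 2 * Suc N)"
  proof (rule sum_mono)
    fix f assume f: "f \<in> dom (store s)"
    then have "dom (the (store s f)) \<subseteq> set (indices N)"
      by (intro assms(2)) (auto intro: ranI)
    then show "key_size f + card (dom (the (store s f))) \<le> q + 2 * Suc N"
      using f assms(1) by (intro add_mono key_size_F card_le) (rule subsetD)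
  qed
  also have "\<dots> \<le> card F * (q + 2 * Suc N)"
    using mult_le_mono1[OF card_mono[OF finite_F assms(1)]] by (simp only: sum_constant of_nat_id)
  finally have "(\<Sum>f \<in> dom (store s). key_size f + card (dom (the (store s f)))) \<le> card F * (q + 2 * Suc N)" .
  then show ?thesis
    using card_le[OF assms(3)] peak_bound unfolding cells_def by linarith
qed

lemma wp_modify:
  assumes "store (g (s\<lparr>clock := clock s + n\<rparr>)) = \<sigma>" "work (g (s\<lparr>clock := clock s + n\<rparr>)) = w"
    "clock (g (s\<lparr>clock := clock s + n\<rparr>)) = clock s + n"
    and "dom \<sigma> \<subseteq> F" "\<And>v. v \<in> ran \<sigma> \<Longrightarrow> dom v \<subseteq> set (indices N)" "dom w \<subseteq> set (indices N)"
    and "peak s \<le> P"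
  shows "wp (modify n g) (\<lambda>_ s'. store s' = \<sigma> \<and> work s' = w \<and> fits s' \<and> clock s' = clock s + n) s"
  using assms cells_le[of "g (s\<lparr>clock := clock s + n\<rparr>)"]
  by (simp add: modify_def fits_def)

lemma wp_write_work:
  assumes "fits s" "fst k \<le> N"
  shows "wp (write_work k n) (\<lambda>_ s'. store s' = store s \<and> work s' = (work s)(k \<mapsto> n) \<and> fits s' \<and>
    clock s' = clock s + 1) s"
proof -
  have "k \<in> set (indices N)"
    using assms(2) by (simp add: set_indices)
  then show ?thesis
    unfolding write_work_def using assms(1) by (intro wp_modify) (auto simp: fits_def)
qed

lemma wp_copy_work:
  assumes "fits s" "f \<in> F"
  shows "wp (copy_work f) (\<lambda>_ s'. store s' = (store s)(f \<mapsto> work s) \<and> work s' = work s \<and> fits s' \<and>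
    clock s' \<le> clock s + (q + 2 * Suc N)) s"
proof -
  let ?n = "key_size f + card (dom (work s))"
  have "?n \<le> q + 2 * Suc N"
    using key_size_F[OF assms(2)] card_mono[of "set (indices N)" "dom (work s)"] assms(1)
    by (intro add_mono) (auto simp: fits_def card_indices)
  moreover have "wp (modify ?n (\<lambda>s. s\<lparr>store := (store s)(f \<mapsto> work s)\<rparr>)) (\<lambda>_ s'. store s' = (store s)(f \<mapsto> work s) \<and>
      work s' = work s \<and> fits s' \<and> clock s' = clock s + ?n) s"
    using assms by (intro wp_modify) (auto simp: fits_def ran_def split: if_splits)
  ultimately show ?thesis
    unfolding copy_work_def by (auto elim!: wp_mono)
qed

lemma wp_delete:
  assumes "fits s" "key_size f \<le> q"
  shows "wp (delete f) (\<lambda>_ s'. store s' = (store s)(f := None) \<and> work s' = work s \<and> fits s' \<and>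
    clock s' \<le> clock s + (q + 2 * Suc N)) s"
proof -
  let ?n = "key_size f + (case store s f of None \<Rightarrow> 0 | Some v \<Rightarrow> card (dom v))"
  have "(case store s f of None \<Rightarrow> 0 | Some v \<Rightarrow> card (dom v)) \<le> 2 * Suc N"
  proof (cases "store s f")
    case (Some v)
    then have "dom v \<subseteq> set (indices N)"
      using assms(1) ranI[of "store s" f v] by (simp add: fits_def)
    with Some show ?thesis
      using card_mono[of "set (indices N)" "dom v"] by (simp add: card_indices)
  qed simp
  then have "?n \<le> q + 2 * Suc N"
    using assms(2) by (rule add_mono[rotated])
  moreover have "wp (modify ?n (\<lambda>s. s\<lparr>store := (store s)(f := None)\<rparr>)) (\<lambda>_ s'. store s' = (store s)(f := None) \<and>
      work s' = work s \<and> fits s' \<and> clock s' = clock s + ?n) s"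
    using assms by (intro wp_modify) (auto simp: fits_def ran_def split: if_splits)
  ultimately show ?thesis
    unfolding delete_def by (auto elim!: wp_mono)
qed

text \<open>In \<open>?J\<close> the work vector is the truncation of a function \<open>g\<close>;
  an inner round adds \<open>?t\<close> to \<open>g\<close>, rows add up these contributions, and
  \<open>convolution_loop\<close> identifies the total. The result is built in \<open>work\<close>
  so that the operands stay intact: in rule 1 the target is itself an operand.\<close>

lemma wp_convolve:
  assumes s0: "fits s0" and keys: "key_size f1 \<le> q" "key_size f2 \<le> q"
  shows "wp (convolve N f f1 f2) (\<lambda>_ s'. store s' = store s0 \<and>
    work s' = truncate_vector N (convolution f (annotation s0 (fst f1) (snd f1)) (annotation s0 (fst f2) (snd f2))) \<and>
    fits s' \<and> clock s' \<le> clock s0 + convolve_cost N q) s0"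
proof -
  let ?a1 = "annotation s0 (fst f1) (snd f1)" and ?a2 = "annotation s0 (fst f2) (snd f2)"
  let ?t = "\<lambda>p q k. if (fst p + fst q, f (snd p) (snd q)) = k then ?a1 p * ?a2 q else 0"
  let ?row = "\<lambda>p k. \<Sum>q\<leftarrow>indices (N - fst p). ?t p q k"
  let ?body = "\<lambda>i1 b1 (i2, b2). do {
         m1 \<leftarrow> read_store f1 (i1, b1);
         m2 \<leftarrow> read_store f2 (i2, b2);
         m \<leftarrow> compute (m1 * m2);
         i \<leftarrow> compute (i1 + i2);
         b \<leftarrow> compute (f b1 b2);
         n \<leftarrow> read_work (i, b);
         n' \<leftarrow> compute (n + m);
         write_work (i, b) n'
       }"
  let ?J = "\<lambda>g s. store s = store s0 \<and> fits s \<and> work s = truncate_vector N g"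
  have init: "wp (for_each (\<lambda>k. write_work k 0) (indices N))
      (\<lambda>_ s. ?J (\<lambda>_. 0) s \<and> clock s \<le> clock s0 + 2 * Suc N * Suc 1) s0"
  proof -
    let ?I = "\<lambda>ys s. store s = store s0 \<and> fits s \<and> work s = (\<lambda>k. if k \<in> set ys then Some 0 else work s0 k)"
    have "wp (for_each (\<lambda>k. write_work k 0) (indices N))
      (\<lambda>_ s. ?I (indices N) s \<and> clock s \<le> clock s0 + length (indices N) * Suc 1) s0"
    proof (rule wp_for_each)
      fix ys k zs and s :: "('r, 'v, 'd) machine"
      assume eq: "indices N = ys @ k # zs" and I: "?I ys s"
      have "k \<in> set (indices N)"
        unfolding eq by simp
      then have "fst k \<le> N"
        by (simp add: set_indices)
      then show "wp (write_work k 0) (\<lambda>_ s'. ?I (ys @ [k]) s' \<and> clock s' \<le> clock s + 1) s"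
        using I by (intro wp_mono[OF wp_write_work]) (auto simp: fun_eq_iff)
    qed (use s0 in auto)
    then show ?thesis
    proof (rule wp_mono)
      fix s assume "?I (indices N) s \<and> clock s \<le> clock s0 + length (indices N) * Suc 1"
      \<comment> \<open>Remains of an earlier computation lie within the same index range by
        \<open>fits\<close>, so all of them are overwritten.\<close>
      moreover have "(\<lambda>k. if k \<in> set (indices N) then Some 0 else work s0 k) = truncate_vector N (\<lambda>_. 0)"
        using s0 by (fastforce simp: fits_def truncate_vector_def set_indices fun_eq_iff)
      ultimately show "?J (\<lambda>_. 0) s \<and> clock s \<le> clock s0 + 2 * Suc N * Suc 1"
        by simp
    qed
  qed
  have body: "wp (?body (fst p) (snd p) r) (\<lambda>_ s'. ?J (\<lambda>k. g k + ?t p r k) s' \<and> clock s' \<le> clock s + (2 * q + 8)) s"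
    if J: "?J g s" and le: "fst p + fst r \<le> N" for p r g s
  proof -
    obtain i1 b1 i2 b2 where pr: "p = (i1, b1)" "r = (i2, b2)"
      by fastforce
    have ann: "annotation s R x = annotation s0 R x" for R x
      using J annotation_cong[of s "(R, x)" s0] by simp
    let ?k = "(i1 + i2, f b1 b2)"
    have work: "entry (work s) ?k = g ?k"
      using J le by (simp add: pr cut_off_def)
    have "wp (write_work ?k (g ?k + ?a1 p * ?a2 r)) (\<lambda>_ s'. ?J (\<lambda>k. g k + ?t p r k) s' \<and> clock s' \<le> clock s + (2 * q + 8))
        (s\<lparr>clock := n\<rparr>)" if n: "n \<le> clock s + (2 * q + 7)" for n
    proof (rule wp_mono[OF wp_write_work])
      fix s'
      assume "store s' = store (s\<lparr>clock := n\<rparr>) \<and>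
        work s' = (work (s\<lparr>clock := n\<rparr>))(?k \<mapsto> g ?k + ?a1 p * ?a2 r) \<and> fits s' \<and>
        clock s' = clock (s\<lparr>clock := n\<rparr>) + 1"
      moreover have "(truncate_vector N g)(?k \<mapsto> g ?k + ?a1 p * ?a2 r) = truncate_vector N (\<lambda>k. g k + ?t p r k)"
        using le by (subst truncate_vector_upd) (auto simp: pr intro!: truncate_vector_cong)
      ultimately show "?J (\<lambda>k. g k + ?t p r k) s' \<and> clock s' \<le> clock s + (2 * q + 8)"
        using J n by simp
    qed (use J le in \<open>simp_all add: pr\<close>)
    then show ?thesis
      using keys by (simp add: pr ann work annotation_clock)
  qed
  have row: "wp (for_each (?body (fst p) (snd p)) (indices (N - fst p)))
      (\<lambda>_ s'. ?J (\<lambda>k. g k + ?row p k) s' \<and> clock s' \<le> clock s + 2 * Suc N * Suc (2 * q + 8)) s"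
    if J: "?J g s" and le: "fst p \<le> N" for p g s
  proof -
    let ?I = "\<lambda>ys s. ?J (\<lambda>k. g k + (\<Sum>q\<leftarrow>ys. ?t p q k)) s"
    have "wp (for_each (?body (fst p) (snd p)) (indices (N - fst p))) (\<lambda>_ s'. ?I (indices (N - fst p)) s' \<and>
        clock s' \<le> clock s + length (indices (N - fst p)) * Suc (2 * q + 8)) s"
    proof (rule wp_for_each)
      fix ys r zs and s :: "('r, 'v, 'd) machine"
      assume eq: "indices (N - fst p) = ys @ r # zs" and I: "?I ys s"
      have "r \<in> set (indices (N - fst p))"
        unfolding eq by simp
      then have "fst p + fst r \<le> N"
        using le by (simp add: set_indices)
      from body[OF I this] show "wp (?body (fst p) (snd p) r) (\<lambda>_ s'. ?I (ys @ [r]) s' \<and> clock s' \<le> clock s + (2 * q + 8)) s"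
        by (simp add: add.assoc)
    qed (use J in simp_all)
    then show ?thesis
    proof (rule wp_mono)
      fix s' assume *: "?I (indices (N - fst p)) s' \<and> clock s' \<le> clock s + length (indices (N - fst p)) * Suc (2 * q + 8)"
      have "length (indices (N - fst p)) * Suc (2 * q + 8) \<le> 2 * Suc N * Suc (2 * q + 8)"
        by (intro mult_right_mono) auto
      with * show "?J (\<lambda>k. g k + ?row p k) s' \<and> clock s' \<le> clock s + 2 * Suc N * Suc (2 * q + 8)"
        by linarith
    qed
  qed
  have main: "wp (for_each (\<lambda>(i1, b1). do { M \<leftarrow> compute (N - i1); for_each (?body i1 b1) (indices M) }) (indices N))
      (\<lambda>_ s'. ?J (\<lambda>k. \<Sum>p\<leftarrow>indices N. ?row p k) s' \<and>
        clock s' \<le> clock s + 2 * Suc N * Suc (1 + 2 * Suc N * Suc (2 * q + 8))) s"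
    if J: "?J (\<lambda>_. 0) s" for s
  proof -
    let ?I = "\<lambda>ys s. ?J (\<lambda>k. \<Sum>p\<leftarrow>ys. ?row p k) s"
    have "wp (for_each (\<lambda>(i1, b1). do { M \<leftarrow> compute (N - i1); for_each (?body i1 b1) (indices M) }) (indices N))
      (\<lambda>_ s'. ?I (indices N) s' \<and>
        clock s' \<le> clock s + length (indices N) * Suc (1 + 2 * Suc N * Suc (2 * q + 8))) s"
    proof (rule wp_for_each)
      fix ys p zs and s :: "('r, 'v, 'd) machine"
      assume eq: "indices N = ys @ p # zs" and I: "?I ys s"
      have "p \<in> set (indices N)"
        unfolding eq by simp
      then have le: "fst p \<le> N"
        by (simp add: set_indices)
      have "?I ys (s\<lparr>clock := clock s + 1\<rparr>)"
        using I by simp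
      note row = row[OF this le]
      obtain i1 b1 where p: "p = (i1, b1)"
        by fastforce
      show "wp (case p of (i1, b1) \<Rightarrow> do { M \<leftarrow> compute (N - i1); for_each (?body i1 b1) (indices M) })
        (\<lambda>_ s'. ?I (ys @ [p]) s' \<and> clock s' \<le> clock s + (1 + 2 * Suc N * Suc (2 * q + 8))) s"
        unfolding p prod.case wp_basic wp_instr by (rule wp_mono[OF row[unfolded p fst_conv snd_conv]]) simp
    qed (use J in simp_all)
    then show ?thesis
      by simp
  qed
  have final: "truncate_vector N (\<lambda>k. \<Sum>p\<leftarrow>indices N. ?row p k) = truncate_vector N (convolution f ?a1 ?a2)"
    by (rule truncate_vector_cong) (rule convolution_loop)
  show ?thesis
    unfolding convolve_def wp_basic
  proof (rule wp_mono[OF init])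
    fix s assume s: "?J (\<lambda>_. 0) s \<and> clock s \<le> clock s0 + 2 * Suc N * Suc 1"
    show "wp (for_each (\<lambda>(i1, b1). do { M \<leftarrow> compute (N - i1); for_each (?body i1 b1) (indices M) }) (indices N))
        (\<lambda>_ s'. store s' = store s0 \<and> work s' = truncate_vector N (convolution f ?a1 ?a2) \<and> fits s' \<and>
          clock s' \<le> clock s0 + convolve_cost N q) s"
      by (rule wp_mono[OF main]) (use s final in \<open>auto simp: convolve_cost_def\<close>)
  qed
qed

end

lemma wp_work_is_zero:
  "wp (work_is_zero ks) (\<lambda>b s'. b = (\<forall>k \<in> set ks. entry (work s) k = \<zero>\<^bsub>shapley\<^esub> k) \<and>
     store s' = store s \<and> work s' = work s \<and> peak s' = peak s \<and> clock s' \<le> clock s + 2 * length ks) s"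
proof (induction ks arbitrary: s)
  case (Cons k ks)
  let ?s = "s\<lparr>clock := clock s + 1 + 1\<rparr>"
  show ?case
  proof (cases "entry (work s) k = \<zero>\<^bsub>shapley\<^esub> k")
    case True
    have "wp (work_is_zero (k # ks)) P s = wp (work_is_zero ks) P ?s" for P
      using True by simp
    moreover have "wp (work_is_zero ks) (\<lambda>b s'. b = (\<forall>k \<in> set (k # ks). entry (work s) k = \<zero>\<^bsub>shapley\<^esub> k) \<and>
        store s' = store s \<and> work s' = work s \<and> peak s' = peak s \<and>
        clock s' \<le> clock s + 2 * length (k # ks)) ?s"
      by (rule wp_mono[OF Cons.IH]) (use True in auto)
    ultimately show ?thesis
      by simp
  next
    case False
    then show ?thesis
      by simp
  qed
qed simp

text \<open>The cost per stored tuple over all loops of a rule. Of the four multiples of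
  \<open>2 * Suc N\<close>, two pay for the zero test, one for writing or deleting the result, one
  for deleting the old vector. Of the three \<open>q\<close>, two pay for the keys of these changes,
  the third for the projection in rule 1 or the lookup in rule 2. The rest covers ticks and one
  computation.\<close>

definition rule_cost :: "nat \<Rightarrow> nat \<Rightarrow> nat" where
  "rule_cost N q = convolve_cost N q + 4 * (2 * Suc N) + 3 * q + 3"

context budget
begin

lemma wp_assign_work:
  assumes s: "fits s" and f: "f \<in> F" and w: "work s = truncate_vector N c"
  shows "wp (assign_work N f) (\<lambda>_ s'. fits s' \<and> (\<forall>g. g \<noteq> f \<longrightarrow> store s' g = store s g) \<and>
    annotation s' (fst f) (snd f) = cut_off N c \<and> clock s' \<le> clock s + (q + 3 * (2 * Suc N))) s"
proof -
  \<comment> \<open>Outside the index range both vectors are 0, so the finite test decides equality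
    of the full vectors.\<close>
  have zero: "(\<forall>k \<in> set (indices N). entry (work s) k = \<zero>\<^bsub>shapley\<^esub> k) \<longleftrightarrow> cut_off N c = \<zero>\<^bsub>shapley\<^esub>"
  proof -
    have "cut_off N c k = \<zero>\<^bsub>shapley\<^esub> k" if "k \<notin> set (indices N)" for k
      using that by (auto simp: set_indices cut_off_def shapley_simps)
    then show ?thesis
      unfolding w entry_truncate_vector fun_eq_iff by blast
  qed
  show ?thesis
    unfolding assign_work_def wp_basic
  proof (rule wp_mono[OF wp_work_is_zero])
    fix b and s1 :: "('r, 'v, 'd) machine"
    assume "b = (\<forall>k \<in> set (indices N). entry (work s) k = \<zero>\<^bsub>shapley\<^esub> k) \<and> store s1 = store s \<and>
      work s1 = work s \<and> peak s1 = peak s \<and> clock s1 \<le> clock s + 2 * length (indices N)"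
    then have b: "b \<longleftrightarrow> cut_off N c = \<zero>\<^bsub>shapley\<^esub>" and s1: "store s1 = store s" "work s1 = work s" "fits s1"
      "clock s1 \<le> clock s + 2 * (2 * Suc N)"
      using s zero by (simp_all add: fits_def)
    show "wp (if b then delete f else copy_work f) (\<lambda>_ s'. fits s' \<and> (\<forall>g. g \<noteq> f \<longrightarrow> store s' g = store s g) \<and>
        annotation s' (fst f) (snd f) = cut_off N c \<and> clock s' \<le> clock s + (q + 3 * (2 * Suc N))) s1"
    proof (cases b)
      case True
      have "wp (delete f) (\<lambda>_ s'. fits s' \<and> (\<forall>g. g \<noteq> f \<longrightarrow> store s' g = store s g) \<and>
        annotation s' (fst f) (snd f) = cut_off N c \<and> clock s' \<le> clock s + (q + 3 * (2 * Suc N))) s1"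
        by (rule wp_mono[OF wp_delete]) (use s1 b True key_size_F[OF f] in \<open>auto simp: annotation_def\<close>)
      then show ?thesis
        using True by simp
    next
      case False
      have "wp (copy_work f) (\<lambda>_ s'. fits s' \<and> (\<forall>g. g \<noteq> f \<longrightarrow> store s' g = store s g) \<and>
        annotation s' (fst f) (snd f) = cut_off N c \<and> clock s' \<le> clock s + (q + 3 * (2 * Suc N))) s1"
        by (rule wp_mono[OF wp_copy_work]) (use s1 w f in \<open>auto simp: annotation_def\<close>)
      then show ?thesis
        using False by simp
    qed
  qed
qed

lemma wp_convolve_assign:
  assumes s: "fits s" and f: "f \<in> F" and keys: "key_size f1 \<le> q" "key_size f2 \<le> q"
  shows "wp (do { convolve N h f1 f2; assign_work N f }) (\<lambda>_ s'. fits s' \<and>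
    (\<forall>g. g \<noteq> f \<longrightarrow> store s' g = store s g) \<and>
    annotation s' (fst f) (snd f) =
      cut_off N (convolution h (annotation s (fst f1) (snd f1)) (annotation s (fst f2) (snd f2))) \<and>
    clock s' \<le> clock s + (convolve_cost N q + q + 3 * (2 * Suc N))) s"
  unfolding wp_basic
proof (rule wp_mono[OF wp_convolve[OF s keys]], elim conjE)
  fix s1 :: "('r, 'v, 'd) machine"
  let ?c = "convolution h (annotation s (fst f1) (snd f1)) (annotation s (fst f2) (snd f2))"
  assume "store s1 = store s" "work s1 = truncate_vector N ?c" "fits s1" "clock s1 \<le> clock s + convolve_cost N q"
  then show "wp (assign_work N f) (\<lambda>_ s'. fits s' \<and> (\<forall>g. g \<noteq> f \<longrightarrow> store s' g = store s g) \<and>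
      annotation s' (fst f) (snd f) = cut_off N ?c \<and>
      clock s' \<le> clock s + (convolve_cost N q + q + 3 * (2 * Suc N))) s1"
    by (intro wp_mono[OF wp_assign_work[OF _ f]]) auto
qed

lemma wp_delete_all:
  assumes "fits s0" and keys: "\<And>x. x \<in> set xs \<Longrightarrow> key_size (R, x) \<le> q"
  shows "wp (for_each (\<lambda>x. delete (R, x)) xs) (\<lambda>_ s'. fits s' \<and>
    store s' = (\<lambda>f. if fst f = R \<and> snd f \<in> set xs then None else store s0 f) \<and>
    clock s' \<le> clock s0 + length xs * Suc (q + 2 * Suc N)) s0"
proof -
  let ?I = "\<lambda>ys s. fits s \<and> store s = (\<lambda>f. if fst f = R \<and> snd f \<in> set ys then None else store s0 f)"
  have "wp (for_each (\<lambda>x. delete (R, x)) xs) (\<lambda>_ s'. ?I xs s' \<and> clock s' \<le> clock s0 + length xs * Suc (q + 2 * Suc N)) s0"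
  proof (rule wp_for_each)
    fix ys x zs and s :: "('r, 'v, 'd) machine"
    assume eq: "xs = ys @ x # zs" and I: "?I ys s"
    show "wp (delete (R, x)) (\<lambda>_ s'. ?I (ys @ [x]) s' \<and> clock s' \<le> clock s + (q + 2 * Suc N)) s"
      by (rule wp_mono[OF wp_delete]) (use I eq keys in \<open>auto simp: fun_eq_iff\<close>)
  qed (use assms in \<open>auto simp: fun_eq_iff\<close>)
  then show ?thesis
    by (simp only: conj_assoc)
qed

text \<open>After a prefix of \<open>xs\<close>, the new relation holds at each \<open>x'\<close>
  the truncated sum over the processed tuples that project to \<open>x'\<close>; an absent vector
  reads as \<open>\<zero>\<close>, the empty sum. The old relation is deleted only after all its
  tuples have been read.\<close>

lemma wp_rule1_program:
  assumes s0: "fits s0" and "R' \<noteq> R" and fresh: "\<And>x. store s0 (R', x) = None" and xs: "enumerates xs s0 R"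
    and new: "\<And>x. x \<in> set xs \<Longrightarrow> (R', x |` (X - {Y})) \<in> F"
  shows "wp (rule1_program N R X Y R' xs) (\<lambda>_ s'. fits s' \<and>
    (\<forall>x. store s' (R, x) = None) \<and> (\<forall>R0 x. R0 \<noteq> R \<longrightarrow> R0 \<noteq> R' \<longrightarrow> store s' (R0, x) = store s0 (R0, x)) \<and>
    (\<forall>x'. annotation s' R' x' =
      cut_off N (\<Oplus>\<^bsub>shapley\<^esub>x \<in> {x \<in> set xs. x |` (X - {Y}) = x'}. annotation s0 R x)) \<and>
    (\<forall>x'. store s' (R', x') \<noteq> None \<longrightarrow> x' \<in> (\<lambda>x. x |` (X - {Y})) ` set xs) \<and>
    clock s' \<le> clock s0 + length xs * rule_cost N q) s0"
proof -
  let ?r = "\<lambda>x. x |` (X - {Y})" and ?c = "convolve_cost N q + 2 * q + 1 + 3 * (2 * Suc N)"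
  let ?sum = "\<lambda>A x'. \<Oplus>\<^bsub>shapley\<^esub>x \<in> {x \<in> A. ?r x = x'}. annotation s0 R x"
  have key: "key_size (R, x) \<le> q" if "x \<in> set xs" for x
    using that xs s0 by (intro key_size_F) (auto simp: enumerates_def fits_def)
  let ?I = "\<lambda>ys s. fits s \<and> (\<forall>R0 x. R0 \<noteq> R' \<longrightarrow> store s (R0, x) = store s0 (R0, x)) \<and>
    (\<forall>x'. annotation s R' x' = cut_off N (?sum (set ys) x')) \<and>
    (\<forall>x'. store s (R', x') \<noteq> None \<longrightarrow> x' \<in> ?r ` set ys)"
  let ?body = "\<lambda>x. do {
      tick (card (dom x));
      x' \<leftarrow> compute (?r x);
      convolve N (\<or>) (R', x') (R, x);
      assign_work N (R', x')
    }"
  have loop: "wp (for_each ?body xs) (\<lambda>_ s'. ?I xs s' \<and> clock s' \<le> clock s0 + length xs * Suc ?c) s0"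
  proof (rule wp_for_each)
    fix ys x zs and s :: "('r, 'v, 'd) machine"
    assume eq: "xs = ys @ x # zs" and I: "?I ys s"
    then have x: "x \<in> set xs" "x \<notin> set ys"
      using xs by (auto simp: enumerates_def)
    let ?s = "s\<lparr>clock := clock s + card (dom x) + 1\<rparr>"
    let ?S = "?sum (set ys)"
    have clock_s: "clock ?s \<le> clock s + (q + 1)"
      using key[OF x(1)] by (simp add: key_size_def)
    \<comment> \<open>Truncating after every addition is harmless, since cutting an operand does not
      change the cut result.\<close>
    have step: "cut_off N (convolution (\<or>) (annotation s R' (?r x)) (annotation s R x)) = cut_off N (?sum (set (ys @ [x])) (?r x))"
    proof -
      have "annotation s R x = annotation s0 R x"
        using annotation_cong[of s "(R, x)" s0] I \<open>R' \<noteq> R\<close> by simp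
      moreover have "{y \<in> set (ys @ [x]). ?r y = ?r x} = insert x {y \<in> set ys. ?r y = ?r x}"
        by auto
      then have "?sum (set (ys @ [x])) (?r x) = convolution (\<or>) (annotation s0 R x) (?S (?r x))"
        using x(2) by (simp add: shapley.finsum_insert shapley_simps(2))
      ultimately show ?thesis
        using I convolution_comm[of "(\<or>)"] by (simp add: convolution_cut_off_left convolution_cut_off_right disj_commute)
    qed
    have other: "?sum (set (ys @ [x])) x' = ?S x'" if "x' \<noteq> ?r x" for x'
    proof -
      have "{y \<in> set (ys @ [x]). ?r y = x'} = {y \<in> set ys. ?r y = x'}"
        using that by auto
      then show ?thesis
        by simp
    qed
    have fits_s: "fits ?s" and key': "key_size (R', ?r x) \<le> q"
      using I key_size_F[OF new[OF x(1)]] by simp_all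
    have "wp (do { convolve N (\<or>) (R', ?r x) (R, x); assign_work N (R', ?r x) })
      (\<lambda>_ s'. ?I (ys @ [x]) s' \<and> clock s' \<le> clock s + ?c) ?s"
    proof (rule wp_mono[OF wp_convolve_assign[OF fits_s new[OF x(1)] key' key[OF x(1)]]], elim conjE)
      fix s' :: "('r, 'v, 'd) machine"
      assume fits: "fits s'" and store: "\<forall>g. g \<noteq> (R', ?r x) \<longrightarrow> store s' g = store ?s g"
        and ann: "annotation s' (fst (R', ?r x)) (snd (R', ?r x)) =
          cut_off N (convolution (\<or>) (annotation ?s (fst (R', ?r x)) (snd (R', ?r x))) (annotation ?s (fst (R, x)) (snd (R, x))))"
        and clock: "clock s' \<le> clock ?s + (convolve_cost N q + q + 3 * (2 * Suc N))"
      have "annotation s' R' x' = cut_off N (?sum (set (ys @ [x])) x')" for x'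
      proof (cases "x' = ?r x")
        case True
        then show ?thesis
          using ann step by (simp only: annotation_clock fst_conv snd_conv)
      next
        case False
        have "annotation s' R' x' = annotation s R' x'"
          using annotation_cong[of s' "(R', x')" s] store False by simp
        then show ?thesis
          using I other[OF False] by simp
      qed
      moreover have "store s' (R0, y) = store s0 (R0, y)" if "R0 \<noteq> R'" for R0 y
        using that store I by simp
      moreover have "y \<in> ?r ` set (ys @ [x])" if "store s' (R', y) \<noteq> None" for y
        using that store I by (cases "y = ?r x") auto
      ultimately show "?I (ys @ [x]) s' \<and> clock s' \<le> clock s + ?c"
        using fits clock clock_s by simp
    qed
    then show "wp (?body x) (\<lambda>_ s'. ?I (ys @ [x]) s' \<and> clock s' \<le> clock s + ?c) s"
      unfolding wp_basic wp_instr by simp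
  next
    show "?I [] s0"
      using s0 fresh by (simp add: annotation_def)
  qed (simp add: annotation_clock)
  show ?thesis
    unfolding rule1_program_def wp_basic(2)
  proof (rule wp_mono[OF loop[unfolded wp_basic(2)]])
    fix s assume s: "?I xs s \<and> clock s \<le> clock s0 + length xs * Suc ?c"
    show "wp (for_each (\<lambda>x. delete (R, x)) xs) (\<lambda>_ s'. fits s' \<and>
      (\<forall>x. store s' (R, x) = None) \<and> (\<forall>R0 x. R0 \<noteq> R \<longrightarrow> R0 \<noteq> R' \<longrightarrow> store s' (R0, x) = store s0 (R0, x)) \<and>
      (\<forall>x'. annotation s' R' x' = cut_off N (?sum (set xs) x')) \<and>
      (\<forall>x'. store s' (R', x') \<noteq> None \<longrightarrow> x' \<in> ?r ` set xs) \<and>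
      clock s' \<le> clock s0 + length xs * rule_cost N q) s"
    proof (rule wp_mono[OF wp_delete_all], goal_cases)
      case (3 _ s')
      have store: "store s' (R0, x) = (if R0 = R \<and> x \<in> set xs then None else store s (R0, x))" for R0 x
        using 3 by simp
      have "annotation s' R' x' = annotation s R' x'" for x'
        using annotation_cong[of s' "(R', x')" s] store \<open>R' \<noteq> R\<close> by simp
      moreover have "store s' (R, x) = None" for x
      proof (cases "x \<in> set xs")
        case False
        then have "store s0 (R, x) = None"
          using xs by (auto simp: enumerates_def)
        then show ?thesis
          using False s store \<open>R' \<noteq> R\<close> by simp
      qed (simp add: store)
      moreover have "clock s' \<le> clock s0 + length xs * rule_cost N q"
      proof -
        have "length xs * Suc ?c + length xs * Suc (q + 2 * Suc N) = length xs * rule_cost N q"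
          by (simp add: rule_cost_def algebra_simps)
        then show ?thesis
          using 3 s by linarith
      qed
      ultimately show ?case
        using 3 s store \<open>R' \<noteq> R\<close> by simp
    qed (use s key in auto)
  qed
qed

text \<open>The invariant depends only on the set \<open>A\<close> of tuples already treated, so
  both loops share it. During the loops only \<open>R'\<close> is written, so the lookup in
  \<open>R1\<close> still decides membership in \<open>xs1\<close>, and a tuple stored for both
  atoms is treated once.\<close>

lemma wp_rule2_program:
  assumes s0: "fits s0" and R': "R' \<noteq> R1" "R' \<noteq> R2" and fresh: "\<And>x. store s0 (R', x) = None"
    and xs: "enumerates xs1 s0 R1" "enumerates xs2 s0 R2"
    and new: "\<And>x. x \<in> set xs1 \<union> set xs2 \<Longrightarrow> (R', x) \<in> F"
    and keys: "\<And>x. x \<in> set xs1 \<union> set xs2 \<Longrightarrow> key_size (R1, x) \<le> q \<and> key_size (R2, x) \<le> q"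
  shows "wp (rule2_program N R1 R2 R' xs1 xs2) (\<lambda>_ s'. fits s' \<and>
    (\<forall>x. store s' (R1, x) = None \<and> store s' (R2, x) = None) \<and>
    (\<forall>R0 x. R0 \<noteq> R1 \<longrightarrow> R0 \<noteq> R2 \<longrightarrow> R0 \<noteq> R' \<longrightarrow> store s' (R0, x) = store s0 (R0, x)) \<and>
    (\<forall>x. annotation s' R' x = cut_off N (convolution (\<and>) (annotation s0 R1 x) (annotation s0 R2 x))) \<and>
    (\<forall>x. store s' (R', x) \<noteq> None \<longrightarrow> x \<in> set xs1 \<union> set xs2) \<and>
    clock s' \<le> clock s0 + (length xs1 + length xs2) * rule_cost N q) s0"
proof -
  let ?c = "convolve_cost N q + q + 3 * (2 * Suc N)"
  let ?conv = "\<lambda>x. cut_off N (convolution (\<and>) (annotation s0 R1 x) (annotation s0 R2 x))"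
  let ?I = "\<lambda>A s. fits s \<and> (\<forall>R0 x. R0 \<noteq> R' \<longrightarrow> store s (R0, x) = store s0 (R0, x)) \<and>
    (\<forall>x. annotation s R' x = (if x \<in> A then ?conv x else \<zero>\<^bsub>shapley\<^esub>)) \<and>
    (\<forall>x. store s (R', x) \<noteq> None \<longrightarrow> x \<in> A)"
  let ?body = "\<lambda>x. do { convolve N (\<and>) (R1, x) (R2, x); assign_work N (R', x) }"
  have step: "wp (?body x) (\<lambda>_ s'. ?I (insert x A) s' \<and> clock s' \<le> clock s + ?c) s"
    if I: "?I A s" and x: "x \<in> set xs1 \<union> set xs2" for A s x
  proof (rule wp_mono[OF wp_convolve_assign[OF conjunct1[OF I] new[OF x] conjunct1[OF keys[OF x]] conjunct2[OF keys[OF x]]]],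
      elim conjE)
    fix s' :: "('r, 'v, 'd) machine"
    assume fits: "fits s'" and store: "\<forall>g. g \<noteq> (R', x) \<longrightarrow> store s' g = store s g"
      and ann: "annotation s' (fst (R', x)) (snd (R', x)) =
        cut_off N (convolution (\<and>) (annotation s (fst (R1, x)) (snd (R1, x))) (annotation s (fst (R2, x)) (snd (R2, x))))"
      and clock: "clock s' \<le> clock s + ?c"
    have ann_s: "annotation s R1 x = annotation s0 R1 x" "annotation s R2 x = annotation s0 R2 x"
      using annotation_cong[of s "(R1, x)" s0] annotation_cong[of s "(R2, x)" s0] I R' by simp_all
    have "annotation s' R' y = (if y \<in> insert x A then ?conv y else \<zero>\<^bsub>shapley\<^esub>)" for y
    proof (cases "y = x")
      case True
      then show ?thesis
        using ann ann_s by simp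
    next
      case False
      have "annotation s' R' y = annotation s R' y"
        using annotation_cong[of s' "(R', y)" s] store False by simp
      then show ?thesis
        using I False by simp
    qed
    moreover have "store s' (R0, y) = store s0 (R0, y)" if "R0 \<noteq> R'" for R0 y
      using that store I by simp
    moreover have "y \<in> insert x A" if "store s' (R', y) \<noteq> None" for y
      using that store I by (cases "y = x") auto
    ultimately show "?I (insert x A) s' \<and> clock s' \<le> clock s + ?c"
      using fits clock by simp
  qed
  have I_clock: "?I A (s\<lparr>clock := n\<rparr>) = ?I A s" for A s n
    by (simp add: annotation_clock)
  have loop1: "wp (for_each ?body xs1) (\<lambda>_ s'. ?I (set xs1) s' \<and> clock s' \<le> clock s0 + length xs1 * Suc ?c) s0"
  proof (rule wp_for_each)
    fix ys x zs and s :: "('r, 'v, 'd) machine"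
    assume "xs1 = ys @ x # zs" and "?I (set ys) s"
    then show "wp (?body x) (\<lambda>_ s'. ?I (set (ys @ [x])) s' \<and> clock s' \<le> clock s + ?c) s"
      using step[of s "set ys" x] by simp
  next
    show "?I (set []) s0"
      using s0 fresh by (simp add: annotation_def)
  qed (rule I_clock)
  let ?body2 = "\<lambda>x. do { d \<leftarrow> is_stored (R1, x); if d then State_Monad.return () else ?body x }"
  have loop2: "wp (for_each ?body2 xs2) (\<lambda>_ s'. ?I (set xs1 \<union> set xs2) s' \<and> clock s' \<le> clock s + length xs2 * Suc (q + ?c)) s"
    if "?I (set xs1) s" for s
  proof (rule wp_for_each[where I = "\<lambda>ys. ?I (set xs1 \<union> set ys)"])
    fix ys x zs and s :: "('r, 'v, 'd) machine"
    assume eq: "xs2 = ys @ x # zs" and I: "?I (set xs1 \<union> set ys) s"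
    let ?s = "s\<lparr>clock := clock s + key_size (R1, x)\<rparr>"
    have key: "key_size (R1, x) \<le> q"
      using keys eq by simp
    have "store s (R1, x) = store s0 (R1, x)"
      using I R' by simp
    then have d: "store s (R1, x) \<noteq> None \<longleftrightarrow> x \<in> set xs1"
      using xs(1) by (auto simp: enumerates_def)
    show "wp (?body2 x) (\<lambda>_ s'. ?I (set xs1 \<union> set (ys @ [x])) s' \<and> clock s' \<le> clock s + (q + ?c)) s"
    proof (cases "x \<in> set xs1")
      case True
      then have A: "set xs1 \<union> set (ys @ [x]) = set xs1 \<union> set ys"
        by auto
      show ?thesis
        unfolding wp_basic(2) wp_instr d A using True I key by (simp add: annotation_clock)
    next
      case False
      have A: "set xs1 \<union> set (ys @ [x]) = insert x (set xs1 \<union> set ys)"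
        by auto
      have "wp (?body x) (\<lambda>_ s'. ?I (insert x (set xs1 \<union> set ys)) s' \<and> clock s' \<le> clock ?s + ?c) ?s"
        by (intro step) (use I eq in \<open>simp_all add: annotation_clock\<close>)
      then have "wp (?body x) (\<lambda>_ s'. ?I (insert x (set xs1 \<union> set ys)) s' \<and> clock s' \<le> clock s + (q + ?c)) ?s"
        by (rule wp_mono) (use key in simp)
      then show ?thesis
        unfolding wp_basic(2)[of "is_stored _"] wp_instr d A using False by (simp only: if_False)
    qed
  qed (use that in \<open>simp_all add: annotation_clock\<close>)
  show ?thesis
    unfolding rule2_program_def wp_basic(2)
  proof (rule wp_mono[OF loop1[unfolded wp_basic(2)]], rule wp_mono[OF loop2[unfolded wp_basic(2)]], goal_cases)
    case (2 _ s1 _ s2)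
    show ?case
    proof (rule wp_mono[OF wp_delete_all], goal_cases)
      case (3 _ s3)
      then show ?case
      proof (intro wp_mono[OF wp_delete_all], goal_cases)
        case (3 _ s4)
        have store: "store s4 (R0, x) = (if R0 = R1 \<and> x \<in> set xs1 \<or> R0 = R2 \<and> x \<in> set xs2 then None
            else store s2 (R0, x))" for R0 x
          using 3 by auto
        have "annotation s4 R' x = ?conv x" for x
        proof -
          have "annotation s4 R' x = annotation s2 R' x"
            using annotation_cong[of s4 "(R', x)" s2] store R' by simp
          also have "\<dots> = ?conv x"
          proof (cases "x \<in> set xs1 \<union> set xs2")
            case False
            then have "store s0 (R1, x) = None" "store s0 (R2, x) = None"
              using xs by (auto simp: enumerates_def)
            \<comment> \<open>A tuple in neither list is never visited and stays absent, which is
              right because \<open>\<zero> \<otimes> \<zero> = \<zero>\<close>.\<close>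
            then have "?conv x = cut_off N (\<zero>\<^bsub>shapley\<^esub> \<otimes>\<^bsub>shapley\<^esub> \<zero>\<^bsub>shapley\<^esub>)"
              by (simp add: annotation_def shapley_simps(1))
            then show ?thesis
              using 2 False by (simp add: shapley.zero_times_zero)
          qed (use 2 in simp)
          finally show ?thesis .
        qed
        moreover have "store s4 (R1, x) = None \<and> store s4 (R2, x) = None" for x
        proof -
          have "store s2 (R1, x) = store s0 (R1, x)" "store s2 (R2, x) = store s0 (R2, x)"
            using 2 R' by simp_all
          then show ?thesis
            using xs store by (auto simp: enumerates_def)
        qed
        moreover have "clock s4 \<le> clock s0 + (length xs1 + length xs2) * rule_cost N q"
        proof -
          have "length xs1 * Suc ?c + length xs2 * Suc (q + ?c) + length xs1 * Suc (q + 2 * Suc N) +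
              length xs2 * Suc (q + 2 * Suc N) \<le> (length xs1 + length xs2) * rule_cost N q"
            by (simp add: rule_cost_def algebra_simps)
          then show ?thesis
            using 2 3 \<open>fits s3 \<and> _\<close> by linarith
        qed
        ultimately show ?case
          using 2 3 store R' by simp
      qed (use keys in auto)
    qed (use 2 keys in auto)
  qed auto
qed

end

section \<open>Time and space of the elimination algorithm\<close>

lemma key_size_le_query_size:
  assumes "finite Q" "f \<in> facts_over Q"
  shows "key_size f \<le> query_size Q"
proof -
  have "(fst f, dom (snd f)) \<in> Q"
    using assms(2) mem_facts_over[of "fst f" "snd f"] by simp
  from member_le_sum[OF this, of "\<lambda>(R, X). 1 + card X"] show ?thesis
    using assms(1) by (simp add: query_size_def key_size_def)
qed

definition step_cost :: "nat \<Rightarrow> nat \<Rightarrow> nat \<Rightarrow> nat" where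
  "step_cost N q m = q\<^sup>2 + m * rule_cost N q"

text \<open>While a rule runs, the at most \<open>m\<close> old facts and their at most
  \<open>m\<close> images may be stored together; the last summand is the work vector.\<close>

definition space_bound :: "nat \<Rightarrow> nat \<Rightarrow> nat \<Rightarrow> nat" where
  "space_bound N q m = 2 * m * (q + 2 * Suc N) + 2 * Suc N"

text \<open>Every step makes the query smaller, which pays for its time, and does not increase the number
  of stored facts.\<close>

definition machine_invariant ::
  "('r, 'v) query \<Rightarrow> ('r, 'v, 'd) fact set \<Rightarrow> ('r, 'v, 'd) fact set
    \<Rightarrow> ('r, 'v) query \<times> ('r, 'v, 'd) machine \<Rightarrow> bool" where
  "machine_invariant Q0 Dx Dn = (\<lambda>(Q, s).
     let N = card Dn; q = query_size Q0; m = card Dx + card Dn; B = step_cost N q m in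
     elim_invariant Q0 Dx Dn (Q, annotation s) \<and>
     (elim_step shapley)\<^sup>*\<^sup>* (Q0, shapley_input Dx Dn) (Q, annotation s) \<and>
     dom (store s) \<subseteq> facts_over Q \<and> finite (dom (store s)) \<and> card (dom (store s)) \<le> m \<and>
     (\<forall>v \<in> ran (store s). dom v \<subseteq> set (indices N)) \<and> dom (work s) \<subseteq> set (indices N) \<and>
     peak s \<le> space_bound N q m \<and> query_size Q \<le> q \<and> clock s + query_size Q * B \<le> q * B)"

section \<open>The loaded state and the bookkeeping common to both rules\<close>

lemma machine_invariant_init:
  assumes "sjf_bcq Q" "hierarchical Q" "database Q Dx" "database Q Dn" "Dx \<inter> Dn = {}"
  shows "machine_invariant Q Dx Dn (Q, load (card Dn) (shapley_input Dx Dn))"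
proof -
  let ?N = "card Dn" and ?psi = "shapley_input Dx Dn" and ?q = "query_size Q" and ?m = "card Dx + card Dn"
  let ?s = "load ?N ?psi"
  have fin: "finite (Dx \<union> Dn)" and over: "Dx \<union> Dn \<subseteq> facts_over Q" and "finite Q"
    using assms by (auto simp: database_def sjf_bcq_def)
  have inv: "elim_invariant Q Dx Dn (Q, ?psi)"
    using assms by (rule elim_invariant_init)
  have store: "store ?s = (\<lambda>(R, x). if ?psi R x = \<zero>\<^bsub>shapley\<^esub> then None else Some (truncate_vector ?N (?psi R x)))"
    and s: "work ?s = Map.empty" "clock ?s = 0"
    by (simp_all add: load_def Let_def)
  have "cut_off ?N (?psi R x) = ?psi R x" for R x
    using elim_invariant_support[OF inv] by (auto simp: cut_off_def fun_eq_iff)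
  then have ann: "annotation ?s = ?psi"
    by (intro ext) (simp add: annotation_def store)
  have dom: "dom (store ?s) \<subseteq> Dx \<union> Dn"
    by (auto simp: store shapley_input_def split: if_splits)
  have ran: "dom v \<subseteq> set (indices ?N)" if v: "v \<in> ran (store ?s)" for v
  proof -
    obtain f where "store ?s f = Some v"
      using v unfolding ran_def by blast
    then have "v = truncate_vector ?N (?psi (fst f) (snd f))"
      by (simp add: store case_prod_unfold split: if_splits)
    then show ?thesis
      by simp
  qed
  have card: "card (Dx \<union> Dn) \<le> ?m"
    by (rule card_Un_le)
  interpret budget ?N ?q "space_bound ?N ?q ?m" "Dx \<union> Dn"
  proof
    show "key_size f \<le> ?q" if "f \<in> Dx \<union> Dn" for f
      using that over key_size_le_query_size[OF \<open>finite Q\<close>] by blast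
    show "card (Dx \<union> Dn) * (?q + 2 * Suc ?N) + 2 * Suc ?N \<le> space_bound ?N ?q ?m"
      using card unfolding space_bound_def by (intro add_right_mono mult_right_mono) auto
  qed (rule fin)
  have "peak ?s = cells (?s\<lparr>peak := 0\<rparr>)"
    by (simp add: load_def Let_def)
  also have "\<dots> \<le> space_bound ?N ?q ?m"
    using dom ran by (intro cells_le) (simp_all add: s)
  finally have "peak ?s \<le> space_bound ?N ?q ?m" .
  moreover have "card (dom (store ?s)) \<le> ?m"
    using card_mono[OF fin dom] card by linarith
  ultimately show ?thesis
    using inv ann order_trans[OF dom over] ran finite_subset[OF dom fin] unfolding machine_invariant_def
    by (simp add: s Let_def)
qed

text \<open>\<open>h\<close> sends a stored fact to the fact it feeds, so the new store is no larger
  than the old one. The decrease of \<open>query_size\<close> releases at least one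
  \<open>step_cost\<close>, which pays for the elapsed time.\<close>

lemma machine_invariant_next:
  assumes inv: "machine_invariant Q0 Dx Dn (Q, s)"
    and step: "elim_step shapley (Q, annotation s) (Q', annotation s')"
    and store: "dom (store s') \<subseteq> h ` dom (store s)" "dom (store s') \<subseteq> facts_over Q'"
    and rest: "\<forall>v \<in> ran (store s'). dom v \<subseteq> set (indices (card Dn))" "dom (work s') \<subseteq> set (indices (card Dn))"
      "peak s' \<le> space_bound (card Dn) (query_size Q0) (card Dx + card Dn)"
    and clock: "clock s' \<le> clock s + step_cost (card Dn) (query_size Q0) (card Dx + card Dn)"
  shows "machine_invariant Q0 Dx Dn (Q', s')"
proof -
  let ?q = "query_size Q0" and ?m = "card Dx + card Dn"
  let ?B = "step_cost (card Dn) ?q ?m"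
  have old: "elim_invariant Q0 Dx Dn (Q, annotation s)"
    "(elim_step shapley)\<^sup>*\<^sup>* (Q0, shapley_input Dx Dn) (Q, annotation s)"
    "finite (dom (store s))" "card (dom (store s)) \<le> ?m" "query_size Q \<le> ?q" "clock s + query_size Q * ?B \<le> ?q * ?B"
    using inv by (simp_all add: machine_invariant_def Let_def)
  note elim = elim_invariant_step[OF old(1) step]
  have "card (dom (store s')) \<le> ?m"
    using card_mono[OF finite_imageI[OF old(3)] store(1)] card_image_le[OF old(3), of h] old(4) by linarith
  moreover have "finite (dom (store s'))"
    using old(3) store(1) finite_surj by blast
  moreover have "query_size Q' \<le> ?q" "clock s' + query_size Q' * ?B \<le> ?q * ?B"
  proof -
    have "Suc (query_size Q') \<le> query_size Q"
      using elim(2) by simp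
    then have "Suc (query_size Q') * ?B \<le> query_size Q * ?B"
      by (rule mult_le_mono1)
    then show "clock s' + query_size Q' * ?B \<le> ?q * ?B"
      using clock old(6) by simp
    show "query_size Q' \<le> ?q"
      using elim(2) old(5) by simp
  qed
  moreover have "(elim_step shapley)\<^sup>*\<^sup>* (Q0, shapley_input Dx Dn) (Q', annotation s')"
    using old(2) step by (rule rtranclp.rtrancl_into_rtrancl)
  ultimately show ?thesis
    using elim(1) store(2) rest unfolding machine_invariant_def Let_def prod.case by blast
qed

lemma budget_step:
  assumes inv: "machine_invariant Q0 Dx Dn (Q, s)" and step: "elim_step shapley (Q, annotation s) (Q', D')"
    and h: "h ` dom (store s) \<subseteq> facts_over Q'"
  shows "budget (card Dn) (query_size Q0) (space_bound (card Dn) (query_size Q0) (card Dx + card Dn))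
    (dom (store s) \<union> h ` dom (store s))"
proof
  let ?q = "query_size Q0" and ?m = "card Dx + card Dn"
  have old: "elim_invariant Q0 Dx Dn (Q, annotation s)" "dom (store s) \<subseteq> facts_over Q"
    "finite (dom (store s))" "card (dom (store s)) \<le> ?m" "query_size Q \<le> ?q"
    using inv by (simp_all add: machine_invariant_def Let_def)
  then have fin: "finite Q" "finite Q'"
    using elim_invariant_step(1)[OF old(1) step] by (simp_all add: elim_invariant_def sjf_bcq_def)
  have "query_size Q' \<le> ?q"
    using elim_invariant_step(2)[OF old(1) step] old(5) by simp
  then show "key_size f \<le> ?q" if "f \<in> dom (store s) \<union> h ` dom (store s)" for f
    using that h old(2,5) key_size_le_query_size[OF fin(1), of f] key_size_le_query_size[OF fin(2), of f]
    by (meson UnE le_trans subsetD)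
  show "finite (dom (store s) \<union> h ` dom (store s))"
    using old(3) by simp
  have "card (dom (store s) \<union> h ` dom (store s)) \<le> 2 * ?m"
  proof -
    have "card (dom (store s) \<union> h ` dom (store s)) \<le> card (dom (store s)) + card (h ` dom (store s))"
      by (rule card_Un_le)
    also have "\<dots> \<le> ?m + ?m"
      using card_image_le[OF old(3), of h] old(4) by (intro add_mono) (auto intro: order_trans)
    finally show ?thesis
      by simp
  qed
  then show "card (dom (store s) \<union> h ` dom (store s)) * (?q + 2 * Suc (card Dn)) + 2 * Suc (card Dn) \<le>
      space_bound (card Dn) ?q ?m"
    unfolding space_bound_def by (intro add_right_mono mult_right_mono) auto
qed

lemma length_enumerates:
  assumes "finite (dom (store s))" "enumerates xs s R"
  shows "length xs = card {f \<in> dom (store s). fst f = R}"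
proof -
  have "{f \<in> dom (store s). fst f = R} = Pair R ` set xs"
    using assms(2) by (auto simp: enumerates_def)
  moreover have "card (Pair R ` set xs) = card (set xs)"
    by (rule card_image) (simp add: inj_on_def)
  ultimately have "card {f \<in> dom (store s). fst f = R} = card (set xs)"
    by (simp only:)
  then show ?thesis
    using assms(2) by (simp add: enumerates_def distinct_card[symmetric])
qed

text \<open>Facts with different symbols are different, so each stored fact is charged once although
  rule 2 walks through two lists.\<close>

lemma length_enumerates2:
  assumes "finite (dom (store s))" "enumerates xs1 s R1" "enumerates xs2 s R2" "R1 \<noteq> R2"
  shows "length xs1 + length xs2 \<le> card (dom (store s))"
proof -
  have "length xs1 + length xs2 = card ({f \<in> dom (store s). fst f = R1} \<union> {f \<in> dom (store s). fst f = R2})"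
    using assms by (subst card_Un_disjoint) (auto simp: length_enumerates)
  also have "\<dots> \<le> card (dom (store s))"
    using assms(1) by (intro card_mono) auto
  finally show ?thesis .
qed

text \<open>Updating \<open>x'\<close> at \<open>Y\<close> is injective in the value, so the sum
  over values can be reindexed by the tuples in \<open>A\<close> that project to \<open>x'\<close>;
  the additional tuples have annotation \<open>\<zero>\<close>.\<close>

lemma rule1_annot_eq:
  fixes D :: "('r, 'v, 'd, vector) annotated"
  assumes "finite A" and A: "\<And>x. x \<in> A \<Longrightarrow> dom x = X" "\<And>x. D R x \<noteq> \<zero>\<^bsub>shapley\<^esub> \<Longrightarrow> x \<in> A" and Y: "Y \<in> X"
  shows "rule1_annot shapley D R X Y R' R' x' = (\<Oplus>\<^bsub>shapley\<^esub>x \<in> {x \<in> A. x |` (X - {Y}) = x'}. D R x)"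
proof (cases "dom x' = X - {Y}")
  case True
  let ?h = "\<lambda>y. x'(Y \<mapsto> y)"
  have eq: "{x \<in> A. x |` (X - {Y}) = x'} = ?h ` (?h -` A)"
  proof -
    have "x \<in> A \<and> x |` (X - {Y}) = x' \<longleftrightarrow> x \<in> A \<and> (\<exists>y. x = ?h y)" for x
      using restrict_map_delete_iff[OF Y, of x x'] A(1)[of x] True by metis
    then show ?thesis
      by auto
  qed
  have inj: "inj_on ?h B" for B
    by (rule inj_onI) (metis map_upd_eqD1)
  have fin: "finite (?h -` A)"
    using \<open>finite A\<close> inj by (rule finite_vimageI)
  have "(\<Oplus>\<^bsub>shapley\<^esub>y \<in> {y. D R (?h y) \<noteq> \<zero>\<^bsub>shapley\<^esub>}. D R (?h y)) = (\<Oplus>\<^bsub>shapley\<^esub>y \<in> ?h -` A. D R (?h y))"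
    using fin A(2) by (intro shapley.add.finprod_mono_neutral_cong_left) auto
  also have "\<dots> = (\<Oplus>\<^bsub>shapley\<^esub>x \<in> {x \<in> A. x |` (X - {Y}) = x'}. D R x)"
    unfolding eq by (rule shapley.finsum_reindex[symmetric], simp, rule inj)
  finally show ?thesis
    using True by (simp add: rule1_annot_def)
next
  case False
  then have "x |` (X - {Y}) \<noteq> x'" if "x \<in> A" for x
    using restrict_map_delete_iff[OF Y, of x x'] A(1)[OF that] by blast
  then have empty: "{x \<in> A. x |` (X - {Y}) = x'} = {}"
    by blast
  show ?thesis
    unfolding empty using False by (simp add: rule1_annot_def)
qed

lemma stored_if_nonzero: "annotation s R x \<noteq> \<zero>\<^bsub>shapley\<^esub> \<Longrightarrow> store s (R, x) \<noteq> None"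
  by (auto simp: annotation_def)

section \<open>Each program run simulates one elimination step\<close>

lemma machine_invariant_rule1:
  assumes inv: "machine_invariant Q0 Dx Dn (Q, s)" and r: "rule1 Q R X Y R'" and xs: "enumerates xs s R"
    and run: "run_state (rule1_program (card Dn) R X Y R' xs) (s\<lparr>clock := clock s + (query_size Q)\<^sup>2\<rparr>) = ((), s')"
  shows "machine_invariant Q0 Dx Dn (rule1_query Q R X Y R', s')"
proof -
  let ?N = "card Dn" and ?q = "query_size Q0" and ?m = "card Dx + card Dn"
  let ?Q' = "rule1_query Q R X Y R'" and ?D' = "rule1_annot shapley (annotation s) R X Y R'"
  let ?s = "s\<lparr>clock := clock s + (query_size Q)\<^sup>2\<rparr>" and ?r = "\<lambda>x. x |` (X - {Y})"
  let ?h = "\<lambda>(R0, x). if R0 = R then (R', ?r x) else (R0, x)"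
  have old: "elim_invariant Q0 Dx Dn (Q, annotation s)" "dom (store s) \<subseteq> facts_over Q"
    "finite (dom (store s))" "card (dom (store s)) \<le> ?m" "query_size Q \<le> ?q"
    "\<forall>v \<in> ran (store s). dom v \<subseteq> set (indices ?N)" "dom (work s) \<subseteq> set (indices ?N)" "peak s \<le> space_bound ?N ?q ?m"
    using inv by (simp_all add: machine_invariant_def Let_def)
  then have sjf: "sjf_bcq Q"
    by (simp add: elim_invariant_def)
  have RX: "(R, X) \<in> Q" and Y: "Y \<in> X" and fresh: "R' \<notin> fst ` Q"
    using r by (simp_all add: rule1_def)
  have "R' \<noteq> R"
    using fresh_not_mem[OF fresh, of X] RX by metis
  have stored: "(R0, dom x) \<in> Q" if "store s (R0, x) \<noteq> None" for R0 x
    using that old(2) mem_facts_over[of R0 x Q] by blast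
  have xs_iff: "x \<in> set xs \<longleftrightarrow> store s (R, x) \<noteq> None" for x
    using xs by (auto simp: enumerates_def)
  have dom_xs: "dom x = X" if "x \<in> set xs" for x
    using stored that sjf_bcq_unique[OF sjf RX] xs_iff by metis
  have h: "?h ` dom (store s) \<subseteq> facts_over ?Q'"
  proof (rule image_subsetI)
    fix f assume f: "f \<in> dom (store s)"
    obtain R0 x where Rx: "f = (R0, x)"
      by fastforce
    show "?h f \<in> facts_over ?Q'"
    proof (cases "R0 = R")
      case True
      have "store s (R0, x) \<noteq> None"
        using f Rx by auto
      with True have "dom x = X"
        using xs_iff dom_xs by blast
      then have "dom (?r x) = X - {Y}"
        by auto
      with True show ?thesis
        by (simp add: Rx mem_facts_over rule1_query_def)
    next
      case False
      then show ?thesis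
        using stored[of R0 x] f by (auto simp: Rx mem_facts_over rule1_query_def)
    qed
  qed
  have step: "elim_step shapley (Q, annotation s) (?Q', ?D')"
    using r by (rule elim_step.intros)
  interpret budget ?N ?q "space_bound ?N ?q ?m" "dom (store s) \<union> ?h ` dom (store s)"
    using inv step h by (rule budget_step)
  have h_new: "(R', ?r x) \<in> ?h ` dom (store s)" if "x \<in> set xs" for x
    using that xs_iff by (intro image_eqI[of _ _ "(R, x)"]) auto
  have "wp (rule1_program ?N R X Y R' xs) (\<lambda>_ s'. fits s' \<and>
    (\<forall>x. store s' (R, x) = None) \<and> (\<forall>R0 x. R0 \<noteq> R \<longrightarrow> R0 \<noteq> R' \<longrightarrow> store s' (R0, x) = store ?s (R0, x)) \<and>
    (\<forall>x'. annotation s' R' x' = cut_off ?N (\<Oplus>\<^bsub>shapley\<^esub>x \<in> {x \<in> set xs. ?r x = x'}. annotation ?s R x)) \<and>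
    (\<forall>x'. store s' (R', x') \<noteq> None \<longrightarrow> x' \<in> ?r ` set xs) \<and>
    clock s' \<le> clock ?s + length xs * rule_cost ?N ?q) ?s"
  proof (rule wp_rule1_program[OF _ \<open>R' \<noteq> R\<close>])
    show "fits ?s"
      using old by (simp add: fits_def)
    show "store ?s (R', x) = None" for x
      using stored[of R' x] fresh_not_mem[OF fresh, of "dom x"] by (cases "store s (R', x)") simp_all
    show "enumerates xs ?s R"
      using xs by (simp add: enumerates_def)
  qed (use h_new in blast)
  then have fits: "fits s'" and none: "store s' (R, x) = None"
    and other: "R0 \<noteq> R \<Longrightarrow> R0 \<noteq> R' \<Longrightarrow> store s' (R0, x) = store s (R0, x)"
    and ann: "annotation s' R' x' = cut_off ?N (\<Oplus>\<^bsub>shapley\<^esub>x \<in> {x \<in> set xs. ?r x = x'}. annotation s R x)"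
    and new: "store s' (R', x') \<noteq> None \<Longrightarrow> x' \<in> ?r ` set xs"
    and clock: "clock s' \<le> clock s + (query_size Q)\<^sup>2 + length xs * rule_cost ?N ?q" for R0 x x'
    unfolding wp_def run by (simp_all add: annotation_clock)
  have "annotation s' = ?D'"
  proof (intro ext)
    fix R0 x k
    consider "R0 = R'" | "R0 = R" "R0 \<noteq> R'" | "R0 \<noteq> R" "R0 \<noteq> R'"
      by blast
    then have "annotation s' R0 x = ?D' R0 x"
    proof cases
      case 1
      have "?D' R' x = (\<Oplus>\<^bsub>shapley\<^esub>y \<in> {y \<in> set xs. ?r y = x}. annotation s R y)"
        using dom_xs xs_iff stored_if_nonzero Y by (intro rule1_annot_eq) auto
      then have "annotation s' R' x = cut_off ?N (?D' R' x)"
        by (simp only: ann)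
      also have "\<dots> = ?D' R' x"
        using elim_invariant_support[OF elim_invariant_step(1)[OF old(1) step]] by (auto simp: cut_off_def fun_eq_iff)
      finally show ?thesis
        by (simp only: 1)
    next
      case 2
      then show ?thesis
        by (simp add: annotation_def none rule1_annot_def)
    next
      case 3
      then show ?thesis
        by (simp add: annotation_def other rule1_annot_def)
    qed
    then show "annotation s' R0 x k = ?D' R0 x k"
      by simp
  qed
  moreover have "dom (store s') \<subseteq> ?h ` dom (store s)"
  proof
    fix f assume f: "f \<in> dom (store s')"
    obtain R0 x where Rx: "f = (R0, x)"
      by fastforce
    consider "R0 = R'" | "R0 \<noteq> R" "R0 \<noteq> R'"
      using f none Rx by force
    then show "f \<in> ?h ` dom (store s)"
    proof cases
      case 1
      then obtain y where "y \<in> set xs" "x = ?r y"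
        using f new[of x] Rx by auto
      then show ?thesis
        using h_new Rx 1 by simp
    next
      case 2
      then show ?thesis
        using f other Rx by (intro image_eqI[of _ _ "(R0, x)"]) auto
    qed
  qed
  moreover from this have "dom (store s') \<subseteq> facts_over ?Q'"
    using h by (rule order_trans)
  moreover have "clock s' \<le> clock s + step_cost ?N ?q ?m"
  proof -
    have "length xs \<le> ?m"
      using length_enumerates[OF old(3) xs] card_mono[OF old(3), of "{f \<in> dom (store s). fst f = R}"] old(4) by simp
    then have "length xs * rule_cost ?N ?q \<le> ?m * rule_cost ?N ?q" "(query_size Q)\<^sup>2 \<le> ?q\<^sup>2"
      using old(5) by (simp_all add: mult_le_mono1 power_mono)
    then show ?thesis
      using clock unfolding step_cost_def by linarith
  qed
  ultimately show ?thesis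
    using fits step unfolding fits_def by (intro machine_invariant_next[OF inv]) auto
qed

lemma machine_invariant_rule2:
  assumes inv: "machine_invariant Q0 Dx Dn (Q, s)" and r: "rule2 Q R1 R2 X R'"
    and xs: "enumerates xs1 s R1" "enumerates xs2 s R2"
    and run: "run_state (rule2_program (card Dn) R1 R2 R' xs1 xs2) (s\<lparr>clock := clock s + (query_size Q)\<^sup>2\<rparr>) = ((), s')"
  shows "machine_invariant Q0 Dx Dn (rule2_query Q R1 R2 X R', s')"
proof -
  let ?N = "card Dn" and ?q = "query_size Q0" and ?m = "card Dx + card Dn"
  let ?Q' = "rule2_query Q R1 R2 X R'" and ?D' = "rule2_annot shapley (annotation s) R1 R2 X R'"
  let ?s = "s\<lparr>clock := clock s + (query_size Q)\<^sup>2\<rparr>"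
  let ?h = "\<lambda>(R0, x). if R0 = R1 \<or> R0 = R2 then (R', x) else (R0, x)"
  have old: "elim_invariant Q0 Dx Dn (Q, annotation s)" "dom (store s) \<subseteq> facts_over Q"
    "finite (dom (store s))" "card (dom (store s)) \<le> ?m" "query_size Q \<le> ?q"
    "\<forall>v \<in> ran (store s). dom v \<subseteq> set (indices ?N)" "dom (work s) \<subseteq> set (indices ?N)" "peak s \<le> space_bound ?N ?q ?m"
    using inv by (simp_all add: machine_invariant_def Let_def)
  then have sjf: "sjf_bcq Q"
    by (simp add: elim_invariant_def)
  have RX: "(R1, X) \<in> Q" "(R2, X) \<in> Q" "R1 \<noteq> R2" and fresh: "R' \<notin> fst ` Q"
    using r by (simp_all add: rule2_def)
  have R': "R' \<noteq> R1" "R' \<noteq> R2"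
    using fresh_not_mem[OF fresh, of X] RX by metis+
  have stored: "(R0, dom x) \<in> Q" if "store s (R0, x) \<noteq> None" for R0 x
    using that old(2) mem_facts_over[of R0 x Q] by blast
  have xs_iff: "x \<in> set xs1 \<longleftrightarrow> store s (R1, x) \<noteq> None" "x \<in> set xs2 \<longleftrightarrow> store s (R2, x) \<noteq> None" for x
    using xs by (auto simp: enumerates_def)
  have dom_xs: "dom x = X" if "x \<in> set xs1 \<union> set xs2" for x
    using stored that sjf_bcq_unique[OF sjf RX(1)] sjf_bcq_unique[OF sjf RX(2)] xs_iff by (metis UnE)
  have h: "?h ` dom (store s) \<subseteq> facts_over ?Q'"
  proof (rule image_subsetI)
    fix f assume f: "f \<in> dom (store s)"
    obtain R0 x where Rx: "f = (R0, x)"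
      by fastforce
    show "?h f \<in> facts_over ?Q'"
    proof (cases "R0 = R1 \<or> R0 = R2")
      case True
      have "store s (R0, x) \<noteq> None"
        using f Rx by auto
      with True have "x \<in> set xs1 \<union> set xs2"
        using xs_iff by blast
      then have "dom x = X"
        by (rule dom_xs)
      with True show ?thesis
        by (simp add: Rx mem_facts_over rule2_query_def)
    next
      case False
      then show ?thesis
        using stored[of R0 x] f by (auto simp: Rx mem_facts_over rule2_query_def)
    qed
  qed
  have step: "elim_step shapley (Q, annotation s) (?Q', ?D')"
    using r by (rule elim_step.intros)
  interpret budget ?N ?q "space_bound ?N ?q ?m" "dom (store s) \<union> ?h ` dom (store s)"
    using inv step h by (rule budget_step)
  have h_new: "(R', x) \<in> ?h ` dom (store s)" if x: "x \<in> set xs1 \<union> set xs2" for x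
  proof -
    have "store s (R1, x) \<noteq> None \<or> store s (R2, x) \<noteq> None"
      using x by (simp only: xs_iff Un_iff)
    then have "(R1, x) \<in> dom (store s) \<or> (R2, x) \<in> dom (store s)"
      by (simp only: domIff)
    moreover have "(R', x) = ?h (R1, x)" "(R', x) = ?h (R2, x)"
      by simp_all
    ultimately show ?thesis
      by (elim disjE) (rule image_eqI, assumption, assumption)+
  qed
  have "wp (rule2_program ?N R1 R2 R' xs1 xs2) (\<lambda>_ s'. fits s' \<and>
    (\<forall>x. store s' (R1, x) = None \<and> store s' (R2, x) = None) \<and>
    (\<forall>R0 x. R0 \<noteq> R1 \<longrightarrow> R0 \<noteq> R2 \<longrightarrow> R0 \<noteq> R' \<longrightarrow> store s' (R0, x) = store ?s (R0, x)) \<and>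
    (\<forall>x. annotation s' R' x = cut_off ?N (convolution (\<and>) (annotation ?s R1 x) (annotation ?s R2 x))) \<and>
    (\<forall>x. store s' (R', x) \<noteq> None \<longrightarrow> x \<in> set xs1 \<union> set xs2) \<and>
    clock s' \<le> clock ?s + (length xs1 + length xs2) * rule_cost ?N ?q) ?s"
  proof (rule wp_rule2_program[OF _ R'])
    show "fits ?s"
      using old by (simp add: fits_def)
    show "store ?s (R', x) = None" for x
      using stored[of R' x] fresh_not_mem[OF fresh, of "dom x"] by (cases "store s (R', x)") simp_all
    show "enumerates xs1 ?s R1" "enumerates xs2 ?s R2"
      using xs by (simp_all add: enumerates_def)
    \<comment> \<open>A tuple may be stored for only one of the two symbols; the bound holds for
      both because the atoms share the variable set \<open>X\<close>.\<close>
    show "key_size (R1, x) \<le> ?q \<and> key_size (R2, x) \<le> ?q" if "x \<in> set xs1 \<union> set xs2" for x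
    proof -
      have "finite Q"
        using sjf by (simp add: sjf_bcq_def)
      moreover have "(R1, x) \<in> facts_over Q" "(R2, x) \<in> facts_over Q"
        using dom_xs[OF that] RX by (simp_all add: mem_facts_over)
      ultimately show ?thesis
        using key_size_le_query_size old(5) le_trans by blast
    qed
  qed (use h_new in blast)
  then have fits: "fits s'" and none: "store s' (R1, x) = None" "store s' (R2, x) = None"
    and other: "R0 \<noteq> R1 \<Longrightarrow> R0 \<noteq> R2 \<Longrightarrow> R0 \<noteq> R' \<Longrightarrow> store s' (R0, x) = store s (R0, x)"
    and ann: "annotation s' R' x = cut_off ?N (convolution (\<and>) (annotation s R1 x) (annotation s R2 x))"
    and new: "store s' (R', x) \<noteq> None \<Longrightarrow> x \<in> set xs1 \<union> set xs2"
    and clock: "clock s' \<le> clock s + (query_size Q)\<^sup>2 + (length xs1 + length xs2) * rule_cost ?N ?q" for R0 x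
    unfolding wp_def run by (simp_all add: annotation_clock)
  have "annotation s' = ?D'"
  proof (intro ext)
    fix R0 x k
    consider "R0 = R'" | "R0 = R1 \<or> R0 = R2" "R0 \<noteq> R'" | "R0 \<noteq> R1" "R0 \<noteq> R2" "R0 \<noteq> R'"
      by blast
    then have "annotation s' R0 x = ?D' R0 x"
    proof cases
      case 1
      have "?D' R' x = convolution (\<and>) (annotation s R1 x) (annotation s R2 x)"
      proof (cases "dom x = X")
        case False
        then have "x \<notin> set xs1 \<union> set xs2"
          using dom_xs by blast
        then have "store s (R1, x) = None" "store s (R2, x) = None"
          by (simp_all add: xs_iff)
        then have "annotation s R1 x = \<zero>\<^bsub>shapley\<^esub>" "annotation s R2 x = \<zero>\<^bsub>shapley\<^esub>"
          by (simp_all add: annotation_def)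
        then show ?thesis
          using False shapley.zero_times_zero by (simp add: rule2_annot_def shapley_simps(1))
      qed (simp add: rule2_annot_def shapley_simps(1))
      then have "annotation s' R' x = cut_off ?N (?D' R' x)"
        by (simp only: ann)
      also have "\<dots> = ?D' R' x"
        using elim_invariant_support[OF elim_invariant_step(1)[OF old(1) step]] by (auto simp: cut_off_def fun_eq_iff)
      finally show ?thesis
        by (simp only: 1)
    next
      case 2
      then show ?thesis
        by (auto simp: annotation_def none rule2_annot_def)
    next
      case 3
      then show ?thesis
        by (simp add: annotation_def other rule2_annot_def)
    qed
    then show "annotation s' R0 x k = ?D' R0 x k"
      by simp
  qed
  moreover have "dom (store s') \<subseteq> ?h ` dom (store s)"
  proof
    fix f assume f: "f \<in> dom (store s')"
    obtain R0 x where Rx: "f = (R0, x)"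
      by fastforce
    consider "R0 = R'" | "R0 \<noteq> R1" "R0 \<noteq> R2" "R0 \<noteq> R'"
      using f none Rx by force
    then show "f \<in> ?h ` dom (store s)"
    proof cases
      case 1
      then show ?thesis
        using f new[of x] Rx h_new[of x] by auto
    next
      case 2
      then show ?thesis
        using f other Rx by (intro image_eqI[of _ _ "(R0, x)"]) auto
    qed
  qed
  moreover from this have "dom (store s') \<subseteq> facts_over ?Q'"
    using h by (rule order_trans)
  moreover have "clock s' \<le> clock s + step_cost ?N ?q ?m"
  proof -
    have "length xs1 + length xs2 \<le> ?m"
      using length_enumerates2[OF old(3) xs RX(3)] old(4) by simp
    then have "(length xs1 + length xs2) * rule_cost ?N ?q \<le> ?m * rule_cost ?N ?q" "(query_size Q)\<^sup>2 \<le> ?q\<^sup>2"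
      using old(5) by (simp_all only: mult_le_mono1 power_mono zero_le)
    then show ?thesis
      using clock unfolding step_cost_def by linarith
  qed
  ultimately show ?thesis
    using fits step unfolding fits_def by (intro machine_invariant_next[OF inv]) auto
qed

lemma machine_invariant_step:
  assumes inv: "machine_invariant Q0 Dx Dn c" and step: "machine_step (card Dn) c c'"
  shows "machine_invariant Q0 Dx Dn c'" "query_size (fst c') < query_size (fst c)"
proof -
  show "machine_invariant Q0 Dx Dn c'"
    using step inv by cases (auto intro: machine_invariant_rule1 machine_invariant_rule2)
  have "sjf_bcq (fst c)"
    using inv by (auto simp: machine_invariant_def elim_invariant_def Let_def)
  show "query_size (fst c') < query_size (fst c)"
    using step
  proof (cases rule: machine_step.cases)
    case (1 Q R X Y R')
    with \<open>sjf_bcq (fst c)\<close> show ?thesis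
      using query_size_rule1 by simp
  next
    case (2 Q R1 R2 X R')
    with \<open>sjf_bcq (fst c)\<close> show ?thesis
      using query_size_rule2 by simp
  qed
qed

lemma ex_enumerates: "finite (dom (store s)) \<Longrightarrow> \<exists>xs. enumerates xs s R"
proof -
  assume "finite (dom (store s))"
  then have "finite (Pair R -` dom (store s))"
    by (rule finite_vimageI) (simp add: inj_on_def)
  then show ?thesis
    using finite_distinct_list by (fastforce simp: enumerates_def vimage_def)
qed

text \<open>The stored tuples can be listed and the programs are total, so the machine never gets
  stuck before the abstract algorithm does.\<close>

lemma machine_step_if_elim_step:
  assumes "finite (dom (store s))" "elim_step shapley (Q, annotation s) c"
  shows "\<exists>c'. machine_step N (Q, s) c'"
  using assms(2)
proof cases
  case (1 R X Y R')
  obtain xs where "enumerates xs s R"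
    using ex_enumerates[OF assms(1)] by blast
  with 1 show ?thesis
    by (metis machine_step.intros(1) old.unit.exhaust surj_pair)
next
  case (2 R1 R2 X R')
  obtain xs1 xs2 where "enumerates xs1 s R1" "enumerates xs2 s R2"
    using ex_enumerates[OF assms(1)] by blast
  with 2 show ?thesis
    by (metis machine_step.intros(2) old.unit.exhaust surj_pair)
qed

text \<open>From \<open>Suc N \<le> 2 * n\<close>, the summands of \<open>rule_cost\<close> give
  \<open>n\<^sup>2\<close> times \<open>32*q + 144 + 32 + 3*q + 3\<close>, that is
  \<open>35*q + 179\<close>; \<open>q\<^sup>2\<close> is the selection cost, and the factor
  \<open>q\<close> bounds the number of steps. In the space bound, \<open>2*q + 8\<close> comes from
  the stored vectors and 4 from the work vector. \<open>C\<close> adds both constants.\<close>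

lemma cost_bounds:
  fixes N q m :: nat
  defines "M \<equiv> max 1 m" and "n \<equiv> max 1 N"
    and "C \<equiv> q * (q\<^sup>2 + 35 * q + 179) + 2 * q + 12"
  shows "q * step_cost N q m \<le> C * (M * n\<^sup>2)" "space_bound N q m \<le> C * (M * n)"
proof -
  have n: "Suc N \<le> 2 * n" "1 \<le> n" "1 \<le> M" "m \<le> M"
    by (simp_all add: n_def M_def)
  have sq: "(Suc N)\<^sup>2 \<le> 4 * n\<^sup>2" "n \<le> n\<^sup>2" "1 \<le> n\<^sup>2" "1 \<le> M * n\<^sup>2"
    using power_mono[OF n(1), of 2] n(2,3) by (simp_all add: power_mult_distrib power2_nat_le_eq_le self_le_power)
  have "rule_cost N q = 4 * (Suc N)\<^sup>2 * (2 * q + 9) + 16 * Suc N + 3 * q + 3"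
    by (simp add: rule_cost_def convolve_cost_def power2_eq_square algebra_simps)
  also have "\<dots> \<le> 4 * (4 * n\<^sup>2) * (2 * q + 9) + 16 * (2 * n\<^sup>2) + 3 * q * n\<^sup>2 + 3 * n\<^sup>2"
  proof -
    have "4 * (Suc N)\<^sup>2 * (2 * q + 9) \<le> 4 * (4 * n\<^sup>2) * (2 * q + 9)"
      using sq(1) by (intro mult_le_mono1 mult_le_mono2)
    moreover have "16 * Suc N \<le> 16 * (2 * n\<^sup>2)"
      by (intro mult_le_mono2 order_trans[OF n(1)] sq(2))
    moreover have "3 * q \<le> 3 * q * n\<^sup>2"
      using sq(3) by simp
    ultimately show ?thesis
      using sq(3) by linarith
  qed
  also have "\<dots> = n\<^sup>2 * (35 * q + 179)"
    by (simp add: algebra_simps)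
  finally have rc: "rule_cost N q \<le> n\<^sup>2 * (35 * q + 179)" .
  have "step_cost N q m \<le> q\<^sup>2 * (M * n\<^sup>2) + M * (n\<^sup>2 * (35 * q + 179))"
    unfolding step_cost_def using sq(4) n(4) rc by (intro add_mono mult_mono) auto
  also have "\<dots> = (q\<^sup>2 + 35 * q + 179) * (M * n\<^sup>2)"
    by (simp add: algebra_simps)
  finally have "q * step_cost N q m \<le> q * ((q\<^sup>2 + 35 * q + 179) * (M * n\<^sup>2))"
    by (rule mult_le_mono2)
  also have "\<dots> \<le> C * (M * n\<^sup>2)"
    unfolding C_def mult.assoc[symmetric, of q] by (intro mult_right_mono) simp_all
  finally show "q * step_cost N q m \<le> C * (M * n\<^sup>2)" .
  have "q \<le> q * n" "2 * Suc N \<le> 2 * (2 * n) * M"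
    using n(1-3) mult_le_mono[of "2 * Suc N" "2 * (2 * n)" 1 M] by simp_all
  moreover from this(1) have "2 * m * (q + 2 * Suc N) \<le> 2 * M * (q * n + 2 * (2 * n))"
    using n(1,4) by (intro mult_le_mono add_mono) simp_all
  ultimately have "space_bound N q m \<le> 2 * M * (q * n + 2 * (2 * n)) + 2 * (2 * n) * M"
    unfolding space_bound_def by (intro add_mono)
  also have "\<dots> = (2 * q + 12) * (M * n)"
    by (simp add: algebra_simps)
  also have "\<dots> \<le> C * (M * n)"
    unfolding C_def by (intro mult_right_mono) simp_all
  finally show "space_bound N q m \<le> C * (M * n)" .
qed

theorem theorem5p16:
  fixes Q :: "('r, 'v) query"
  assumes "infinite (UNIV :: 'r set)"
    and "countable (UNIV :: 'd set)" and "infinite (UNIV :: 'd set)"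
    and "sjf_bcq Q" and "hierarchical Q"
  shows "\<exists>C :: nat. \<forall>Dx Dn :: ('r, 'v, 'd) fact set.
    database Q Dx \<and> database Q Dn \<and> Dx \<inter> Dn = {} \<longrightarrow>
    (let psi = shapley_input Dx Dn; size = max 1 (card Dx + card Dn); n = max 1 (card Dn) in
      always_ends (elim_step shapley)
        (\<lambda>c. \<exists>q. outputs c q \<and> (\<forall>i. q (i, True) = num_sat Q Dx Dn i))
        (Q, psi) \<and>
      always_ends (machine_step (card Dn))
        (\<lambda>(Q', s). \<exists>q. (elim_step shapley)\<^sup>*\<^sup>* (Q, psi) (Q', annotation s) \<and>
           outputs (Q', annotation s) q \<and> (\<forall>i. q (i, True) = num_sat Q Dx Dn i) \<and>
           clock s \<le> C * (size * n\<^sup>2) \<and> peak s \<le> C * (size * n))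
        (Q, load (card Dn) psi))"
proof -
  let ?q = "query_size Q"
  \<comment> \<open>The constant of \<open>cost_bounds\<close>; it involves only the size of the
    query and can be chosen before the instances.\<close>
  let ?C = "?q * (?q\<^sup>2 + 35 * ?q + 179) + 2 * ?q + 12"
  have "always_ends (elim_step shapley) (\<lambda>c. \<exists>q. outputs c q \<and> (\<forall>i. q (i, True) = num_sat Q Dx Dn i))
      (Q, shapley_input Dx Dn) \<and>
    always_ends (machine_step (card Dn))
      (\<lambda>(Q', s). \<exists>q. (elim_step shapley)\<^sup>*\<^sup>* (Q, shapley_input Dx Dn) (Q', annotation s) \<and>
         outputs (Q', annotation s) q \<and> (\<forall>i. q (i, True) = num_sat Q Dx Dn i) \<and>
         clock s \<le> ?C * (max 1 (card Dx + card Dn) * (max 1 (card Dn))\<^sup>2) \<and>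
         peak s \<le> ?C * (max 1 (card Dx + card Dn) * max 1 (card Dn)))
      (Q, load (card Dn) (shapley_input Dx Dn))" (is "?E \<and> ?M")
    if "database Q Dx" "database Q Dn" "Dx \<inter> Dn = {}" for Dx Dn :: "('r, 'v, 'd) fact set"
  proof
    show ?E
    proof (rule always_ends_measure[where I = "elim_invariant Q Dx Dn" and \<mu> = "\<lambda>c. query_size (fst c)"])
      show "elim_invariant Q Dx Dn (Q, shapley_input Dx Dn)"
        using assms(4,5) that by (rule elim_invariant_init)
    next
      fix c c' assume "elim_invariant Q Dx Dn c" "elim_step shapley c c'"
      from elim_invariant_step[OF this]
      show "elim_invariant Q Dx Dn c' \<and> query_size (fst c') < query_size (fst c)"
        by (rule conjI)
    next
      fix c assume "elim_invariant Q Dx Dn c" "\<nexists>c'. elim_step shapley c c'"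
      then show "\<exists>q. outputs c q \<and> (\<forall>i. q (i, True) = num_sat Q Dx Dn i)"
        by (cases c) (auto dest: elim_invariant_final[OF assms(1)])
    qed
    show ?M
    proof (rule always_ends_measure[where I = "machine_invariant Q Dx Dn" and \<mu> = "\<lambda>c. query_size (fst c)"])
      show "machine_invariant Q Dx Dn (Q, load (card Dn) (shapley_input Dx Dn))"
        using assms(4,5) that by (rule machine_invariant_init)
    next
      fix c c' assume "machine_invariant Q Dx Dn c" "machine_step (card Dn) c c'"
      from machine_invariant_step[OF this]
      show "machine_invariant Q Dx Dn c' \<and> query_size (fst c') < query_size (fst c)"
        by (rule conjI)
    next
      fix c assume inv: "machine_invariant Q Dx Dn c" and stuck: "\<nexists>c'. machine_step (card Dn) c c'"
      obtain Q' s where c: "c = (Q', s)"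
        by fastforce
      let ?m = "card Dx + card Dn"
      have inv: "elim_invariant Q Dx Dn (Q', annotation s)"
        "(elim_step shapley)\<^sup>*\<^sup>* (Q, shapley_input Dx Dn) (Q', annotation s)" "finite (dom (store s))"
        "peak s \<le> space_bound (card Dn) ?q ?m"
        "clock s + query_size Q' * step_cost (card Dn) ?q ?m \<le> ?q * step_cost (card Dn) ?q ?m"
        using inv by (simp_all add: c machine_invariant_def Let_def)
      \<comment> \<open>A stuck machine means a stuck algorithm, so the abstract correctness
        statement applies to the annotation read off the final memory.\<close>
      have "\<nexists>c'. elim_step shapley (Q', annotation s) c'"
        using stuck machine_step_if_elim_step[OF inv(3)] unfolding c by blast
      from elim_invariant_final[OF assms(1) inv(1) this] obtain q
        where "outputs (Q', annotation s) q" "\<forall>i. q (i, True) = num_sat Q Dx Dn i"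
        by blast
      moreover have "clock s \<le> ?q * step_cost (card Dn) ?q ?m"
        using inv(5) by linarith
      ultimately show "case c of (Q', s) \<Rightarrow> \<exists>q.
         (elim_step shapley)\<^sup>*\<^sup>* (Q, shapley_input Dx Dn) (Q', annotation s) \<and>
         outputs (Q', annotation s) q \<and> (\<forall>i. q (i, True) = num_sat Q Dx Dn i) \<and>
         clock s \<le> ?C * (max 1 (card Dx + card Dn) * (max 1 (card Dn))\<^sup>2) \<and>
         peak s \<le> ?C * (max 1 (card Dx + card Dn) * max 1 (card Dn))"
        unfolding c prod.case
        using inv(2) order_trans[OF _ cost_bounds(1)] order_trans[OF inv(4) cost_bounds(2)] by blast
    qed
  qed
  then show ?thesis
    unfolding Let_def by (intro exI[of _ ?C] allI impI) blast
qed

end
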